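(* Let $X$ be a continuum with compact universal cover $\widehat{\phi}:\widehat{X}\to X=\widehat{X}/\pi_P(X)$. If $f:Y\to X=Y/G$ is a generalized regular covering map with $Y$ a continuum, then there is a unique (mod $G$) generalized regular covering map $f_L:\widehat{X}\to Y$ (called the lift of $f$) such that $\widehat{\phi}=f\circ f_L$.
   Context: "Unique (mod $G$)" means that the set of all maps with the stated properties is exactly $\{g\circ f_L:g\in G\}$. A continuum is a compact, connected, metrizable space. A regular covering map $f:Y\to X=Y/G$ between topological spaces is a covering map that is also the quotient map of a free action of a group $G$ of homeomorphisms of $Y$. A cover of $X$ by a continuum is a regular covering map $f:Y\to X$ with $Y$ a continuum. Uniform spaces: a uniform space is a topological space with a compatible uniformity, whose entourages are taken to be symmetric; a compact space carries its unique compatible uniformity. For a map $g$ and $E\subset Y\times Y$, $g(E)$ means $(g\times g)(E)$. A group $G$ of bijections of a uniform space $Y$ acts isomorphically if $Y$ has a basis of entourages $E$ with $g(E)=E$ for all $g\in G$; $Y/G$ then has the quotient uniformity, consisting of the images of entourages. For an entourage $E$ let $U_E(G)=\{g\in G:(y,g(y))\in E\ \forall y\in Y\}$, $S_E(G)=\{g\in G:(y,g(y))\in E\text{ for some }y\in Y\}$, and $N_E(G)$ the subgroup generated by $S_E(G)$. $G$ acts prodiscretely if for every entourage $E$ there is an entourage $F$ with $N_F(G)\subset U_E(G)$. $G$ has the topology (and uniformity) of uniform convergence, for which the $U_E(G)$ form a basis at the identity. A generalized regular covering map $f:Y\to X=Y/G$ with deck group $G$ is the quotient map of an isomorphic and prodiscrete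 action of a complete group $G$ on $Y$ (with $X$ identified with $Y/G$). Compact universal cover: two covers $f_1:Y_1\to X=Y_1/G_1$, $f_2:Y_2\to X=Y_2/G_2$ are equivalent if there are a homeomorphism $h:Y_1\to Y_2$ and an isomorphism $\theta:G_1\to G_2$ with $f_2\circ h=f_1$ and $h\circ g=\theta(g)\circ h$ for all $g\in G_1$. Let $\{f_i:X_i\to X=X_i/G_i\}$ be the family of all covers of $X$ by continua, one from each equivalence class, with basepoints $*$ in $X$ and the $X_i$ such that $f_i( * )=*$. Write $f_i\leq f_j$ if there is a continuous surjection $f_{ij}:X_j\to X_i$ with $f_j=f_i\circ f_{ij}$; this is a directed order, the basepoint preserving $f_{ij}$ is unique, and there are homomorphisms $\theta_{ij}:G_j\to G_i$ with $\theta_{ij}(g)\circ f_{ij}=f_{ij}\circ g$. Put $\widehat{X}=\varprojlim X_i$ and $\pi_P(X)=\varprojlim G_i$, acting coordinatewise on $\widehat{X}$; $\widehat{\phi}:\widehat{X}\to X=\widehat{X}/\pi_P(X)$ is the projection, a generalized regular covering map. *)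

theory Defs
  imports "HOL-Analysis.Analysis" "HOL-Algebra.Bij" "HOL-Algebra.Generated_Groups"
begin

definition continuum :: "'a topology \<Rightarrow> bool" where
  "continuum X \<longleftrightarrow> compact_space X \<and> connected_space X \<and> metrizable_space X"


section \<open>Groups of transformations and regular covering maps\<close>

text \<open>
  A group acting (effectively) on a set \<open>S\<close> is a subgroup of the library's group
  \<^const>\<open>BijGroup\<close> of bijections of \<open>S\<close>. Its elements are functions that are
  \<^const>\<open>undefined\<close> outside \<open>S\<close>, so equality of group elements is equality on \<open>S\<close>.
\<close>

text \<open>\<open>T\<close> is identified with the orbit set \<open>S/G\<close> by means of \<open>f\<close>.\<close>

definition orbit_map :: "'a set \<Rightarrow> 'b set \<Rightarrow> ('a \<Rightarrow> 'a) set \<Rightarrow> ('a \<Rightarrow> 'b) \<Rightarrow> bool" where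
  "orbit_map S T G f \<longleftrightarrow>
     f ` S = T \<and> (\<forall>x\<in>S. \<forall>y\<in>S. f x = f y \<longleftrightarrow> (\<exists>g\<in>G. g x = y))"

definition free_action :: "'a set \<Rightarrow> ('a \<Rightarrow> 'a) set \<Rightarrow> bool" where
  "free_action S G \<longleftrightarrow> (\<forall>g\<in>G. \<forall>y\<in>S. g y = y \<longrightarrow> g = \<one>\<^bsub>BijGroup S\<^esub>)"

text \<open>The counterpart of \<^const>\<open>covering_space\<close> for abstract topologies.\<close>

definition covering_map :: "'a topology \<Rightarrow> 'b topology \<Rightarrow> ('a \<Rightarrow> 'b) \<Rightarrow> bool" where
  "covering_map Y X f \<longleftrightarrow>
     continuous_map Y X f \<and> f ` topspace Y = topspace X \<and>
     (\<forall>x\<in>topspace X. \<exists>U. x \<in> U \<and> openin X U \<and>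
        (\<exists>\<V>. \<Union>\<V> = topspace Y \<inter> f -` U \<and> pairwise disjnt \<V> \<and>
             (\<forall>V\<in>\<V>. openin Y V \<and>
                 homeomorphic_map (subtopology Y V) (subtopology X U) f)))"

definition regular_covering_map ::
    "'a topology \<Rightarrow> 'b topology \<Rightarrow> ('a \<Rightarrow> 'a) set \<Rightarrow> ('a \<Rightarrow> 'b) \<Rightarrow> bool" where
  "regular_covering_map Y X G f \<longleftrightarrow>
     subgroup G (BijGroup (topspace Y)) \<and>
     (\<forall>g\<in>G. homeomorphic_map Y Y g) \<and>
     free_action (topspace Y) G \<and>
     covering_map Y X f \<and>
     quotient_map Y X f \<and> orbit_map (topspace Y) (topspace X) G f"

definition continuum_cover ::
    "'a topology \<Rightarrow> 'b topology \<Rightarrow> ('b \<Rightarrow> 'b) set \<Rightarrow> ('b \<Rightarrow> 'a) \<Rightarrow> bool" where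
  "continuum_cover X Y G f \<longleftrightarrow> continuum Y \<and> regular_covering_map Y X G f"


section \<open>Uniform spaces\<close>

text \<open>
  A uniformity on \<open>S\<close> is represented by the set of its symmetric entourages. We do not use
  \<^class>\<open>uniform_space\<close>, because the carriers below are not whole types.
\<close>

definition is_uniformity :: "'a set \<Rightarrow> ('a \<times> 'a) set set \<Rightarrow> bool" where
  "is_uniformity S \<U> \<longleftrightarrow>
     \<U> \<noteq> {} \<and>
     (\<forall>E\<in>\<U>. E \<subseteq> S \<times> S \<and> Id_on S \<subseteq> E \<and> sym E) \<and>
     (\<forall>E\<in>\<U>. \<forall>F\<in>\<U>. E \<inter> F \<in> \<U>) \<and>
     (\<forall>E\<in>\<U>. \<forall>F. E \<subseteq> F \<and> F \<subseteq> S \<times> S \<and> sym F \<longrightarrow> F \<in> \<U>) \<and>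
     (\<forall>E\<in>\<U>. \<exists>F\<in>\<U>. F O F \<subseteq> E)"

definition compatible_uniformity :: "'a topology \<Rightarrow> ('a \<times> 'a) set set \<Rightarrow> bool" where
  "compatible_uniformity X \<U> \<longleftrightarrow>
     is_uniformity (topspace X) \<U> \<and>
     (\<forall>W. openin X W \<longleftrightarrow> W \<subseteq> topspace X \<and> (\<forall>x\<in>W. \<exists>E\<in>\<U>. E `` {x} \<subseteq> W))"

text \<open>Only meaningful for compact Hausdorff spaces, where existence and uniqueness hold.\<close>

definition compact_uniformity :: "'a topology \<Rightarrow> ('a \<times> 'a) set set" where
  "compact_uniformity X = (THE \<U>. compatible_uniformity X \<U>)"


section \<open>Generalized regular covering maps\<close>

definition acts_isomorphically :: "('a \<times> 'a) set set \<Rightarrow> ('a \<Rightarrow> 'a) set \<Rightarrow> bool" where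
  "acts_isomorphically \<U> G \<longleftrightarrow>
     (\<forall>D\<in>\<U>. \<exists>E\<in>\<U>. E \<subseteq> D \<and> (\<forall>g\<in>G. map_prod g g ` E = E))"

definition U_set :: "'a set \<Rightarrow> ('a \<times> 'a) set \<Rightarrow> ('a \<Rightarrow> 'a) set \<Rightarrow> ('a \<Rightarrow> 'a) set" where
  "U_set S E G = {g \<in> G. \<forall>y\<in>S. (y, g y) \<in> E}"

definition S_set :: "'a set \<Rightarrow> ('a \<times> 'a) set \<Rightarrow> ('a \<Rightarrow> 'a) set \<Rightarrow> ('a \<Rightarrow> 'a) set" where
  "S_set S E G = {g \<in> G. \<exists>y\<in>S. (y, g y) \<in> E}"

definition N_set :: "'a set \<Rightarrow> ('a \<times> 'a) set \<Rightarrow> ('a \<Rightarrow> 'a) set \<Rightarrow> ('a \<Rightarrow> 'a) set" where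
  "N_set S E G = generate (BijGroup S) (S_set S E G)"

definition acts_prodiscretely ::
    "'a set \<Rightarrow> ('a \<times> 'a) set set \<Rightarrow> ('a \<Rightarrow> 'a) set \<Rightarrow> bool" where
  "acts_prodiscretely S \<U> G \<longleftrightarrow> (\<forall>E\<in>\<U>. \<exists>F\<in>\<U>. N_set S F G \<subseteq> U_set S E G)"

text \<open>
  Completeness of \<open>G\<close> in the uniformity of uniform convergence, whose basic entourages are the
  sets of pairs \<open>(g, h)\<close> with \<open>(g y, h y) \<in> E\<close> for all \<open>y\<close>: every Cauchy filter converges,
  as in \<^const>\<open>complete\<close>.
\<close>

definition complete_group ::
    "'a set \<Rightarrow> ('a \<times> 'a) set set \<Rightarrow> ('a \<Rightarrow> 'a) set \<Rightarrow> bool" where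
  "complete_group S \<U> G \<longleftrightarrow>
     (\<forall>\<F>. \<F> \<noteq> bot \<and> \<F> \<le> principal G \<and>
          (\<forall>E\<in>\<U>. \<forall>\<^sub>F (g, h) in \<F> \<times>\<^sub>F \<F>. \<forall>y\<in>S. (g y, h y) \<in> E)
        \<longrightarrow> (\<exists>g\<in>G. \<forall>E\<in>\<U>. \<forall>\<^sub>F h in \<F>. \<forall>y\<in>S. (g y, h y) \<in> E))"

text \<open>
  The last conjunct says that \<open>\<V>\<close> is the quotient uniformity on \<open>T = S/G\<close>.
\<close>

definition generalized_regular_covering ::
    "'a set \<Rightarrow> ('a \<times> 'a) set set \<Rightarrow> 'b set \<Rightarrow> ('b \<times> 'b) set set
       \<Rightarrow> ('a \<Rightarrow> 'a) set \<Rightarrow> ('a \<Rightarrow> 'b) \<Rightarrow> bool" where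
  "generalized_regular_covering S \<U> T \<V> G f \<longleftrightarrow>
     is_uniformity S \<U> \<and>
     subgroup G (BijGroup S) \<and>
     acts_isomorphically \<U> G \<and> acts_prodiscretely S \<U> G \<and> complete_group S \<U> G \<and>
     orbit_map S T G f \<and> \<V> = (\<lambda>E. map_prod f f ` E) ` \<U>"

definition compact_generalized_regular_covering ::
    "'a topology \<Rightarrow> 'b topology \<Rightarrow> ('a \<Rightarrow> 'a) set \<Rightarrow> ('a \<Rightarrow> 'b) \<Rightarrow> bool" where
  "compact_generalized_regular_covering Y X G f \<longleftrightarrow>
     generalized_regular_covering (topspace Y) (compact_uniformity Y)
       (topspace X) (compact_uniformity X) G f"


section \<open>The compact universal cover\<close>

definition equivalent_covers ::
    "'b topology \<Rightarrow> ('b \<Rightarrow> 'b) set \<Rightarrow> ('b \<Rightarrow> 'a) \<Rightarrow>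
     'c topology \<Rightarrow> ('c \<Rightarrow> 'c) set \<Rightarrow> ('c \<Rightarrow> 'a) \<Rightarrow> bool" where
  "equivalent_covers Y1 G1 f1 Y2 G2 f2 \<longleftrightarrow>
     (\<exists>h \<theta>. homeomorphic_map Y1 Y2 h \<and>
        \<theta> \<in> iso ((BijGroup (topspace Y1))\<lparr>carrier := G1\<rparr>)
                  ((BijGroup (topspace Y2))\<lparr>carrier := G2\<rparr>) \<and>
        (\<forall>y\<in>topspace Y1. f2 (h y) = f1 y) \<and>
        (\<forall>g\<in>G1. \<forall>y\<in>topspace Y1. h (g y) = \<theta> g (h y)))"

text \<open>
  The family \<open>(C i, K i, p i)\<close>, \<open>i \<in> I\<close>, consists of one cover of \<open>X\<close> by a continuum from
  each equivalence class, with basepoints \<open>c i\<close> over the basepoint \<open>x0\<close>. A compact metrizable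
  space has at most the cardinality of the real line, so every cover of \<open>X\<close> by a continuum is
  equivalent to one whose total space is a set of real numbers with some topology (unrelated to
  the Euclidean one). Hence it suffices to let \<open>Z\<close> range over \<open>real topology\<close>.
\<close>

definition all_pointed_covers ::
    "'a topology \<Rightarrow> 'a \<Rightarrow> 'i set \<Rightarrow> ('i \<Rightarrow> 'b topology) \<Rightarrow> ('i \<Rightarrow> ('b \<Rightarrow> 'b) set)
       \<Rightarrow> ('i \<Rightarrow> 'b \<Rightarrow> 'a) \<Rightarrow> ('i \<Rightarrow> 'b) \<Rightarrow> bool" where
  "all_pointed_covers X x0 I C K p c \<longleftrightarrow>
     x0 \<in> topspace X \<and>
     (\<forall>i\<in>I. continuum_cover X (C i) (K i) (p i) \<and> c i \<in> topspace (C i) \<and> p i (c i) = x0) \<and>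
     (\<forall>i\<in>I. \<forall>j\<in>I. equivalent_covers (C i) (K i) (p i) (C j) (K j) (p j) \<longrightarrow> i = j) \<and>
     (\<forall>(Z :: real topology) L q. continuum_cover X Z L q \<longrightarrow>
        (\<exists>i\<in>I. equivalent_covers (C i) (K i) (p i) Z L q))"

definition cover_le :: "('i \<Rightarrow> 'b topology) \<Rightarrow> ('i \<Rightarrow> 'b \<Rightarrow> 'a) \<Rightarrow> 'i \<Rightarrow> 'i \<Rightarrow> bool" where
  "cover_le C p i j \<longleftrightarrow>
     (\<exists>h. continuous_map (C j) (C i) h \<and> h ` topspace (C j) = topspace (C i) \<and>
          (\<forall>y\<in>topspace (C j). p j y = p i (h y)))"

text \<open>The unique basepoint preserving map \<open>C j \<rightarrow> C i\<close> witnessing \<open>cover_le C p i j\<close>.\<close>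

definition bonding_map ::
    "('i \<Rightarrow> 'b topology) \<Rightarrow> ('i \<Rightarrow> 'b \<Rightarrow> 'a) \<Rightarrow> ('i \<Rightarrow> 'b) \<Rightarrow> 'i \<Rightarrow> 'i \<Rightarrow> 'b \<Rightarrow> 'b" where
  "bonding_map C p c i j =
     (THE h. h \<in> extensional (topspace (C j)) \<and>
          continuous_map (C j) (C i) h \<and> h ` topspace (C j) = topspace (C i) \<and>
          (\<forall>y\<in>topspace (C j). p j y = p i (h y)) \<and> h (c j) = c i)"

definition universal_cover ::
    "'i set \<Rightarrow> ('i \<Rightarrow> 'b topology) \<Rightarrow> ('i \<Rightarrow> 'b \<Rightarrow> 'a) \<Rightarrow> ('i \<Rightarrow> 'b) \<Rightarrow> ('i \<Rightarrow> 'b) topology" where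
  "universal_cover I C p c =
     subtopology (product_topology C I)
       {x. \<forall>i\<in>I. \<forall>j\<in>I. cover_le C p i j \<longrightarrow> bonding_map C p c i j (x j) = x i}"

text \<open>
  The coordinates of a point of the inverse limit all lie over the same point of the base.
\<close>

definition universal_proj :: "'i set \<Rightarrow> ('i \<Rightarrow> 'b \<Rightarrow> 'a) \<Rightarrow> ('i \<Rightarrow> 'b) \<Rightarrow> 'a" where
  "universal_proj I p x = (THE z. \<forall>i\<in>I. p i (x i) = z)"

text \<open>
  Lifts of \<open>f : Y \<rightarrow> X\<close> along \<open>\<phi> : W \<rightarrow> X\<close>. Maps are taken \<^const>\<open>undefined\<close> outside their
  domain, so that distinct lifts differ on \<open>W\<close>.
\<close>

definition gen_covering_lifts ::
    "'w topology \<Rightarrow> 'c topology \<Rightarrow> ('w \<Rightarrow> 'a) \<Rightarrow> ('c \<Rightarrow> 'a) \<Rightarrow> ('w \<Rightarrow> 'c) set" where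
  "gen_covering_lifts W Y \<phi> f =
     {h \<in> topspace W \<rightarrow>\<^sub>E topspace Y.
        (\<exists>H. compact_generalized_regular_covering W Y H h) \<and>
        (\<forall>x\<in>topspace W. \<phi> x = f (h x))}"

end

theory Submission
  imports Defs
begin

text \<open>
  A generalized regular covering \<open>f : Y \<rightarrow> X = Y/G\<close> need not be locally injective, but it is an inverse
  limit of ordinary regular covers, and the compact universal cover is the limit of all of them.

  To see the covers below \<open>Y\<close>, choose a metric on \<open>Y\<close> that \<open>G\<close> preserves (\<open>invariant_metric\<close>) and let
  \<open>N r\<close> be generated by the elements of \<open>G\<close> that move some point by less than \<open>r\<close>. This is a normal
  subgroup, the orbit space of \<open>N r\<close> is a continuum, and an element of \<open>G\<close> outside \<open>N r\<close> moves every
  point of it by at least \<open>r\<close>. Hence the orbit space is a regular cover of \<open>X\<close>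
  (\<open>galois_covering_orbit_space\<close>) and occurs, as a pointed space, among the given covers. Prodiscreteness
  says that \<open>N r\<close> shrinks uniformly to the identity with \<open>r\<close>. So a point of \<open>Y\<close> is determined by its
  orbits under all the \<open>N r\<close>, and by compactness every compatible choice of orbits comes from a point:
  reading off the coordinates of a point of the universal cover that belong to these orbit spaces
  defines the lift \<open>f_L\<close> (\<open>lift_exists\<close>).

  The universal cover is connected, and its projections are onto, because the pointed covers are
  directed. An upper bound of two covers is a component of their fibre product. It is clopen even
  though \<open>X\<close> may fail to be locally connected, since covers by continua have finite fibres
  (\<open>clopen_connected_piece\<close>).

  Connectedness gives uniqueness of lifts along ordinary covers, and passing to the orbit spaces of
  \<open>N r\<close> also along \<open>f\<close> (\<open>lift_unique_prodiscrete\<close>). Uniqueness modulo \<open>G\<close> follows at once, and so does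
  the fact that the homeomorphisms over \<open>Y\<close> of the universal cover are transitive on the fibres of \<open>f_L\<close>.
  To prove that they form the group of a generalized regular covering, note that every entourage
  of the universal cover contains one pulled back from a single cover (\<open>coordinate_entourage\<close>), on
  which they act through a finite free group; so the action is isomorphic and prodiscrete. Completeness
  and the quotient uniformity are automatic for compact spaces
  (\<open>compact_generalized_regular_coveringI\<close>).
\<close>

section \<open>The uniformity of a compact Hausdorff space\<close>

text \<open>
  The symmetric neighbourhoods of the diagonal. The general theory of uniform spaces says that a
  compact Hausdorff space has exactly one compatible uniformity and that it is this one; the
  following lemmas prove this for spaces whose carrier is not a whole type.
\<close>

definition diagonal_uniformity :: "'a topology \<Rightarrow> ('a \<times> 'a) set set" where
  "diagonal_uniformity X =
     {E. E \<subseteq> topspace X \<times> topspace X \<and> sym E \<and>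
         (\<exists>Q. openin (prod_topology X X) Q \<and> Id_on (topspace X) \<subseteq> Q \<and> Q \<subseteq> E)}"

lemma compact_space_pointwise_subcover:
  assumes "compact_space X"
    and "\<And>x. x \<in> topspace X \<Longrightarrow> openin X (V x) \<and> x \<in> V x"
  obtains A where "finite A" "A \<subseteq> topspace X" "topspace X \<subseteq> (\<Union>x\<in>A. V x)"
proof -
  have "(\<forall>U\<in>V ` topspace X. openin X U) \<and> topspace X \<subseteq> \<Union>(V ` topspace X)"
    using assms(2) by blast
  then obtain \<F> where "finite \<F>" "\<F> \<subseteq> V ` topspace X" "topspace X \<subseteq> \<Union>\<F>"
    using assms(1) unfolding compact_space_alt by meson
  then show ?thesis
    using that finite_subset_image[of \<F> V "topspace X"] by blast
qed

lemma openin_converse_prod: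
  assumes "openin (prod_topology X X) Q"
  shows "openin (prod_topology X X) (Q\<inverse>)"
proof -
  have "homeomorphic_map (prod_topology X X) (prod_topology X X) prod.swap"
    by (metis (no_types, lifting) homeomorphic_map_eq homeomorphic_map_swap prod.swap_def split_beta)
  then have "openin (prod_topology X X) (prod.swap ` Q)"
    using assms homeomorphic_map_openness_eq by blast
  moreover have "prod.swap ` Q = Q\<inverse>" by auto
  ultimately show ?thesis by simp
qed

lemma openin_prod_diagonal:
  assumes "openin (prod_topology X X) Q" "(x, x) \<in> Q"
  obtains W where "openin X W" "x \<in> W" "W \<times> W \<subseteq> Q"
proof -
  obtain U V where UV: "openin X U" "openin X V" "x \<in> U" "x \<in> V" and Q: "U \<times> V \<subseteq> Q"
    using openin_prod_topology_alt[THEN iffD1, rule_format, OF assms] by (elim exE conjE)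
  have "(U \<inter> V) \<times> (U \<inter> V) \<subseteq> Q"
    using Q by (rule subset_trans[rotated]) auto
  then show ?thesis using UV by (intro that[of "U \<inter> V"]) auto
qed

lemma is_uniformityD:
  assumes "is_uniformity S \<U>"
  shows "\<U> \<noteq> {}"
    "E \<in> \<U> \<Longrightarrow> E \<subseteq> S \<times> S" "E \<in> \<U> \<Longrightarrow> x \<in> S \<Longrightarrow> (x, x) \<in> E" "E \<in> \<U> \<Longrightarrow> sym E"
    "E \<in> \<U> \<Longrightarrow> F \<in> \<U> \<Longrightarrow> E \<inter> F \<in> \<U>"
    "E \<in> \<U> \<Longrightarrow> E \<subseteq> F \<Longrightarrow> F \<subseteq> S \<times> S \<Longrightarrow> sym F \<Longrightarrow> F \<in> \<U>"
    "E \<in> \<U> \<Longrightarrow> \<exists>F\<in>\<U>. F O F \<subseteq> E"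
proof -
  note u = assms[unfolded is_uniformity_def]
  note 1 = conjunct1[OF u] and 2 = conjunct1[OF conjunct2[OF u]]
    and 3 = conjunct1[OF conjunct2[OF conjunct2[OF u]]]
    and 4 = conjunct1[OF conjunct2[OF conjunct2[OF conjunct2[OF u]]]]
    and 5 = conjunct2[OF conjunct2[OF conjunct2[OF conjunct2[OF u]]]]
  show "\<U> \<noteq> {}" by (fact 1)
  show "E \<in> \<U> \<Longrightarrow> E \<subseteq> S \<times> S" "E \<in> \<U> \<Longrightarrow> x \<in> S \<Longrightarrow> (x, x) \<in> E" "E \<in> \<U> \<Longrightarrow> sym E"
    using 2 by (simp, blast, simp)
  show "E \<in> \<U> \<Longrightarrow> F \<in> \<U> \<Longrightarrow> E \<inter> F \<in> \<U>" using 3 by simp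
  show "E \<in> \<U> \<Longrightarrow> E \<subseteq> F \<Longrightarrow> F \<subseteq> S \<times> S \<Longrightarrow> sym F \<Longrightarrow> F \<in> \<U>" using 4 by simp
  show "E \<in> \<U> \<Longrightarrow> \<exists>F\<in>\<U>. F O F \<subseteq> E" using 5 by simp
qed

text \<open>
  The points with some ball \<open>D `` {y}\<close> inside \<open>E `` {x}\<close> form an open set, because \<open>D\<close> can be halved.
\<close>

lemma compatible_uniformity_neighbourhood:
  assumes "compatible_uniformity X \<U>" and E: "E \<in> \<U>" and x: "x \<in> topspace X"
  obtains V where "openin X V" "x \<in> V" "V \<subseteq> E `` {x}"
proof -
  have u: "is_uniformity (topspace X) \<U>"
    and op: "\<And>W. openin X W \<longleftrightarrow> W \<subseteq> topspace X \<and> (\<forall>x\<in>W. \<exists>E\<in>\<U>. E `` {x} \<subseteq> W)"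
    using assms unfolding compatible_uniformity_def by auto
  define V where "V = {y \<in> topspace X. \<exists>D\<in>\<U>. D `` {y} \<subseteq> E `` {x}}"
  have "\<exists>D\<in>\<U>. D `` {y} \<subseteq> V" if y: "y \<in> V" for y
  proof -
    obtain D where D: "D \<in> \<U>" "D `` {y} \<subseteq> E `` {x}"
      using y V_def by auto
    obtain D' where D': "D' \<in> \<U>" "D' O D' \<subseteq> D"
      using is_uniformityD(7)[OF u D(1)] by auto
    have "D' `` {y} \<subseteq> V"
    proof
      fix z assume z: "z \<in> D' `` {y}"
      then have "D' `` {z} \<subseteq> D `` {y}"
        using D' by auto
      then show "z \<in> V"
        using z D D' is_uniformityD(2)[OF u D'(1)] unfolding V_def by blast
    qed
    then show ?thesis using D' by auto
  qed
  then have "openin X V"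
    unfolding op by (auto simp: V_def)
  moreover have "x \<in> V"
    using E x V_def by auto
  moreover have "V \<subseteq> E `` {x}"
    using is_uniformityD(3)[OF u] unfolding V_def by blast
  ultimately show ?thesis using that by blast
qed

text \<open>
  Entourages are neighbourhoods of the diagonal because they can be halved. Conversely, cover
  the space by finitely many balls so small that each lies in a square \<open>W \<times> W\<close> inside the
  given neighbourhood; the intersection of the finitely many entourages used lies in the neighbourhood.
\<close>

lemma compatible_uniformity_unique:
  assumes "compact_space X" and c: "compatible_uniformity X \<U>"
  shows "\<U> = diagonal_uniformity X"
proof
  have u: "is_uniformity (topspace X) \<U>"
    and op: "\<And>W. openin X W \<longleftrightarrow> W \<subseteq> topspace X \<and> (\<forall>x\<in>W. \<exists>E\<in>\<U>. E `` {x} \<subseteq> W)"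
    using c unfolding compatible_uniformity_def by auto
  note ud = is_uniformityD[OF u]
  show "\<U> \<subseteq> diagonal_uniformity X"
  proof
    fix E assume E: "E \<in> \<U>"
    obtain F where F: "F \<in> \<U>" "F O F \<subseteq> E"
      using ud(7)[OF E] by auto
    define \<Q> where "\<Q> = {V \<times> V |V. openin X V \<and> V \<times> V \<subseteq> E}"
    have "openin (prod_topology X X) (\<Union>\<Q>)"
      by (rule openin_Union) (auto simp: \<Q>_def openin_prod_Times_iff)
    moreover have "Id_on (topspace X) \<subseteq> \<Union>\<Q>"
    proof clarify
      fix x assume x: "x \<in> topspace X"
      obtain V where V: "openin X V" "x \<in> V" "V \<subseteq> F `` {x}"
        using compatible_uniformity_neighbourhood[OF c F(1) x] by blast
      have "V \<times> V \<subseteq> E"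
      proof clarify
        fix a b assume "a \<in> V" "b \<in> V"
        then have "(a, x) \<in> F" "(x, b) \<in> F"
          using V ud(4)[OF F(1)] unfolding sym_def by auto
        then show "(a, b) \<in> E" using F by auto
      qed
      then show "(x, x) \<in> \<Union>\<Q>"
        using V unfolding \<Q>_def by blast
    qed
    moreover have "\<Union>\<Q> \<subseteq> E" by (auto simp: \<Q>_def)
    ultimately show "E \<in> diagonal_uniformity X"
      unfolding diagonal_uniformity_def using ud(2,4)[OF E] by blast
  qed
  show "diagonal_uniformity X \<subseteq> \<U>"
  proof
    fix D assume "D \<in> diagonal_uniformity X"
    then obtain Q where D: "D \<subseteq> topspace X \<times> topspace X" "sym D"
      and Q: "openin (prod_topology X X) Q" "Id_on (topspace X) \<subseteq> Q" "Q \<subseteq> D"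
      unfolding diagonal_uniformity_def by auto
    have "\<exists>W F V. openin X W \<and> W \<times> W \<subseteq> Q \<and> F \<in> \<U> \<and> (F O F) `` {x} \<subseteq> W \<and>
        openin X V \<and> x \<in> V \<and> V \<subseteq> F `` {x}" if x: "x \<in> topspace X" for x
    proof -
      have "(x, x) \<in> Q" using x Q by auto
      then obtain U where W: "openin X U" "x \<in> U" "U \<times> U \<subseteq> Q"
        using openin_prod_diagonal[OF Q(1)] by metis
      then obtain E where E: "E \<in> \<U>" "E `` {x} \<subseteq> U"
        unfolding op by auto
      obtain F where F: "F \<in> \<U>" "F O F \<subseteq> E"
        using ud(7)[OF E(1)] by auto
      obtain V where V: "openin X V" "x \<in> V" "V \<subseteq> F `` {x}"
        using compatible_uniformity_neighbourhood[OF c F(1) x] by blast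
      have "(F O F) `` {x} \<subseteq> U" using E F by blast
      then show ?thesis using W F(1) V by blast
    qed
    then obtain W F V where WFV: "\<And>x. x \<in> topspace X \<Longrightarrow> openin X (W x) \<and> W x \<times> W x \<subseteq> Q \<and>
        F x \<in> \<U> \<and> (F x O F x) `` {x} \<subseteq> W x \<and> openin X (V x) \<and> x \<in> V x \<and> V x \<subseteq> F x `` {x}"
      by metis
    obtain A where A: "finite A" "A \<subseteq> topspace X" "topspace X \<subseteq> (\<Union>x\<in>A. V x)"
      using compact_space_pointwise_subcover[OF assms(1), of V] WFV by blast
    \<comment> \<open>For the empty space the finite intersection below has no members; \<open>E0\<close> keeps it an entourage.\<close>
    obtain E0 where E0: "E0 \<in> \<U>" using ud(1) by auto
    have "finite B \<Longrightarrow> B \<subseteq> topspace X \<Longrightarrow> E0 \<inter> (\<Inter>x\<in>B. F x) \<in> \<U>" for B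
    proof (induction B rule: finite_induct)
      case empty
      then show ?case using E0 by simp
    next
      case (insert b B)
      then have "F b \<inter> (E0 \<inter> (\<Inter>x\<in>B. F x)) \<in> \<U>"
        using ud(5)[of "F b" "E0 \<inter> (\<Inter>x\<in>B. F x)"] WFV[of b] by simp
      then show ?case by (simp add: Int_ac)
    qed
    then have E: "E0 \<inter> (\<Inter>x\<in>A. F x) \<in> \<U>" using A by auto
    have "E0 \<inter> (\<Inter>x\<in>A. F x) \<subseteq> D"
    proof clarify
      fix a b assume ab: "(a, b) \<in> E0" "(a, b) \<in> (\<Inter>x\<in>A. F x)"
      have "a \<in> topspace X" using ab(1) ud(2)[OF E0] by auto
      then obtain x where x: "x \<in> A" "a \<in> V x" using A by auto
      then have xt: "x \<in> topspace X" using A by auto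
      have ax: "(x, a) \<in> F x" "(a, b) \<in> F x" using x WFV[OF xt] ab by auto
      have "(a, x) \<in> F x" using ax ud(4) WFV[OF xt] unfolding sym_def by blast
      then have "(x, x) \<in> F x" using ud(3) WFV[OF xt] xt by blast
      then have "a \<in> W x" "b \<in> W x" using WFV[OF xt] ax by blast+
      then show "(a, b) \<in> D" using WFV[OF xt] Q(3) by blast
    qed
    then show "D \<in> \<U>" using ud(6)[OF E] D by blast
  qed
qed

text \<open>
  Choose finitely many closed sets \<open>K x \<subseteq> W x\<close> whose interiors cover, with \<open>W x \<times> W x\<close> inside the
  given neighbourhood, and let \<open>F\<close> forbid pairs that lead from some \<open>K x\<close> out of \<open>W x\<close>. The middle
  point of a chain \<open>a, b, c\<close> lies in some \<open>K x\<close>, so both ends lie in \<open>W x\<close>.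
\<close>

lemma diagonal_uniformity_halving:
  assumes "compact_space X" "Hausdorff_space X" and "E \<in> diagonal_uniformity X"
  shows "\<exists>F\<in>diagonal_uniformity X. F O F \<subseteq> E"
proof -
  let ?S = "topspace X"
  obtain Q where Q: "openin (prod_topology X X) Q" "Id_on ?S \<subseteq> Q" "Q \<subseteq> E"
    using assms unfolding diagonal_uniformity_def by auto
  have reg: "regular_space X" using assms compact_Hausdorff_imp_regular_space by blast
  have "\<exists>W V K. openin X W \<and> W \<times> W \<subseteq> Q \<and> openin X V \<and> closedin X K \<and> x \<in> V \<and> V \<subseteq> K \<and> K \<subseteq> W"
    if x: "x \<in> ?S" for x
  proof -
    have "(x, x) \<in> Q" using x Q by auto
    then obtain U where W: "openin X U" "x \<in> U" "U \<times> U \<subseteq> Q"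
      using openin_prod_diagonal[OF Q(1)] by metis
    have "closedin X (?S - U)" "x \<in> ?S - (?S - U)"
      using W x by auto
    then obtain V V' where V: "openin X V" "openin X V'" "x \<in> V" "?S - U \<subseteq> V'" "disjnt V V'"
      using reg unfolding regular_space_def by meson
    have "closedin X (?S - V')" "V \<subseteq> ?S - V'" "?S - V' \<subseteq> U"
      using V openin_subset[OF V(1)] unfolding disjnt_def by auto
    then show ?thesis using W V by blast
  qed
  then obtain W V K where WVK: "\<And>x. x \<in> ?S \<Longrightarrow> openin X (W x) \<and> W x \<times> W x \<subseteq> Q \<and>
      openin X (V x) \<and> closedin X (K x) \<and> x \<in> V x \<and> V x \<subseteq> K x \<and> K x \<subseteq> W x"
    by metis
  obtain A where A: "finite A" "A \<subseteq> ?S" "?S \<subseteq> (\<Union>x\<in>A. V x)"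
    using compact_space_pointwise_subcover[OF assms(1), of V] WVK by blast
  define P where "P = ?S \<times> ?S - (\<Union>x\<in>A. K x \<times> (?S - W x))"
  define F where "F = P \<inter> P\<inverse>"
  have "closedin (prod_topology X X) (\<Union>x\<in>A. K x \<times> (?S - W x))"
  proof (rule closedin_Union)
    show "finite ((\<lambda>x. K x \<times> (?S - W x)) ` A)" using A by simp
    fix T assume "T \<in> (\<lambda>x. K x \<times> (?S - W x)) ` A"
    then obtain x where x: "x \<in> ?S" "T = K x \<times> (?S - W x)" using A by blast
    then show "closedin (prod_topology X X) T"
      using WVK[OF x(1)] by (simp add: closedin_prod_Times_iff closedin_diff)
  qed
  then have "openin (prod_topology X X) P"
    unfolding P_def using openin_diff[of "prod_topology X X" "?S \<times> ?S"]
    by (metis openin_topspace topspace_prod_topology)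
  then have F: "openin (prod_topology X X) F"
    unfolding F_def using openin_converse_prod by blast
  have IF: "Id_on ?S \<subseteq> F"
    unfolding F_def P_def using A WVK by blast
  have FF: "F \<in> diagonal_uniformity X"
    unfolding diagonal_uniformity_def using F IF
    by (auto simp: F_def P_def sym_def)
  have "F O F \<subseteq> E"
  proof clarify
    fix a b c assume "(a, b) \<in> F" "(b, c) \<in> F"
    then have bP: "(b, a) \<in> P" "(b, c) \<in> P" by (auto simp: F_def)
    then obtain x where x: "x \<in> A" "b \<in> V x" using A(3) unfolding P_def by blast
    have xt: "x \<in> ?S" using x A by auto
    have "a \<in> W x" "c \<in> W x" using bP x WVK[OF xt] unfolding P_def by blast+
    then show "(a, c) \<in> E" using WVK[OF xt] Q(3) by blast
  qed
  then show ?thesis using FF by blast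
qed

lemma compatible_diagonal_uniformity:
  assumes "compact_space X" "Hausdorff_space X"
  shows "compatible_uniformity X (diagonal_uniformity X)"
proof -
  let ?S = "topspace X" and ?D = "diagonal_uniformity X"
  have "openin (prod_topology X X) (?S \<times> ?S)"
    by (simp add: openin_prod_Times_iff)
  then have top: "?S \<times> ?S \<in> ?D"
    unfolding diagonal_uniformity_def by (auto simp: sym_def)
  have int: "E \<inter> F \<in> ?D" if EF: "E \<in> ?D" "F \<in> ?D" for E F
  proof -
    obtain Q R where "openin (prod_topology X X) Q" "Id_on ?S \<subseteq> Q" "Q \<subseteq> E"
        "openin (prod_topology X X) R" "Id_on ?S \<subseteq> R" "R \<subseteq> F"
      using EF unfolding diagonal_uniformity_def by auto
    then have "openin (prod_topology X X) (Q \<inter> R)" "Id_on ?S \<subseteq> Q \<inter> R" "Q \<inter> R \<subseteq> E \<inter> F"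
      by auto
    then show ?thesis using EF unfolding diagonal_uniformity_def by (auto simp: sym_Int)
  qed
  have u: "is_uniformity ?S ?D"
    unfolding is_uniformity_def
  proof (intro conjI ballI allI impI)
    show "\<exists>F\<in>?D. F O F \<subseteq> E" if "E \<in> ?D" for E
      using diagonal_uniformity_halving[OF assms that] .
  next
    fix E F assume "E \<in> ?D" "E \<subseteq> F \<and> F \<subseteq> ?S \<times> ?S \<and> sym F"
    then show "F \<in> ?D" unfolding diagonal_uniformity_def by blast
  qed (use top int in \<open>auto simp: diagonal_uniformity_def\<close>)
  have "openin X W \<longleftrightarrow> W \<subseteq> ?S \<and> (\<forall>x\<in>W. \<exists>E\<in>?D. E `` {x} \<subseteq> W)" (is "_ \<longleftrightarrow> ?R") for W
  proof
    assume W: "openin X W"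
    have "\<exists>E\<in>?D. E `` {x} \<subseteq> W" if x: "x \<in> W" for x
    proof -
      have xS: "x \<in> ?S" using W x openin_subset by auto
      define K where "K = {x} \<times> (?S - W)"

      define E where "E = (?S \<times> ?S - K) \<inter> (?S \<times> ?S - K)\<inverse>"
      have "closedin (prod_topology X X) K"
        unfolding K_def using W xS assms
        by (auto simp: closedin_prod_Times_iff closedin_Hausdorff_singleton)
      then have "openin (prod_topology X X) (?S \<times> ?S - K)"
        using openin_diff[of "prod_topology X X" "?S \<times> ?S"]
        by (metis openin_topspace topspace_prod_topology)
      then have "openin (prod_topology X X) E"
        unfolding E_def using openin_converse_prod by blast
      moreover have "Id_on ?S \<subseteq> E" unfolding E_def K_def using x by auto
      ultimately have "E \<in> ?D"
        unfolding diagonal_uniformity_def by (auto simp: E_def sym_def)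
      moreover have "E `` {x} \<subseteq> W" unfolding E_def K_def by auto
      ultimately show ?thesis by blast
    qed
    then show ?R using openin_subset[OF W] by blast
  next
    assume R: ?R
    have "\<exists>V. openin X V \<and> x \<in> V \<and> V \<subseteq> W" if x: "x \<in> W" for x
    proof -
      obtain E where E: "E \<in> ?D" "E `` {x} \<subseteq> W" using R x by auto
      then obtain Q where Q: "openin (prod_topology X X) Q" "Id_on ?S \<subseteq> Q" "Q \<subseteq> E"
        unfolding diagonal_uniformity_def by auto
      have "(x, x) \<in> Q" using Q x R by auto
      then obtain V where "openin X V" "x \<in> V" "V \<times> V \<subseteq> Q"
        using openin_prod_diagonal[OF Q(1)] by metis
      then show ?thesis using E Q by blast
    qed
    then show "openin X W" by (subst openin_subopen) blast
  qed
  then show ?thesis unfolding compatible_uniformity_def using u by blast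
qed

lemma compact_uniformity_eq:
  assumes "compact_space X" "Hausdorff_space X"
  shows "compact_uniformity X = diagonal_uniformity X"
  unfolding compact_uniformity_def
  using compatible_diagonal_uniformity[OF assms] compatible_uniformity_unique[OF assms(1)]
  by (rule the_equality)

lemma compatible_compact_uniformity:
  assumes "compact_space X" "Hausdorff_space X"
  shows "compatible_uniformity X (compact_uniformity X)"
  using compatible_diagonal_uniformity assms by (simp add: compact_uniformity_eq)

lemma is_uniformity_compact_uniformity:
  assumes "compact_space X" "Hausdorff_space X"
  shows "is_uniformity (topspace X) (compact_uniformity X)"
  using compatible_compact_uniformity[OF assms] by (simp add: compatible_uniformity_def)

lemma openin_compact_uniformity:
  assumes "compact_space X" "Hausdorff_space X"
  shows "openin X W \<longleftrightarrow> W \<subseteq> topspace X \<and> (\<forall>x\<in>W. \<exists>E\<in>compact_uniformity X. E `` {x} \<subseteq> W)"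
  using compatible_compact_uniformity[OF assms] by (simp add: compatible_uniformity_def)

lemma compact_uniformity_metric:
  assumes "Metric_space M d" and "compact_space (Metric_space.mtopology M d)"
  shows "compact_uniformity (Metric_space.mtopology M d) =
    {E. E \<subseteq> M \<times> M \<and> sym E \<and> (\<exists>e>0. \<forall>x\<in>M. \<forall>y\<in>M. d x y < e \<longrightarrow> (x, y) \<in> E)}" (is "_ = ?U")
proof -
  interpret Metric_space M d by fact
  have "is_uniformity M ?U"
    unfolding is_uniformity_def
  proof (intro conjI ballI allI impI)
    show "?U \<noteq> {}" by (auto intro!: exI[of _ "M \<times> M"] exI[of _ 1] simp: sym_def)
  next
    fix E F assume "E \<in> ?U" "F \<in> ?U"
    then obtain e e' where "e > 0" "\<forall>x\<in>M. \<forall>y\<in>M. d x y < e \<longrightarrow> (x, y) \<in> E"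
      "e' > 0" "\<forall>x\<in>M. \<forall>y\<in>M. d x y < e' \<longrightarrow> (x, y) \<in> F" by auto
    then have "min e e' > 0 \<and> (\<forall>x\<in>M. \<forall>y\<in>M. d x y < min e e' \<longrightarrow> (x, y) \<in> E \<inter> F)" by auto
    moreover have "E \<inter> F \<subseteq> M \<times> M" "sym (E \<inter> F)"
      using \<open>E \<in> ?U\<close> \<open>F \<in> ?U\<close> by (auto simp: sym_Int)
    ultimately show "E \<inter> F \<in> ?U" by blast
  next
    fix E assume "E \<in> ?U"
    then obtain e where e: "e > 0" "\<forall>x\<in>M. \<forall>y\<in>M. d x y < e \<longrightarrow> (x, y) \<in> E" by auto
    let ?F = "{(x, y). x \<in> M \<and> y \<in> M \<and> d x y < e/2}"
    have "?F \<in> ?U" using e by (auto simp: sym_def commute intro!: exI[of _ "e/2"])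
    moreover have "?F O ?F \<subseteq> E"
    proof clarify
      fix x y z assume "x \<in> M" "y \<in> M" "z \<in> M" "d x y < e/2" "d y z < e/2"
      then show "(x, z) \<in> E" using e triangle[of x y z] by force
    qed
    ultimately show "\<exists>F\<in>?U. F O F \<subseteq> E" by blast
  next
    fix E assume "E \<in> ?U" then show "Id_on M \<subseteq> E" by auto
  next
    fix E F assume "E \<in> ?U" "E \<subseteq> F \<and> F \<subseteq> M \<times> M \<and> sym F"
    then show "F \<in> ?U" by blast
  qed auto
  moreover have "openin mtopology W \<longleftrightarrow> W \<subseteq> M \<and> (\<forall>x\<in>W. \<exists>E\<in>?U. E `` {x} \<subseteq> W)" for W
  proof
    assume W: "openin mtopology W"
    have "\<exists>E\<in>?U. E `` {x} \<subseteq> W" if x: "x \<in> W" for x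
    proof -
      obtain r where r: "r > 0" "mball x r \<subseteq> W"
        using W x unfolding openin_mtopology by blast
      let ?F = "{(x, y). x \<in> M \<and> y \<in> M \<and> d x y < r}"
      have "?F \<in> ?U" using r by (auto simp: sym_def commute intro!: exI[of _ r])
      moreover have "?F `` {x} \<subseteq> W" using r by (auto simp: mball_def)
      ultimately show ?thesis by blast
    qed
    then show "W \<subseteq> M \<and> (\<forall>x\<in>W. \<exists>E\<in>?U. E `` {x} \<subseteq> W)"
      using W unfolding openin_mtopology by blast
  next
    assume R: "W \<subseteq> M \<and> (\<forall>x\<in>W. \<exists>E\<in>?U. E `` {x} \<subseteq> W)"
    have "\<exists>r>0. mball x r \<subseteq> W" if x: "x \<in> W" for x
    proof -
      obtain E where E: "E \<in> ?U" "E `` {x} \<subseteq> W" using R x by blast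
      then obtain e where e: "e > 0" "\<forall>x\<in>M. \<forall>y\<in>M. d x y < e \<longrightarrow> (x, y) \<in> E" by auto
      then have "mball x e \<subseteq> W" using E(2) R x by auto
      then show ?thesis using e by blast
    qed
    then show "openin mtopology W" unfolding openin_mtopology using R by blast
  qed
  ultimately have "compatible_uniformity mtopology ?U"
    unfolding compatible_uniformity_def by simp
  then show ?thesis
    using compatible_uniformity_unique[OF assms(2)] compact_uniformity_eq[OF assms(2) Hausdorff_space_mtopology]
    by blast
qed

section \<open>Regular covers and their deck transformations\<close>

lemma subgroup_BijGroupD:
  assumes "subgroup G (BijGroup S)"
  shows "g \<in> G \<Longrightarrow> g \<in> extensional S"
    and "g \<in> G \<Longrightarrow> x \<in> S \<Longrightarrow> g x \<in> S"
    and "(\<lambda>x\<in>S. x) \<in> G"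
    and "g \<in> G \<Longrightarrow> h \<in> G \<Longrightarrow> compose S g h \<in> G"
    and "g \<in> G \<Longrightarrow> \<exists>h\<in>G. \<forall>x\<in>S. h (g x) = x \<and> g (h x) = x"
proof -
  interpret B: group "BijGroup S" by (rule group_BijGroup)
  have sub: "G \<subseteq> Bij S"
    using subgroup.subset[OF assms] by (simp add: BijGroup_def)
  show "g \<in> G \<Longrightarrow> g \<in> extensional S"
    using sub by (auto simp: Bij_def)
  show "g \<in> G \<Longrightarrow> x \<in> S \<Longrightarrow> g x \<in> S"
    using sub Bij_imp_funcset by blast
  show "(\<lambda>x\<in>S. x) \<in> G"
    using subgroup.one_closed[OF assms] by (simp add: BijGroup_def)
  show "compose S g h \<in> G" if "g \<in> G" "h \<in> G"
    using subgroup.m_closed[OF assms that] that sub by (auto simp: BijGroup_def subset_iff)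
  show "\<exists>h\<in>G. \<forall>x\<in>S. h (g x) = x \<and> g (h x) = x" if g: "g \<in> G"
  proof
    have gB: "g \<in> carrier (BijGroup S)" using g sub by (auto simp: BijGroup_def)
    let ?h = "inv\<^bsub>BijGroup S\<^esub> g"
    show h: "?h \<in> G" using subgroup.m_inv_closed[OF assms g] .
    have e: "compose S ?h g = (\<lambda>x\<in>S. x)" "compose S g ?h = (\<lambda>x\<in>S. x)"
      using B.l_inv[OF gB] B.r_inv[OF gB] g h sub by (auto simp: BijGroup_def subset_iff)
    show "\<forall>x\<in>S. ?h (g x) = x \<and> g (?h x) = x"
    proof
      fix x assume "x \<in> S"
      then show "?h (g x) = x \<and> g (?h x) = x"
        using fun_cong[OF e(1), of x] fun_cong[OF e(2), of x] by (simp add: compose_eq)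
    qed
  qed
qed

text \<open>
  A left inverse within \<open>G\<close> suffices: it has a left inverse itself, which makes it two-sided, so
  bijectivity need not be checked separately.
\<close>

lemma subgroup_BijGroupI:
  assumes ext: "\<And>g. g \<in> G \<Longrightarrow> g \<in> extensional S"
    and into: "\<And>g x. g \<in> G \<Longrightarrow> x \<in> S \<Longrightarrow> g x \<in> S"
    and one: "(\<lambda>x\<in>S. x) \<in> G"
    and mult: "\<And>g h. g \<in> G \<Longrightarrow> h \<in> G \<Longrightarrow> compose S g h \<in> G"
    and inverse: "\<And>g. g \<in> G \<Longrightarrow> \<exists>h\<in>G. \<forall>x\<in>S. h (g x) = x"
  shows "subgroup G (BijGroup S)"
proof -
  interpret B: group "BijGroup S" by (rule group_BijGroup)
  have two_sided: "\<exists>h\<in>G. (\<forall>x\<in>S. h (g x) = x) \<and> (\<forall>x\<in>S. g (h x) = x)" if g: "g \<in> G" for g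
  proof -
    obtain h where h: "h \<in> G" "\<forall>x\<in>S. h (g x) = x" using inverse[OF g] by blast
    obtain k where k: "k \<in> G" "\<forall>x\<in>S. k (h x) = x" using inverse[OF h(1)] by blast
    have "g (h x) = x" if "x \<in> S" for x
      using h k into g that by metis
    then show ?thesis using h by blast
  qed
  have Bij: "g \<in> Bij S" if "g \<in> G" for g
    using two_sided[OF that] ext[OF that] into that
    by (auto simp: Bij_def intro!: bij_betw_byWitness)
  show ?thesis
  proof
    show "G \<subseteq> carrier (BijGroup S)" using Bij by (auto simp: BijGroup_def)
    show "\<one>\<^bsub>BijGroup S\<^esub> \<in> G" using one by (simp add: BijGroup_def)
    show "x \<otimes>\<^bsub>BijGroup S\<^esub> y \<in> G" if "x \<in> G" "y \<in> G" for x y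
      using mult[OF that] Bij that by (simp add: BijGroup_def)
    show "inv\<^bsub>BijGroup S\<^esub> g \<in> G" if g: "g \<in> G" for g
    proof -
      obtain h where h: "h \<in> G" "\<forall>x\<in>S. h (g x) = x" using inverse[OF g] by blast
      have "compose S h g = (\<lambda>x\<in>S. x)" using h by (auto simp: compose_def)
      then have "h \<otimes>\<^bsub>BijGroup S\<^esub> g = \<one>\<^bsub>BijGroup S\<^esub>"
        using Bij g h by (simp add: BijGroup_def)
      then have "inv\<^bsub>BijGroup S\<^esub> g = h"
        using B.inv_equality Bij g h by (auto simp: BijGroup_def)
      then show ?thesis using h by simp
    qed
  qed
qed

text \<open>
  For a connected regular cover these are exactly the elements of its group, so the group need not
  be carried along as separate data.
\<close>

definition deck_group :: "'a topology \<Rightarrow> ('a \<Rightarrow> 'b) \<Rightarrow> ('a \<Rightarrow> 'a) set" where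
  "deck_group Z q = {g \<in> extensional (topspace Z). homeomorphic_map Z Z g \<and> (\<forall>z\<in>topspace Z. q (g z) = q z)}"

lemma homeomorphic_map_into: "homeomorphic_map Z Z' g \<Longrightarrow> z \<in> topspace Z \<Longrightarrow> g z \<in> topspace Z'"
  using homeomorphic_imp_surjective_map by fastforce

lemma deck_groupI:
  assumes "homeomorphic_map Z Z g" "\<And>z. z \<in> topspace Z \<Longrightarrow> q (g z) = q z"
  shows "restrict g (topspace Z) \<in> deck_group Z q"
  using assms homeomorphic_map_eq[OF assms(1), of "restrict g (topspace Z)"]
  by (simp add: deck_group_def)

lemma deck_groupD:
  assumes "g \<in> deck_group Z q"
  shows "homeomorphic_map Z Z g" "z \<in> topspace Z \<Longrightarrow> q (g z) = q z" "z \<in> topspace Z \<Longrightarrow> g z \<in> topspace Z"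
  using assms homeomorphic_map_into[of Z Z g z] by (simp_all add: deck_group_def)

lemma subgroup_deck_group: "subgroup (deck_group Z q) (BijGroup (topspace Z))"
proof (rule subgroup_BijGroupI)
  let ?S = "topspace Z"
  show "g \<in> deck_group Z q \<Longrightarrow> g \<in> extensional ?S" for g
    by (simp add: deck_group_def)
  show "g \<in> deck_group Z q \<Longrightarrow> x \<in> ?S \<Longrightarrow> g x \<in> ?S" for g x
    unfolding deck_group_def using homeomorphic_map_into[of Z Z g] by blast
  show "(\<lambda>x\<in>?S. x) \<in> deck_group Z q"
  proof -
    have "homeomorphic_map Z Z id" by simp
    from deck_groupI[OF this, of q] show ?thesis by (simp add: restrict_def id_def)
  qed
  show "compose ?S g h \<in> deck_group Z q" if "g \<in> deck_group Z q" "h \<in> deck_group Z q" for g h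
  proof -
    have gh: "homeomorphic_map Z Z g" "homeomorphic_map Z Z h"
      and "\<And>z. z \<in> ?S \<Longrightarrow> q (g z) = q z" "\<And>z. z \<in> ?S \<Longrightarrow> q (h z) = q z"
      using that by (simp_all add: deck_group_def)
    then have "restrict (g \<circ> h) ?S \<in> deck_group Z q"
      using homeomorphic_map_compose[OF gh(2,1)] homeomorphic_map_into[OF gh(2)]
      by (intro deck_groupI) simp_all
    moreover have "restrict (g \<circ> h) ?S = compose ?S g h"
      by (simp add: compose_def restrict_def fun_eq_iff)
    ultimately show ?thesis by simp
  qed
  show "\<exists>h\<in>deck_group Z q. \<forall>x\<in>?S. h (g x) = x" if g: "g \<in> deck_group Z q" for g
  proof -
    obtain h where h: "homeomorphic_maps Z Z g h"
      using g by (auto simp: deck_group_def homeomorphic_map_maps)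
    then have hh: "homeomorphic_map Z Z h" "\<And>x. x \<in> ?S \<Longrightarrow> h (g x) = x" "\<And>x. x \<in> ?S \<Longrightarrow> g (h x) = x"
      by (auto simp: homeomorphic_maps_map)
    have "q (h z) = q z" if "z \<in> ?S" for z
    proof -
      have "q (g (h z)) = q (h z)"
        using g homeomorphic_map_into[OF hh(1) that] by (simp add: deck_group_def)
      then show ?thesis using hh(3)[OF that] by simp
    qed
    then have "restrict h ?S \<in> deck_group Z q" using hh deck_groupI by blast
    moreover have "\<forall>x\<in>?S. restrict h ?S (g x) = x"
      using hh g homeomorphic_map_into[of Z Z g] by (simp add: deck_group_def)
    ultimately show ?thesis by blast
  qed
qed

lemma closedin_equalizer:
  assumes "continuous_map X Y f" "continuous_map X Y g" "Hausdorff_space Y"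
  shows "closedin X {x \<in> topspace X. f x = g x}"
proof -
  have "\<exists>T. openin X T \<and> x \<in> T \<and> T \<subseteq> {x \<in> topspace X. f x \<noteq> g x}"
    if x: "x \<in> {x \<in> topspace X. f x \<noteq> g x}" for x
  proof -
    have "f x \<in> topspace Y" "g x \<in> topspace Y" "f x \<noteq> g x"
      using x assms(1,2) by (auto simp: continuous_map_def Pi_iff)
    then obtain U V where UV: "openin Y U" "openin Y V" "f x \<in> U" "g x \<in> V" "disjnt U V"
      using assms(3) unfolding Hausdorff_space_def by metis
    let ?T = "{x \<in> topspace X. f x \<in> U} \<inter> {x \<in> topspace X. g x \<in> V}"
    have "openin X ?T"
      using openin_continuous_map_preimage[OF assms(1) UV(1)] openin_continuous_map_preimage[OF assms(2) UV(2)]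
      by (rule openin_Int)
    moreover have "x \<in> ?T" using x UV(3,4) by simp
    moreover have "?T \<subseteq> {x \<in> topspace X. f x \<noteq> g x}" using UV(5) by (auto simp: disjnt_def)
    ultimately show ?thesis by (intro exI[of _ ?T] conjI)
  qed
  then have "openin X {x \<in> topspace X. f x \<noteq> g x}" by (subst openin_subopen) simp
  moreover have "topspace X - {x \<in> topspace X. f x = g x} = {x \<in> topspace X. f x \<noteq> g x}" by auto
  ultimately show ?thesis by (simp add: closedin_def)
qed

definition locally_injective :: "'a topology \<Rightarrow> ('a \<Rightarrow> 'b) \<Rightarrow> bool" where
  "locally_injective Z q \<longleftrightarrow> (\<forall>z\<in>topspace Z. \<exists>V. openin Z V \<and> z \<in> V \<and> inj_on q V)"

text \<open>
  The set where two lifts agree is closed since \<open>Z\<close> is Hausdorff, and open since \<open>q\<close> is locally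
  injective.
\<close>

lemma unique_lift:
  assumes W: "connected_space W" and Z: "Hausdorff_space Z" "locally_injective Z q"
    and h: "continuous_map W Z h" "continuous_map W Z h'"
    and lift: "\<And>w. w \<in> topspace W \<Longrightarrow> q (h w) = q (h' w)"
    and v: "v \<in> topspace W" "h v = h' v"
    and w: "w \<in> topspace W"
  shows "h w = h' w"
proof -
  define A where "A = {w \<in> topspace W. h w = h' w}"
  have "\<exists>T. openin W T \<and> w \<in> T \<and> T \<subseteq> A" if w: "w \<in> A" for w
  proof -
    have "h w \<in> topspace Z" using w h(1) A_def continuous_map_image_subset_topspace by fastforce
    then obtain V where V: "openin Z V" "h w \<in> V" "inj_on q V"
      using Z(2) unfolding locally_injective_def by blast
    let ?T = "{w \<in> topspace W. h w \<in> V} \<inter> {w \<in> topspace W. h' w \<in> V}"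
    have "openin W ?T"
      using h V openin_continuous_map_preimage by (intro openin_Int) blast+
    moreover have "w \<in> ?T" using w V by (auto simp: A_def)
    moreover have "?T \<subseteq> A" using V lift by (auto simp: A_def inj_on_def)
    ultimately show ?thesis by blast
  qed
  then have "openin W A" by (subst openin_subopen) blast
  moreover have "closedin W A"
    unfolding A_def by (rule closedin_equalizer[OF h Z(1)])
  moreover have "v \<in> A" using v by (simp add: A_def)
  ultimately have "A = topspace W"
    using W unfolding connected_space_clopen_in by blast
  then show ?thesis using w by (auto simp: A_def)
qed

text \<open>
  A form of \<^const>\<open>continuum_cover\<close> that is easy to verify: evenly covered neighbourhoods and freeness
  of the action follow from local injectivity and connectedness, see the two lemmas
  \<open>continuum_cover_imp_galois_covering\<close> and \<open>galois_covering_imp_continuum_cover\<close>.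
\<close>

definition galois_covering :: "'a topology \<Rightarrow> 'b topology \<Rightarrow> ('b \<Rightarrow> 'a) \<Rightarrow> bool" where
  "galois_covering X Z q \<longleftrightarrow>
     continuum Z \<and> continuous_map Z X q \<and> open_map Z X q \<and> q ` topspace Z = topspace X \<and>
     locally_injective Z q \<and>
     (\<forall>z\<in>topspace Z. \<forall>w\<in>topspace Z. q z = q w \<longrightarrow> (\<exists>g\<in>deck_group Z q. g z = w))"

lemma continuum_Hausdorff: "continuum Z \<Longrightarrow> Hausdorff_space Z"
  by (simp add: continuum_def metrizable_imp_Hausdorff_space)

lemma galois_coveringD:
  assumes "galois_covering X Z q"
  shows "continuum Z" "compact_space Z" "connected_space Z" "metrizable_space Z" "Hausdorff_space Z"
    "continuous_map Z X q" "open_map Z X q" "q ` topspace Z = topspace X" "locally_injective Z q"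
    "z \<in> topspace Z \<Longrightarrow> w \<in> topspace Z \<Longrightarrow> q z = q w \<Longrightarrow> \<exists>g\<in>deck_group Z q. g z = w"
  using assms continuum_Hausdorff[of Z] by (simp_all add: galois_covering_def continuum_def)

lemma deck_group_agree:
  assumes q: "galois_covering X Z q" and g: "g \<in> deck_group Z q" "g' \<in> deck_group Z q"
    and z: "z \<in> topspace Z" "g z = g' z"
  shows "g = g'"
proof
  fix w
  note Z = galois_coveringD[OF q]
  show "g w = g' w"
  proof (cases "w \<in> topspace Z")
    case True
    show ?thesis
    proof (rule unique_lift[OF Z(3,5,9), where h = g and h' = g'])
      show "continuous_map Z Z g" "continuous_map Z Z g'"
        using deck_groupD(1)[OF g(1)] deck_groupD(1)[OF g(2)] homeomorphic_imp_continuous_map by metis+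
      show "q (g w) = q (g' w)" if "w \<in> topspace Z" for w
        using deck_groupD(2)[OF g(1) that] deck_groupD(2)[OF g(2) that] by simp
    qed (use z True in auto)
  next
    case False
    then show ?thesis using g by (simp add: deck_group_def extensional_def)
  qed
qed

text \<open>
  The preimage of the image of \<open>U\<close> is the union of the translates of \<open>U\<close>.
\<close>

lemma orbit_map_open:
  assumes G: "\<And>g. g \<in> G \<Longrightarrow> homeomorphic_map Z Z g"
    and orb: "orbit_map (topspace Z) (topspace X) G q" and q: "quotient_map Z X q"
  shows "open_map Z X q"
  unfolding open_map_def
proof (intro allI impI)
  fix U assume U: "openin Z U"
  have US: "U \<subseteq> topspace Z" using U openin_subset by blast
  have "{z \<in> topspace Z. q z \<in> q ` U} = (\<Union>g\<in>G. g ` U)"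
  proof
    show "{z \<in> topspace Z. q z \<in> q ` U} \<subseteq> (\<Union>g\<in>G. g ` U)"
    proof clarify
      fix z u assume z: "z \<in> topspace Z" and u: "u \<in> U" "q z = q u"
      then obtain g where "g \<in> G" "g u = z"
        using orb US unfolding orbit_map_def by (metis subsetD)
      then show "z \<in> (\<Union>g\<in>G. g ` U)" using u by blast
    qed
    show "(\<Union>g\<in>G. g ` U) \<subseteq> {z \<in> topspace Z. q z \<in> q ` U}"
    proof clarify
      fix g u assume g: "g \<in> G" and u: "u \<in> U"
      have "g u \<in> topspace Z" using homeomorphic_map_into[OF G[OF g]] u US by blast
      moreover from this have "q u = q (g u)"
        using orb g u US unfolding orbit_map_def by (metis subsetD)
      ultimately show "g u \<in> topspace Z \<and> q (g u) \<in> q ` U" using u by (metis imageI)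
    qed
  qed
  moreover have "openin Z (\<Union>g\<in>G. g ` U)"
    using homeomorphic_map_openness_eq[OF G] U by blast
  moreover have "q ` U \<subseteq> topspace X"
    using q US unfolding quotient_map_def by blast
  ultimately show "openin X (q ` U)"
    using q unfolding quotient_map_def by metis
qed

lemma continuum_cover_imp_galois_covering:
  assumes "continuum_cover X Z L q"
  shows "galois_covering X Z q"
proof -
  have Z: "continuum Z" and L: "subgroup L (BijGroup (topspace Z))" "\<And>g. g \<in> L \<Longrightarrow> homeomorphic_map Z Z g"
    and cov: "covering_map Z X q" and quot: "quotient_map Z X q"
    and orb: "orbit_map (topspace Z) (topspace X) L q"
    using assms unfolding continuum_cover_def regular_covering_map_def by blast+
  have "locally_injective Z q"
    unfolding locally_injective_def
  proof
    fix z assume z: "z \<in> topspace Z"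
    then have "q z \<in> topspace X" using cov unfolding covering_map_def by blast
    then obtain U \<V> where U: "q z \<in> U" "\<Union>\<V> = topspace Z \<inter> q -` U"
      and V: "\<And>V. V \<in> \<V> \<Longrightarrow> openin Z V \<and> homeomorphic_map (subtopology Z V) (subtopology X U) q"
      using cov unfolding covering_map_def by metis
    then obtain V where "z \<in> V" "V \<in> \<V>" using z by blast
    moreover have "inj_on q V"
      using V[OF \<open>V \<in> \<V>\<close>] openin_subset[of Z V]
      by (metis homeomorphic_imp_injective_map topspace_subtopology_subset)
    ultimately show "\<exists>V. openin Z V \<and> z \<in> V \<and> inj_on q V" using V by blast
  qed
  moreover have "\<exists>g\<in>deck_group Z q. g z = w"
    if zw: "z \<in> topspace Z" "w \<in> topspace Z" "q z = q w" for z w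
  proof -
    obtain g where g: "g \<in> L" "g z = w" using orb zw unfolding orbit_map_def by blast
    have "q (g y) = q y" if y: "y \<in> topspace Z" for y
    proof -
      have "g y \<in> topspace Z" using homeomorphic_map_into[OF L(2)[OF g(1)] y] .
      then show ?thesis using orb g y unfolding orbit_map_def by metis
    qed
    then have "restrict g (topspace Z) \<in> deck_group Z q"
      using L(2)[OF g(1)] deck_groupI by blast
    then show ?thesis using zw g by (intro bexI[of _ "restrict g (topspace Z)"]) auto
  qed
  ultimately show ?thesis
    unfolding galois_covering_def
    using Z cov orbit_map_open[OF L(2) orb quot] unfolding covering_map_def by blast
qed

text \<open>
  If \<open>q\<close> is injective on an open set \<open>V\<close>, then the translates of \<open>V\<close> are the sheets over \<open>q ` V\<close>: two
  deck transformations that send points of \<open>V\<close> to the same point agree somewhere, hence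
  everywhere.
\<close>

lemma galois_covering_imp_continuum_cover:
  assumes q: "galois_covering X Z q"
  shows "continuum_cover X Z (deck_group Z q) q"
proof -
  let ?S = "topspace Z" and ?D = "deck_group Z q"
  have Z: "continuum Z" by (rule galois_coveringD(1)[OF q])
  have cq: "continuous_map Z X q" and oq: "open_map Z X q" and sq: "q ` ?S = topspace X"
    and li: "locally_injective Z q"
    and tr: "\<And>z w. z \<in> ?S \<Longrightarrow> w \<in> ?S \<Longrightarrow> q z = q w \<Longrightarrow> \<exists>g\<in>?D. g z = w"
    using q unfolding galois_covering_def by blast+
  note sub = subgroup_BijGroupD[OF subgroup_deck_group[of Z q]]
  have Dh: "homeomorphic_map Z Z g" and Dq: "z \<in> ?S \<Longrightarrow> q (g z) = q z" if "g \<in> ?D" for g z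
    using that by (auto simp: deck_group_def)
  note agree = deck_group_agree[OF q]
  have orb: "orbit_map ?S (topspace X) ?D q"
    unfolding orbit_map_def using sq tr Dq by metis
  have free: "free_action ?S ?D"
    unfolding free_action_def
    using agree[OF _ sub(3)] by (auto simp: BijGroup_def)
  have "\<exists>U. x \<in> U \<and> openin X U \<and>
        (\<exists>\<V>. \<Union>\<V> = ?S \<inter> q -` U \<and> pairwise disjnt \<V> \<and>
             (\<forall>V\<in>\<V>. openin Z V \<and> homeomorphic_map (subtopology Z V) (subtopology X U) q))"
    if x: "x \<in> topspace X" for x
  proof -
    obtain z where z: "z \<in> ?S" "q z = x" using x unfolding sq[symmetric] by blast
    obtain V where V: "openin Z V" "z \<in> V" "inj_on q V"
      using li z(1) unfolding locally_injective_def by meson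
    have VS: "V \<subseteq> ?S" using V(1) by (rule openin_subset)
    define \<V> where "\<V> = (\<lambda>g. g ` V) ` ?D"
    have U: "x \<in> q ` V" "openin X (q ` V)"
      using z V oq by (auto simp: open_map_def)
    have "\<Union>\<V> = ?S \<inter> q -` (q ` V)"
    proof
      show "\<Union>\<V> \<subseteq> ?S \<inter> q -` (q ` V)"
      proof
        fix y assume "y \<in> \<Union>\<V>"
        then obtain g v where g: "g \<in> ?D" and v: "v \<in> V" and y: "y = g v"
          unfolding \<V>_def by blast
        have "v \<in> ?S" using v VS by blast
        then have "y \<in> ?S" "q y = q v" using sub(2)[OF g] Dq[OF g] y by simp_all
        then show "y \<in> ?S \<inter> q -` (q ` V)" using v by simp
      qed
      show "?S \<inter> q -` (q ` V) \<subseteq> \<Union>\<V>"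
      proof clarify
        fix y v assume "y \<in> ?S" "v \<in> V" "q y = q v"
        then obtain g where "g \<in> ?D" "g v = y" using tr VS by (metis subsetD)
        then show "y \<in> \<Union>\<V>" using \<open>v \<in> V\<close> unfolding \<V>_def by blast
      qed
    qed
    moreover have "pairwise disjnt \<V>"
    proof -
      have "g ` V = g' ` V" if g: "g \<in> ?D" "g' \<in> ?D" and ne: "\<not> disjnt (g ` V) (g' ` V)" for g g'
      proof -
        obtain v v' where v: "v \<in> V" "v' \<in> V" "g v = g' v'"
          using ne unfolding disjnt_def by blast
        then have "q v = q v'" using Dq g VS by (metis subsetD)
        then have "v = v'" using v V(3) by (auto dest: inj_onD)
        then show ?thesis using agree[OF g, of v] v VS by blast
      qed
      then show ?thesis unfolding pairwise_def \<V>_def by blast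
    qed
    moreover have "openin Z V' \<and> homeomorphic_map (subtopology Z V') (subtopology X (q ` V)) q"
      if V': "V' \<in> \<V>" for V'
    proof -
      obtain g where g: "g \<in> ?D" "V' = g ` V" using V' \<V>_def by blast
      have o: "openin Z V'" using g V Dh homeomorphic_map_openness_eq by blast
      have im: "q ` V' = q ` V"
        unfolding g(2) image_image using Dq[OF g(1)] VS by (intro image_cong) auto
      have inj: "inj_on q V'"
        unfolding g(2) using V(3) Dq[OF g(1)] VS by (auto simp: inj_on_def subset_iff)
      have ts: "topspace (subtopology Z V') = V'"
        by (rule topspace_subtopology_subset[OF openin_subset[OF o]])
      have "homeomorphic_map (subtopology Z V') (subtopology X (q ` V)) q"
      proof (rule bijective_open_imp_homeomorphic_map)
        show "continuous_map (subtopology Z V') (subtopology X (q ` V)) q"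
          using cq im ts by (intro continuous_map_into_subtopology continuous_map_from_subtopology) auto
        show "open_map (subtopology Z V') (subtopology X (q ` V)) q"
          using open_map_from_subtopology[OF oq o] U(2) im ts by (auto simp: open_map_in_subtopology)
        show "q ` topspace (subtopology Z V') = topspace (subtopology X (q ` V))"
          unfolding ts im topspace_subtopology_subset[OF openin_subset[OF U(2)]] ..
        show "inj_on q (topspace (subtopology Z V'))" using inj ts by simp
      qed
      then show ?thesis using o by blast
    qed
    ultimately show ?thesis using U by blast
  qed
  then have "covering_map Z X q"
    unfolding covering_map_def using cq sq by blast
  then show ?thesis
    unfolding continuum_cover_def regular_covering_map_def
    using Z subgroup_deck_group[of Z q] Dh free orb continuous_open_imp_quotient_map[OF cq oq sq]
    by (intro conjI ballI) simp_all
qed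

lemma galois_covering_homeomorphic:
  assumes q: "galois_covering X Z q" and jk: "homeomorphic_maps Z Z' j k"
  shows "galois_covering X Z' (q \<circ> k)"
proof -
  have cq: "continuous_map Z X q" and oq: "open_map Z X q" and sq: "q ` topspace Z = topspace X"
    and li: "locally_injective Z q"
    and tr: "\<And>z w. z \<in> topspace Z \<Longrightarrow> w \<in> topspace Z \<Longrightarrow> q z = q w \<Longrightarrow> \<exists>g\<in>deck_group Z q. g z = w"
    using q unfolding galois_covering_def by blast+
  have j: "homeomorphic_map Z Z' j" and k: "homeomorphic_map Z' Z k"
    and kj: "\<And>z. z \<in> topspace Z \<Longrightarrow> k (j z) = z" and jk': "\<And>z. z \<in> topspace Z' \<Longrightarrow> j (k z) = z"
    using jk by (auto simp: homeomorphic_maps_map)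
  have hom: "Z homeomorphic_space Z'" using jk homeomorphic_space_def by blast
  have "continuum Z'"
    using q homeomorphic_metrizable_space[OF hom] homeomorphic_connected_space[OF hom]
      homeomorphic_compact_space[OF hom] unfolding galois_covering_def continuum_def by blast
  moreover have "continuous_map Z' X (q \<circ> k)"
    using continuous_map_compose[OF homeomorphic_imp_continuous_map[OF k] cq] .
  moreover have "open_map Z' X (q \<circ> k)"
    using open_map_compose[OF homeomorphic_imp_open_map[OF k] oq] .
  moreover have "(q \<circ> k) ` topspace Z' = topspace X"
    using homeomorphic_imp_surjective_map[OF k] sq by (metis image_comp)
  moreover have "locally_injective Z' (q \<circ> k)"
    unfolding locally_injective_def
  proof
    fix z assume z: "z \<in> topspace Z'"
    then obtain V where V: "openin Z V" "k z \<in> V" "inj_on q V"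
      using li homeomorphic_map_into[OF k] unfolding locally_injective_def by blast
    have "openin Z' {z \<in> topspace Z'. k z \<in> V}"
      using V homeomorphic_imp_continuous_map[OF k] openin_continuous_map_preimage by blast
    moreover have "inj_on (q \<circ> k) {z \<in> topspace Z'. k z \<in> V}"
      using V(3) jk' by (auto simp: inj_on_def) metis
    ultimately show "\<exists>V. openin Z' V \<and> z \<in> V \<and> inj_on (q \<circ> k) V" using z V by blast
  qed
  moreover have "\<exists>g\<in>deck_group Z' (q \<circ> k). g z = w"
    if zw: "z \<in> topspace Z'" "w \<in> topspace Z'" "(q \<circ> k) z = (q \<circ> k) w" for z w
  proof -
    obtain g where g: "g \<in> deck_group Z q" "g (k z) = k w"
      using tr[of "k z" "k w"] zw homeomorphic_map_into[OF k] by auto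
    have gh: "homeomorphic_map Z Z g" "\<And>y. y \<in> topspace Z \<Longrightarrow> q (g y) = q y"
      using g by (auto simp: deck_group_def)
    have "homeomorphic_map Z' Z' (j \<circ> (g \<circ> k))"
      using homeomorphic_map_compose[OF homeomorphic_map_compose[OF k gh(1)] j] .
    moreover have "(q \<circ> k) ((j \<circ> (g \<circ> k)) y) = (q \<circ> k) y" if "y \<in> topspace Z'" for y
      using that gh kj homeomorphic_map_into[OF k] homeomorphic_map_into[OF gh(1)] by simp
    ultimately have "restrict (j \<circ> (g \<circ> k)) (topspace Z') \<in> deck_group Z' (q \<circ> k)"
      by (rule deck_groupI)
    then show ?thesis using zw g jk' by (intro bexI) auto
  qed
  ultimately show ?thesis unfolding galois_covering_def by blast
qed

text \<open>
  Finite \<open>1/(n+1)\<close>-nets for all \<open>n\<close> form a countable set, and a point is determined by the net points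
  close to it; so the space embeds into the power set of a countable set.
\<close>

lemma compact_metrizable_lepoll_reals:
  assumes "compact_space Z" "metrizable_space Z"
  shows "topspace Z \<lesssim> (UNIV :: real set)"
proof -
  obtain M d where "Metric_space M d" and Z: "Z = Metric_space.mtopology M d"
    using assms unfolding metrizable_space_def by blast
  interpret Metric_space M d by fact
  have "mtotally_bounded M"
    using assms compactin_imp_mtotally_bounded unfolding Z compact_space_def by simp
  then have "\<exists>K. finite K \<and> K \<subseteq> M \<and> M \<subseteq> (\<Union>x\<in>K. mball x (1 / real (Suc n)))" for n
    unfolding mtotally_bounded_def by simp
  then obtain K where K: "\<And>n. finite (K n) \<and> K n \<subseteq> M \<and> M \<subseteq> (\<Union>x\<in>K n. mball x (1 / real (Suc n)))"
    by metis
  define T where "T = (UNIV :: nat set) \<times> (\<Union>n. K n)"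
  have T: "countable T" unfolding T_def using K by (intro countable_SIGMA countable_UN) (auto intro: countable_finite)
  define j where "j x = to_nat_on T ` {(n, y) \<in> T. d y x < 1 / real (Suc n)}" for x
  have "inj_on j M"
  proof (rule inj_onI, rule ccontr)
    fix x x' assume x: "x \<in> M" "x' \<in> M" "j x = j x'" "x \<noteq> x'"
    then have "0 < d x x' / 2" by simp
    then obtain n where n: "inverse (real (Suc n)) < d x x' / 2"
      using reals_Archimedean by blast
    obtain y where y: "y \<in> K n" "x \<in> mball y (1 / real (Suc n))" using K x by blast
    have "(n, y) \<in> {(n, y) \<in> T. d y x < 1 / real (Suc n)}"
      using y by (auto simp: T_def)
    moreover have "{(n, y) \<in> T. d y x < 1 / real (Suc n)} = {(n, y) \<in> T. d y x' < 1 / real (Suc n)}"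
    proof (rule inj_on_image_eq_iff[OF inj_on_to_nat_on[OF T], THEN iffD1])
      show "to_nat_on T ` {(n, y) \<in> T. d y x < 1 / real (Suc n)} =
          to_nat_on T ` {(n, y) \<in> T. d y x' < 1 / real (Suc n)}"
        using x(3) unfolding j_def .
    qed auto
    ultimately have "d y x' < 1 / real (Suc n)" by auto
    moreover have "y \<in> M" using y K by blast
    ultimately show False
      using y n triangle[of x y x'] x by (auto simp: commute inverse_eq_divide)
  qed
  then have "M \<lesssim> (UNIV :: nat set set)"
    unfolding lepoll_def by blast
  also have "(UNIV :: nat set set) \<approx> (UNIV :: real set)" by (rule nat_sets_eqpoll_reals)
  finally show ?thesis by (simp add: Z)
qed

text \<open>
  The family of covers is exhaustive for total spaces with real points; a given cover has to be
  transported to a set of reals before the family can be searched for it.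
\<close>

lemma galois_covering_real_model:
  assumes "galois_covering X Z q"
  obtains Z' :: "real topology" and j k where "homeomorphic_maps Z Z' j k"
proof -
  obtain j :: "'b \<Rightarrow> real" where j: "inj_on j (topspace Z)"
    using compact_metrizable_lepoll_reals[of Z] assms
    unfolding galois_covering_def continuum_def lepoll_def by blast
  define S where "S = topspace Z"
  define k where "k = inv_into S j"
  have kj: "k (j z) = z" if "z \<in> S" for z
    unfolding k_def using j that by (simp add: S_def)
  define Z' where "Z' = pullback_topology (j ` S) k Z"
  have ts: "topspace Z' = j ` S"
    unfolding Z'_def topspace_pullback_topology using kj by (auto simp: S_def)
  have "continuous_map Z' Z k"
    unfolding Z'_def using continuous_map_pullback[of Z Z id "j ` S" k] by simp
  moreover have "continuous_map Z Z' j"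
    unfolding Z'_def
  proof (rule continuous_map_pullback')
    show "continuous_map Z Z (k \<circ> j)"
      using kj by (intro continuous_map_eq[OF continuous_map_id]) (simp add: S_def)
    show "topspace Z \<subseteq> j -` (j ` S)" by (auto simp: S_def)
  qed
  ultimately have "homeomorphic_maps Z Z' j k"
    unfolding homeomorphic_maps_def using kj ts by (auto simp: S_def)
  then show ?thesis using that by blast
qed

text \<open>
  An equivalence of covers may move the basepoint; a deck transformation moves it back.
\<close>

lemma all_pointed_covers_complete:
  assumes C: "all_pointed_covers X x0 I C K p c"
    and q: "galois_covering X Z q" and z0: "z0 \<in> topspace Z" "q z0 = x0"
  shows "\<exists>i\<in>I. \<exists>e. homeomorphic_map (C i) Z e \<and> (\<forall>y\<in>topspace (C i). q (e y) = p i y) \<and> e (c i) = z0"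
proof -
  obtain Z' :: "real topology" and j k where jk: "homeomorphic_maps Z Z' j k"
    using galois_covering_real_model[OF q] by metis
  have "continuum_cover X Z' (deck_group Z' (q \<circ> k)) (q \<circ> k)"
    using galois_covering_imp_continuum_cover[OF galois_covering_homeomorphic[OF q jk]] .
  then obtain i where i: "i \<in> I" "equivalent_covers (C i) (K i) (p i) Z' (deck_group Z' (q \<circ> k)) (q \<circ> k)"
    using C unfolding all_pointed_covers_def by metis
  then obtain h where h: "homeomorphic_map (C i) Z' h" "\<And>y. y \<in> topspace (C i) \<Longrightarrow> q (k (h y)) = p i y"
    unfolding equivalent_covers_def by auto
  have k: "homeomorphic_map Z' Z k" using jk by (simp add: homeomorphic_maps_map)
  have kh: "homeomorphic_map (C i) Z (k \<circ> h)" using homeomorphic_map_compose[OF h(1) k] .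
  have ci: "c i \<in> topspace (C i)" "p i (c i) = x0"
    using C i(1) unfolding all_pointed_covers_def by blast+
  have "k (h (c i)) \<in> topspace Z" "q (k (h (c i))) = q z0"
    using homeomorphic_map_into[OF kh ci(1)] h(2)[OF ci(1)] ci(2) z0(2) by simp_all
  then obtain g where g: "g \<in> deck_group Z q" "g (k (h (c i))) = z0"
    using q z0(1) unfolding galois_covering_def by metis
  have "homeomorphic_map (C i) Z (g \<circ> (k \<circ> h))"
    using homeomorphic_map_compose[OF kh, of Z g] g(1) by (auto simp: deck_group_def)
  moreover have "q ((g \<circ> (k \<circ> h)) y) = p i y" if "y \<in> topspace (C i)" for y
    using g h(2)[OF that] homeomorphic_map_into[OF kh that] by (simp add: deck_group_def)
  ultimately show ?thesis using i g by (intro bexI[of _ i] exI[of _ "g \<circ> (k \<circ> h)"]) auto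
qed

section \<open>Directed families of covers\<close>

lemma directed_closed_Inter_nonempty:
  assumes X: "compact_space X" and I: "I \<noteq> {}"
    and T: "\<And>i. i \<in> I \<Longrightarrow> closedin X (T i)" "\<And>i. i \<in> I \<Longrightarrow> T i \<noteq> {}"
    and directed: "\<And>i j. i \<in> I \<Longrightarrow> j \<in> I \<Longrightarrow> \<exists>k\<in>I. T k \<subseteq> T i \<and> T k \<subseteq> T j"
  shows "(\<Inter>i\<in>I. T i) \<noteq> {}"
proof -
  have lower: "finite A \<Longrightarrow> A \<subseteq> I \<Longrightarrow> \<exists>k\<in>I. \<forall>i\<in>A. T k \<subseteq> T i" for A
  proof (induction A rule: finite_induct)
    case empty
    then show ?case using I by blast
  next
    case (insert a A)
    then obtain k where k: "k \<in> I" "\<forall>i\<in>A. T k \<subseteq> T i" by auto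
    obtain l where l: "l \<in> I" "T l \<subseteq> T a" "T l \<subseteq> T k" using directed[of a k] insert.prems k by auto
    have "\<forall>i\<in>insert a A. T l \<subseteq> T i" using k(2) l(2,3) by (simp add: subset_trans)
    then show ?case using l(1) by (rule bexI)
  qed
  have "\<Inter>\<F> \<noteq> {}" if \<F>: "finite \<F>" "\<F> \<subseteq> T ` I" for \<F>
  proof -
    obtain A where A: "A \<subseteq> I" "finite A" "\<F> = T ` A"
      using finite_subset_image[OF \<F>] by metis
    then obtain k where k: "k \<in> I" "\<forall>i\<in>A. T k \<subseteq> T i" using lower by metis
    have "T k \<subseteq> \<Inter>\<F>" using k A(3) by auto
    then show ?thesis using T(2)[OF k(1)] by auto
  qed
  moreover have "\<forall>C\<in>T ` I. closedin X C" using T(1) by simp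
  ultimately show ?thesis
    using X[unfolded compact_space_fip, rule_format, of "T ` I"] by simp
qed

text \<open>
  Disjoint open neighbourhoods of the two parts of a separation of the intersection already
  contain some \<open>T k\<close>, by compactness, and so separate it.
\<close>

lemma connectedin_directed_Inter:
  assumes X: "compact_space X" "Hausdorff_space X" and I: "I \<noteq> {}"
    and T: "\<And>i. i \<in> I \<Longrightarrow> closedin X (T i)" "\<And>i. i \<in> I \<Longrightarrow> connectedin X (T i)"
    and directed: "\<And>i j. i \<in> I \<Longrightarrow> j \<in> I \<Longrightarrow> \<exists>k\<in>I. T k \<subseteq> T i \<and> T k \<subseteq> T j"
  shows "connectedin X (\<Inter>i\<in>I. T i)"
proof (rule ccontr)
  let ?S = "\<Inter>i\<in>I. T i"
  assume "\<not> connectedin X ?S"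
  have cS: "closedin X ?S" using I T(1) by (rule closedin_INT)
  obtain E1 E2 where E: "closedin X E1" "closedin X E2" "?S \<subseteq> E1 \<union> E2" "E1 \<inter> E2 \<inter> ?S = {}"
      "E1 \<inter> ?S \<noteq> {}" "E2 \<inter> ?S \<noteq> {}"
    using \<open>\<not> connectedin X ?S\<close> closedin_subset[OF cS] unfolding connectedin_closedin by metis
  have "closedin X (E1 \<inter> ?S)" "closedin X (E2 \<inter> ?S)" using E(1,2) cS by (simp_all add: closedin_Int)
  moreover have "disjnt (E1 \<inter> ?S) (E2 \<inter> ?S)" using E(4) unfolding disjnt_def by blast
  moreover have "normal_space X" using X compact_Hausdorff_or_regular_imp_normal_space by metis
  ultimately obtain U V where U: "openin X U" "E1 \<inter> ?S \<subseteq> U" and V: "openin X V" "E2 \<inter> ?S \<subseteq> V"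
    and UV: "disjnt U V"
    unfolding normal_space_def by metis
  have "\<exists>k\<in>I. T k \<subseteq> U \<union> V"
  proof (rule ccontr)
    assume no: "\<not> (\<exists>k\<in>I. T k \<subseteq> U \<union> V)"
    have "(\<Inter>i\<in>I. T i - (U \<union> V)) \<noteq> {}"
    proof (rule directed_closed_Inter_nonempty[OF X(1) I])
      show "closedin X (T i - (U \<union> V))" if "i \<in> I" for i
        using T(1)[OF that] U(1) V(1) by (simp add: closedin_diff openin_Un)
      show "T i - (U \<union> V) \<noteq> {}" if "i \<in> I" for i
        using no that by (simp add: Diff_eq_empty_iff)
      show "\<exists>k\<in>I. T k - (U \<union> V) \<subseteq> T i - (U \<union> V) \<and> T k - (U \<union> V) \<subseteq> T j - (U \<union> V)"
        if "i \<in> I" "j \<in> I" for i j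
        using directed[OF that] by (meson Diff_mono order_refl)
    qed
    moreover have "?S \<subseteq> U \<union> V" using E(3) U(2) V(2) by blast
    ultimately show False using I by auto
  qed
  then obtain k where k: "k \<in> I" "T k \<subseteq> U \<union> V" by metis
  have "?S \<subseteq> T k" using k(1) by (rule INF_lower)
  then have "U \<inter> T k \<noteq> {}" "V \<inter> T k \<noteq> {}" using E(5,6) U(2) V(2) by auto
  moreover have "U \<inter> V \<inter> T k = {}" using UV by (auto simp: disjnt_def)
  ultimately show False
    using T(2)[OF k(1)] U(1) V(1) k(2) unfolding connectedin by metis
qed

lemma finite_locally_injective_fibre:
  assumes "compact_space Z" "locally_injective Z q"
  shows "finite {z \<in> topspace Z. q z = x}"
proof -
  obtain V where V: "\<And>z. z \<in> topspace Z \<Longrightarrow> openin Z (V z) \<and> z \<in> V z" "\<And>z. z \<in> topspace Z \<Longrightarrow> inj_on q (V z)"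
    using assms(2) unfolding locally_injective_def by metis
  obtain A where A: "finite A" "A \<subseteq> topspace Z" "topspace Z \<subseteq> (\<Union>z\<in>A. V z)"
    using compact_space_pointwise_subcover[OF assms(1) V(1)] by metis
  have "finite {z \<in> V a. q z = x}" if "a \<in> A" for a
  proof (rule finite_subset)
    show "{z \<in> V a. q z = x} \<subseteq> {THE z. z \<in> V a \<and> q z = x}"
    proof
      fix z assume z: "z \<in> {z \<in> V a. q z = x}"
      have "(THE z. z \<in> V a \<and> q z = x) = z"
        using z V(2)[of a] A(2) that by (intro the_equality) (auto dest: inj_onD)
      then show "z \<in> {THE z. z \<in> V a \<and> q z = x}" by simp
    qed
  qed simp
  then have "finite (\<Union>a\<in>A. {z \<in> V a. q z = x})" using A(1) by simp
  then show ?thesis by (rule rev_finite_subset) (use A(3) in auto)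
qed

text \<open>
  The space \<open>X\<close> is not assumed to be locally connected, so components of \<open>W\<close> need not be open in
  general. Here they are: every nonempty clopen set maps onto \<open>X\<close> and so meets the finite fibre
  through \<open>w\<close>; a clopen set containing \<open>w\<close> that meets it in as few points as possible cannot be
  split.
\<close>

lemma clopen_connected_piece:
  assumes W: "compact_space W" and X: "connected_space X" "Hausdorff_space X"
    and r: "continuous_map W X r" "open_map W X r" "locally_injective W r"
    and w: "w \<in> topspace W"
  obtains D where "openin W D" "closedin W D" "connectedin W D" "w \<in> D" "r ` D = topspace X"
proof -
  define fib where "fib = {v \<in> topspace W. r v = r w}"
  have fib: "finite fib" unfolding fib_def using finite_locally_injective_fibre[OF W r(3)] .
  have cl: "closed_map W X r" using continuous_imp_closed_map[OF r(1) W X(2)] .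
  have onto: "r ` A = topspace X" if A: "openin W A" "closedin W A" "A \<noteq> {}" for A
  proof -
    have "openin X (r ` A)" using r(2) A(1) by (simp add: open_map_def)
    moreover have "closedin X (r ` A)" using cl A(2) by (simp add: closed_map_def)
    ultimately show ?thesis using X(1) A(3) unfolding connected_space_clopen_in by (metis image_is_empty)
  qed
  have meets: "A \<inter> fib \<noteq> {}" if A: "openin W A" "closedin W A" "A \<noteq> {}" for A
  proof -
    have "r w \<in> topspace X" using r(1) w by (auto simp: continuous_map_def)
    then have "r w \<in> r ` A" using onto[OF A] by simp
    then obtain a where "a \<in> A" "r a = r w" by (metis imageE)
    then show ?thesis using openin_subset[OF A(1)] unfolding fib_def by auto
  qed
  \<comment> \<open>A minimal \<open>D\<close> is found by counting points of the fibre.\<close>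
  define P where "P D \<longleftrightarrow> openin W D \<and> closedin W D \<and> w \<in> D" for D
  have "P (topspace W)" using w by (simp add: P_def)
  then obtain D where D: "P D" and least: "\<And>D'. P D' \<Longrightarrow> card (D \<inter> fib) \<le> card (D' \<inter> fib)"
    using ex_has_least_nat[of P "topspace W" "\<lambda>D. card (D \<inter> fib)"] by metis
  have Dp: "openin W D" "closedin W D" "w \<in> D" using D by (simp_all add: P_def)
  have "connected_space (subtopology W D)"
    unfolding connected_space_clopen_in
  proof (intro allI impI)
    fix T assume T: "openin (subtopology W D) T \<and> closedin (subtopology W D) T"
    have tsD: "topspace (subtopology W D) = D"
      by (rule topspace_subtopology_subset[OF openin_subset[OF Dp(1)]])
    have T1: "openin W T" "closedin W T" "T \<subseteq> D"
      using T Dp openin_trans_full closedin_trans_full openin_subset[of "subtopology W D" T] tsD by auto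
    have T2: "openin W (D - T)" "closedin W (D - T)"
      using T1 Dp by (simp_all add: openin_diff closedin_diff)
    have full: "B = {}" if AB: "P A" "openin W B" "closedin W B" "A \<inter> B = {}" "A \<union> B = D" for A B
    proof (rule ccontr)
      assume "B \<noteq> {}"
      then obtain b where "b \<in> B" "b \<in> fib" using meets[OF AB(2,3)] by auto
      then have "A \<inter> fib \<subset> D \<inter> fib" using AB(4,5) by auto
      then have "card (A \<inter> fib) < card (D \<inter> fib)" using fib by (intro psubset_card_mono) auto
      then show False using least[OF AB(1)] by simp
    qed
    show "T = {} \<or> T = topspace (subtopology W D)"
    proof (cases "w \<in> T")
      case True
      have "D - T = {}"
        by (rule full[of T]) (use True T1 T2 in \<open>auto simp: P_def\<close>)
      then show ?thesis using T1(3) tsD by auto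
    next
      case False
      have "T = {}"
        by (rule full[of "D - T"]) (use False T1 T2 Dp in \<open>auto simp: P_def\<close>)
      then show ?thesis by simp
    qed
  qed
  then have "connectedin W D"
    using openin_subset[OF Dp(1)] by (simp add: connectedin_def)
  moreover have "D \<noteq> {}" using Dp(3) by auto
  ultimately show ?thesis by (intro that[OF Dp(1,2) _ Dp(3)] onto[OF Dp(1,2)])
qed

lemma homeomorphic_map_prod:
  assumes "homeomorphic_map X X' f" "homeomorphic_map Y Y' g"
  shows "homeomorphic_map (prod_topology X Y) (prod_topology X' Y') (map_prod f g)"
proof -
  obtain f' g' where "homeomorphic_maps X X' f f'" "homeomorphic_maps Y Y' g g'"
    using assms unfolding homeomorphic_map_maps by auto
  then have "homeomorphic_maps (prod_topology X Y) (prod_topology X' Y')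
      (\<lambda>(x,y). (f x, g y)) (\<lambda>(x,y). (f' x, g' y))"
    unfolding homeomorphic_maps_prod by simp
  then have "homeomorphic_map (prod_topology X Y) (prod_topology X' Y') (\<lambda>(x,y). (f x, g y))"
    unfolding homeomorphic_map_maps by blast
  then show ?thesis by (simp add: map_prod_def)
qed

text \<open>
  A connected piece \<open>D\<close> of the fibre product of two covers is a common upper bound for them. A
  product of deck transformations that moves one point of \<open>D\<close> to another one maps \<open>D\<close> to itself,
  because \<open>D\<close> is clopen and connected.
\<close>

lemma galois_covering_fibre_product:
  assumes X: "continuum X" and q: "galois_covering X Z q" "galois_covering X Z' q'"
    and w: "z \<in> topspace Z" "z' \<in> topspace Z'" "q z = q' z'"
  obtains D where "D \<subseteq> topspace Z \<times> topspace Z'" "(z, z') \<in> D" "\<And>a b. (a, b) \<in> D \<Longrightarrow> q a = q' b"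
    "galois_covering X (subtopology (prod_topology Z Z') D) (q \<circ> fst)"
proof -
  let ?P = "prod_topology Z Z'"
  note Z = galois_coveringD[OF q(1)] and Z' = galois_coveringD[OF q(2)]
  have X': "connected_space X" "Hausdorff_space X"
    using X continuum_Hausdorff by (auto simp: continuum_def)
  define S where "S = {v \<in> topspace ?P. (q \<circ> fst) v = (q' \<circ> snd) v}"
  define W where "W = subtopology ?P S"
  have r: "continuous_map ?P X (q \<circ> fst)"
    using continuous_map_compose[OF continuous_map_fst Z(6)] .
  have r': "continuous_map ?P X (q' \<circ> snd)"
    using continuous_map_compose[OF continuous_map_snd Z'(6)] .
  have cS: "closedin ?P S" unfolding S_def by (rule closedin_equalizer[OF r r' X'(2)])
  have tW: "topspace W = S"
    unfolding W_def by (rule topspace_subtopology_subset) (auto simp: S_def)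
  have inS: "(a, b) \<in> S \<longleftrightarrow> a \<in> topspace Z \<and> b \<in> topspace Z' \<and> q a = q' b" for a b
    by (auto simp: S_def)
  have W: "compact_space W"
    unfolding W_def using Z(2) Z'(2) cS
    by (intro compact_space_subtopology closedin_compact_space) (simp_all add: compact_space_prod_topology)
  have rW: "continuous_map W X (q \<circ> fst)"
    unfolding W_def using continuous_map_from_subtopology[OF r] .
  have oW: "open_map W X (q \<circ> fst)"
    unfolding open_map_def
  proof (intro allI impI)
    fix U assume "openin W U"
    then obtain O' where O': "openin ?P O'" "U = O' \<inter> S" unfolding W_def openin_subtopology by metis
    have "\<exists>T. openin X T \<and> x \<in> T \<and> T \<subseteq> (q \<circ> fst) ` U" if x: "x \<in> (q \<circ> fst) ` U" for x
    proof -
      obtain a b where ab: "(a, b) \<in> O'" "(a, b) \<in> S" "x = q a" using x O'(2) by auto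
      obtain A B where A: "openin Z A" "a \<in> A" and B: "openin Z' B" "b \<in> B" and AB: "A \<times> B \<subseteq> O'"
        using openin_prod_topology_alt[THEN iffD1, rule_format, OF O'(1) ab(1)] by metis
      have "openin X (q ` A \<inter> q' ` B)"
        using A(1) B(1) Z(7) Z'(7) by (simp add: open_map_def openin_Int)
      moreover have "x \<in> q ` A \<inter> q' ` B" using ab A(2) B(2) inS by (metis IntI imageI)
      moreover have "q ` A \<inter> q' ` B \<subseteq> (q \<circ> fst) ` U"
      proof
        fix y assume "y \<in> q ` A \<inter> q' ` B"
        then obtain a' b' where "a' \<in> A" "b' \<in> B" "y = q a'" "y = q' b'" by auto
        moreover from this have "(a', b') \<in> U"
          using AB O'(2) inS openin_subset[OF A(1)] openin_subset[OF B(1)] by auto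
        ultimately show "y \<in> (q \<circ> fst) ` U" by force
      qed
      ultimately show ?thesis by (intro exI[of _ "q ` A \<inter> q' ` B"] conjI)
    qed
    then show "openin X ((q \<circ> fst) ` U)" by (subst openin_subopen) simp
  qed
  have liW: "locally_injective W (q \<circ> fst)"
    unfolding locally_injective_def tW
  proof
    fix v assume v: "v \<in> S"
    obtain a b where ab: "v = (a, b)" by (cases v)
    obtain A where A: "openin Z A" "a \<in> A" "inj_on q A"
      using Z(9) v ab inS unfolding locally_injective_def by metis
    obtain B where B: "openin Z' B" "b \<in> B" "inj_on q' B"
      using Z'(9) v ab inS unfolding locally_injective_def by metis
    have "openin W (A \<times> B \<inter> S)"
      unfolding W_def openin_subtopology using A(1) B(1)
      by (intro exI[of _ "A \<times> B"]) (simp add: openin_prod_Times_iff)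
    moreover have "v \<in> A \<times> B \<inter> S" using A(2) B(2) ab v by simp
    moreover have "inj_on (q \<circ> fst) (A \<times> B \<inter> S)"
    proof (rule inj_onI)
      fix x y assume x: "x \<in> A \<times> B \<inter> S" and y: "y \<in> A \<times> B \<inter> S" and eq: "(q \<circ> fst) x = (q \<circ> fst) y"
      have "fst x = fst y" using x y eq A(3) by (auto dest: inj_onD)
      moreover have "snd x = snd y" using x y eq B(3) inS by (auto dest: inj_onD)
      ultimately show "x = y" by (rule prod_eqI)
    qed
    ultimately show "\<exists>V. openin W V \<and> v \<in> V \<and> inj_on (q \<circ> fst) V"
      by (intro exI[of _ "A \<times> B \<inter> S"] conjI)
  qed
  have "(z, z') \<in> topspace W" using w tW inS by simp
  then obtain D where D: "openin W D" "closedin W D" "connectedin W D" "(z, z') \<in> D" "(q \<circ> fst) ` D = topspace X"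
    using clopen_connected_piece[OF W X' rW oW liW] by metis
  have DS: "D \<subseteq> S" using openin_subset[OF D(1)] tW by simp
  have WD: "subtopology W D = subtopology ?P D"
    unfolding W_def subtopology_subtopology using DS by (simp add: Int_absorb1)
  have tD: "topspace (subtopology ?P D) = D"
    by (rule topspace_subtopology_subset) (use DS S_def in auto)
  have "galois_covering X (subtopology ?P D) (q \<circ> fst)"
    unfolding galois_covering_def tD
  proof (intro conjI ballI impI)
    have "compact_space (subtopology W D)"
      using closedin_compact_space[OF W D(2)] by (rule compact_space_subtopology)
    moreover have "metrizable_space (subtopology ?P D)"
      using Z(4) Z'(4) by (simp add: metrizable_space_subtopology metrizable_space_prod_topology)
    ultimately show "continuum (subtopology ?P D)"
      using D(3) unfolding continuum_def WD[symmetric] connectedin_def by simp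
    show "continuous_map (subtopology ?P D) X (q \<circ> fst)"
      using continuous_map_from_subtopology[OF r] .
    show "open_map (subtopology ?P D) X (q \<circ> fst)"
      using open_map_from_subtopology[OF oW D(1)] by (simp add: WD)
    show "(q \<circ> fst) ` D = topspace X" by (fact D(5))
    show "locally_injective (subtopology ?P D) (q \<circ> fst)"
      unfolding locally_injective_def tD
    proof
      fix v assume v: "v \<in> D"
      then obtain V where V: "openin W V" "v \<in> V" "inj_on (q \<circ> fst) V"
        using liW DS tW unfolding locally_injective_def by (metis subsetD)
      have "openin (subtopology ?P D) (V \<inter> D)"
        unfolding WD[symmetric] openin_subtopology using V(1) by (intro exI[of _ V]) simp
      then show "\<exists>V. openin (subtopology ?P D) V \<and> v \<in> V \<and> inj_on (q \<circ> fst) V"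
        using v V(2) inj_on_subset[OF V(3), of "V \<inter> D"] by (intro exI[of _ "V \<inter> D"]) simp
    qed
    fix u v assume u: "u \<in> D" and v: "v \<in> D" and uv: "(q \<circ> fst) u = (q \<circ> fst) v"
    obtain a b a' b' where e: "u = (a, b)" "v = (a', b')" by (cases u, cases v)
    have ab: "a \<in> topspace Z" "b \<in> topspace Z'" "q a = q' b" "a' \<in> topspace Z" "b' \<in> topspace Z'" "q a' = q' b'"
      using u v DS inS unfolding e by auto
    have "q a = q a'" using uv e by simp
    then obtain g where g: "g \<in> deck_group Z q" "g a = a'" using Z(10)[OF ab(1,4)] by auto
    have "q' b = q' b'" using \<open>q a = q a'\<close> ab by simp
    then obtain h where h: "h \<in> deck_group Z' q'" "h b = b'" using Z'(10)[OF ab(2,5)] by auto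
    define k where "k = map_prod g h"
    have kP: "homeomorphic_map ?P ?P k"
      unfolding k_def by (rule homeomorphic_map_prod[OF deck_groupD(1)[OF g(1)] deck_groupD(1)[OF h(1)]])
    have kW: "homeomorphic_map W W k"
      unfolding W_def
    proof (rule homeomorphic_map_subtopologies_alt[OF kP])
      fix x assume x: "x \<in> topspace ?P"
      obtain c d where cd: "x = (c, d)" by (cases x)
      show "k x \<in> S \<longleftrightarrow> x \<in> S"
        using x deck_groupD(2,3)[OF g(1)] deck_groupD(2,3)[OF h(1)] by (simp add: cd k_def inS)
    qed
    have ku: "k u = v" using g(2) h(2) by (simp add: k_def e)
    have kD: "openin W (k ` D)" "closedin W (k ` D)" "connectedin W (k ` D)"
    proof -
      show "openin W (k ` D)" using homeomorphic_imp_open_map[OF kW] D(1) by (simp add: open_map_def)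
      show "closedin W (k ` D)" using homeomorphic_imp_closed_map[OF kW] D(2) by (simp add: closed_map_def)
      show "connectedin W (k ` D)"
        by (rule connectedin_continuous_map_image[OF homeomorphic_imp_continuous_map[OF kW] D(3)])
    qed
    have meet: "v \<in> k ` D" "v \<in> D" using u v ku by auto
    have "D \<subseteq> k ` D" using connectedin_clopen_cases[OF D(3) kD(2,1)] meet unfolding disjnt_def by blast
    moreover have "k ` D \<subseteq> D" using connectedin_clopen_cases[OF kD(3) D(2,1)] meet unfolding disjnt_def by blast
    ultimately have "k ` D = D" by (rule equalityI[rotated])
    then have "homeomorphic_map (subtopology ?P D) (subtopology ?P D) k"
      using kP DS S_def by (intro homeomorphic_map_subtopologies) (auto simp: Int_absorb1)
    moreover have "(q \<circ> fst) (k x) = (q \<circ> fst) x" if "x \<in> topspace (subtopology ?P D)" for x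
    proof -
      obtain c d where cd: "x = (c, d)" by (cases x)
      have "c \<in> topspace Z" using that DS inS unfolding tD cd by auto
      then show ?thesis using deck_groupD(2)[OF g(1)] by (simp add: cd k_def)
    qed
    ultimately have "restrict k (topspace (subtopology ?P D)) \<in> deck_group (subtopology ?P D) (q \<circ> fst)"
      by (rule deck_groupI)
    then show "\<exists>g\<in>deck_group (subtopology ?P D) (q \<circ> fst). g u = v"
      using ku u tD by (intro bexI[of _ "restrict k (topspace (subtopology ?P D))"]) auto
  qed
  moreover have "D \<subseteq> topspace Z \<times> topspace Z'" using DS by (auto simp: S_def)
  moreover have "q a = q' b" if "(a, b) \<in> D" for a b
    using that DS inS by blast
  ultimately show ?thesis using that[of D] D(4) by blast
qed

text \<open>
  Near \<open>h u\<close> the map \<open>q'\<close> is injective, so there the image under \<open>h\<close> is the preimage under \<open>q'\<close> of the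
  image under \<open>q\<close>.
\<close>

lemma open_map_lift:
  assumes h: "continuous_map Z Z' h" and q: "open_map Z X q" and q': "continuous_map Z' X q'" "locally_injective Z' q'"
    and lift: "\<And>z. z \<in> topspace Z \<Longrightarrow> q' (h z) = q z"
  shows "open_map Z Z' h"
  unfolding open_map_def
proof (intro allI impI)
  fix U assume U: "openin Z U"
  have US: "U \<subseteq> topspace Z" using U by (rule openin_subset)
  have "\<exists>T. openin Z' T \<and> y \<in> T \<and> T \<subseteq> h ` U" if y: "y \<in> h ` U" for y
  proof -
    obtain u where u: "u \<in> U" "y = h u" using y by auto
    have "h u \<in> topspace Z'" using h u US by (auto simp: continuous_map_def)
    then obtain V where V: "openin Z' V" "h u \<in> V" "inj_on q' V"
      using q'(2) unfolding locally_injective_def by metis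
    define U' where "U' = {z \<in> U. h z \<in> V}"
    have oU': "openin Z U'" unfolding U'_def by (rule openin_continuous_map_preimage_gen[OF h U V(1)])
    define T where "T = {z \<in> V. q' z \<in> q ` U'}"
    have "openin X (q ` U')" using q oU' by (simp add: open_map_def)
    then have "openin Z' T" unfolding T_def by (rule openin_continuous_map_preimage_gen[OF q'(1) V(1)])
    moreover have "y \<in> T" using u V(2) US lift by (auto simp: T_def U'_def)
    moreover have "T \<subseteq> h ` U"
    proof
      fix t assume "t \<in> T"
      then obtain v where v: "v \<in> U'" "t \<in> V" "q' t = q v" unfolding T_def by auto
      then have "q' t = q' (h v)" "h v \<in> V" using lift US by (auto simp: U'_def)
      then have "t = h v" using V(3) v(2) by (auto dest: inj_onD)
      then show "t \<in> h ` U" using v(1) by (auto simp: U'_def)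
    qed
    ultimately show ?thesis by (intro exI[of _ T] conjI)
  qed
  then show "openin Z' (h ` U)" by (subst openin_subopen) simp
qed

text \<open>
  The image is open by the previous lemma and closed by compactness.
\<close>

lemma lift_surjective:
  assumes q: "galois_covering X Z q" "galois_covering X Z' q'" and Z: "topspace Z \<noteq> {}"
    and h: "continuous_map Z Z' h" and lift: "\<And>z. z \<in> topspace Z \<Longrightarrow> q' (h z) = q z"
  shows "h ` topspace Z = topspace Z'"
proof -
  note q1 = galois_coveringD[OF q(1)] and q2 = galois_coveringD[OF q(2)]
  have "open_map Z Z' h" using open_map_lift[OF h q1(7) q2(6,9) lift] .
  then have "openin Z' (h ` topspace Z)" by (simp add: open_map_def)
  moreover have "closedin Z' (h ` topspace Z)"
    using continuous_imp_closed_map[OF h q1(2) q2(5)] by (simp add: closed_map_def)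
  ultimately show ?thesis
    using q2(3) Z unfolding connected_space_clopen_in by (metis image_is_empty)
qed

section \<open>Uniform structure of covers\<close>

lemma compact_uniformity_preimage:
  assumes Z: "compact_space Z" "Hausdorff_space Z" and Z': "compact_space Z'" "Hausdorff_space Z'"
    and h: "continuous_map Z Z' h" and E: "E \<in> compact_uniformity Z'"
  shows "{(x, y). x \<in> topspace Z \<and> y \<in> topspace Z \<and> (h x, h y) \<in> E} \<in> compact_uniformity Z" (is "?P \<in> _")
proof -
  obtain Q where Q: "openin (prod_topology Z' Z') Q" "Id_on (topspace Z') \<subseteq> Q" "Q \<subseteq> E" and "sym E"
    using E unfolding compact_uniformity_eq[OF Z'] diagonal_uniformity_def by auto
  have hh: "continuous_map (prod_topology Z Z) (prod_topology Z' Z') (map_prod h h)"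
    using h continuous_map_prod_top[of Z Z Z' Z' h h] by (simp add: map_prod_def)
  let ?R = "{v \<in> topspace (prod_topology Z Z). map_prod h h v \<in> Q}"
  have "openin (prod_topology Z Z) ?R"
    by (rule openin_continuous_map_preimage[OF hh Q(1)])
  moreover have "Id_on (topspace Z) \<subseteq> ?R"
  proof
    fix v assume "v \<in> Id_on (topspace Z)"
    then obtain x where x: "x \<in> topspace Z" "v = (x, x)" by (auto elim: Id_onE)
    then have "h x \<in> topspace Z'" using h by (auto simp: continuous_map_def)
    then show "v \<in> ?R" using Q(2) x by auto
  qed
  moreover have "?R \<subseteq> ?P" using Q(3) by auto
  moreover have "sym ?P" using \<open>sym E\<close> by (auto simp: sym_def)
  moreover have "?P \<subseteq> topspace Z \<times> topspace Z" by auto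
  ultimately show ?thesis
    unfolding compact_uniformity_eq[OF Z] diagonal_uniformity_def mem_Collect_eq
    by (intro conjI exI[of _ ?R])
qed

lemma finite_Inter_entourage:
  assumes u: "is_uniformity S \<U>" and "finite A" "A \<noteq> {}" and E: "\<And>a. a \<in> A \<Longrightarrow> E a \<in> \<U>"
  shows "(\<Inter>a\<in>A. E a) \<in> \<U>"
  using assms(2,3) E
proof (induction A rule: finite_ne_induct)
  case (singleton a)
  then show ?case by simp
next
  case (insert a A)
  then show ?case using is_uniformityD(5)[OF u, of "E a" "\<Inter>a\<in>A. E a"] by simp
qed

lemma finite_deck_group:
  assumes q: "galois_covering X Z q"
  shows "finite (deck_group Z q)"
proof (cases "topspace Z = {}")
  case True
  then have "deck_group Z q \<subseteq> {\<lambda>x. undefined}"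
    by (auto simp: deck_group_def extensional_def)
  then show ?thesis by (rule finite_subset) simp
next
  case False
  then obtain z where z: "z \<in> topspace Z" by blast
  have "inj_on (\<lambda>g. g z) (deck_group Z q)"
    using deck_group_agree[OF q] z by (intro inj_onI) metis
  moreover have "(\<lambda>g. g z) ` deck_group Z q \<subseteq> {w \<in> topspace Z. q w = q z}"
    using deck_groupD(2,3)[OF _ z, of _ q] by auto
  moreover have "finite {w \<in> topspace Z. q w = q z}"
    using finite_locally_injective_fibre[OF galois_coveringD(2,9)[OF q]] .
  ultimately show ?thesis by (metis finite_imageD finite_subset)
qed

text \<open>
  The deck group of a cover by a continuum is finite, so the translates of an entourage can be
  intersected.
\<close>

lemma galois_covering_invariant_entourage:
  assumes q: "galois_covering X Z q" and E: "E \<in> compact_uniformity Z"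
  obtains F where "F \<in> compact_uniformity Z" "F \<subseteq> E"
    "\<And>g x y. g \<in> deck_group Z q \<Longrightarrow> (x, y) \<in> F \<Longrightarrow> (g x, g y) \<in> F"
proof -
  note Z = galois_coveringD[OF q]
  have u: "is_uniformity (topspace Z) (compact_uniformity Z)"
    by (rule is_uniformity_compact_uniformity[OF Z(2,5)])
  note sub = subgroup_BijGroupD[OF subgroup_deck_group[of Z q]]
  let ?P = "\<lambda>g. {(x, y). x \<in> topspace Z \<and> y \<in> topspace Z \<and> (g x, g y) \<in> E}"
  define F where "F = (\<Inter>g\<in>deck_group Z q. ?P g)"
  have F: "(x, y) \<in> F \<longleftrightarrow> x \<in> topspace Z \<and> y \<in> topspace Z \<and> (\<forall>g\<in>deck_group Z q. (g x, g y) \<in> E)" for x y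
    using sub(3) by (auto simp: F_def)
  have "F \<in> compact_uniformity Z"
    unfolding F_def
  proof (rule finite_Inter_entourage[OF u finite_deck_group[OF q]])
    show "deck_group Z q \<noteq> {}" using sub(3) by auto
    show "?P g \<in> compact_uniformity Z" if "g \<in> deck_group Z q" for g
      by (rule compact_uniformity_preimage[OF Z(2,5) Z(2,5)
            homeomorphic_imp_continuous_map[OF deck_groupD(1)[OF that]] E])
  qed
  moreover have "F \<subseteq> E"
  proof clarify
    fix x y assume "(x, y) \<in> F"
    then have xy: "x \<in> topspace Z" "y \<in> topspace Z" "\<forall>g\<in>deck_group Z q. (g x, g y) \<in> E"
      unfolding F by auto
    from bspec[OF xy(3) sub(3)] xy(1,2) show "(x, y) \<in> E" by simp
  qed
  moreover have "(g x, g y) \<in> F" if g: "g \<in> deck_group Z q" and xy: "(x, y) \<in> F" for g x y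
    unfolding F
  proof (intro conjI ballI)
    have xy': "x \<in> topspace Z" "y \<in> topspace Z" using xy F by auto
    then show "g x \<in> topspace Z" "g y \<in> topspace Z" using deck_groupD(3)[OF g] by auto
    fix h assume h: "h \<in> deck_group Z q"
    have "\<forall>g\<in>deck_group Z q. (g x, g y) \<in> E" using xy unfolding F by auto
    from bspec[OF this sub(4)[OF h g]] xy' show "(h (g x), h (g y)) \<in> E" by (simp add: compose_def)
  qed
  ultimately show ?thesis by (rule that)
qed

text \<open>
  A deck transformation that moves a single point by less than this entourage fixes it, and so
  is the identity.
\<close>

lemma galois_covering_discrete_entourage:
  assumes q: "galois_covering X Z q"
  shows "{(x, y). x \<in> topspace Z \<and> y \<in> topspace Z \<and> (q x = q y \<longrightarrow> x = y)} \<in> compact_uniformity Z" (is "?F \<in> _")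
proof -
  note Z = galois_coveringD[OF q]
  let ?Q = "\<Union>{V \<times> V |V. openin Z V \<and> inj_on q V}"
  have "openin (prod_topology Z Z) ?Q"
    by (rule openin_Union) (auto simp: openin_prod_Times_iff)
  moreover have "Id_on (topspace Z) \<subseteq> ?Q"
  proof clarify
    fix z assume "z \<in> topspace Z"
    then obtain V where "openin Z V" "z \<in> V" "inj_on q V"
      using Z(9) unfolding locally_injective_def by metis
    then show "(z, z) \<in> ?Q" by auto
  qed
  moreover have "?Q \<subseteq> ?F"
  proof clarify
    fix x y V assume V: "openin Z V" "inj_on q V" "x \<in> V" "y \<in> V"
    then show "x \<in> topspace Z \<and> y \<in> topspace Z \<and> (q x = q y \<longrightarrow> x = y)"
      using openin_subset[OF V(1)] by (auto dest: inj_onD)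
  qed
  moreover have "?F \<subseteq> topspace Z \<times> topspace Z" "sym ?F" by (auto simp: sym_def)
  ultimately show ?thesis
    unfolding compact_uniformity_eq[OF Z(2,5)] diagonal_uniformity_def mem_Collect_eq
    by (intro conjI exI[of _ ?Q])
qed

section \<open>The compact universal cover\<close>

locale pointed_covers =
  fixes X :: "'a topology" and x0 :: 'a
    and I :: "'i set" and C :: "'i \<Rightarrow> 'b topology" and K :: "'i \<Rightarrow> ('b \<Rightarrow> 'b) set"
    and p :: "'i \<Rightarrow> 'b \<Rightarrow> 'a" and c :: "'i \<Rightarrow> 'b"
  assumes X: "continuum X" and covers: "all_pointed_covers X x0 I C K p c"
begin

abbreviation "bond \<equiv> bonding_map C p c"
abbreviation "Xhat \<equiv> universal_cover I C p c"
abbreviation "phi \<equiv> universal_proj I p"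

lemma x0: "x0 \<in> topspace X"
  using covers by (simp add: all_pointed_covers_def)

lemma galois: "i \<in> I \<Longrightarrow> galois_covering X (C i) (p i)"
  using covers unfolding all_pointed_covers_def
  by (elim conjE, intro continuum_cover_imp_galois_covering) blast

lemma base: "i \<in> I \<Longrightarrow> c i \<in> topspace (C i)" "i \<in> I \<Longrightarrow> p i (c i) = x0"
  using covers by (simp_all add: all_pointed_covers_def)

lemma cover_exists:
  assumes "galois_covering X Z q" "z0 \<in> topspace Z" "q z0 = x0"
  shows "\<exists>i\<in>I. \<exists>e. homeomorphic_map (C i) Z e \<and> (\<forall>y\<in>topspace (C i). q (e y) = p i y) \<and> e (c i) = z0"
  using all_pointed_covers_complete[OF covers assms] .

text \<open>
  The identity of \<open>X\<close> is a cover.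
\<close>

lemma nonempty: "I \<noteq> {}"
proof -
  have "galois_covering X X id"
    unfolding galois_covering_def
  proof (intro conjI ballI impI)
    show "locally_injective X id" unfolding locally_injective_def by (auto intro: exI[of _ "topspace X"])
    show "\<exists>g\<in>deck_group X id. g z = w" if "z \<in> topspace X" "w \<in> topspace X" "id z = id w" for z w
      using that subgroup_BijGroupD(3)[OF subgroup_deck_group[of X id]] by (intro bexI) auto
  qed (use X in \<open>auto simp: open_map_id\<close>)
  then show ?thesis using cover_exists[of X id x0] x0 by auto
qed

lemma lift_unique:
  assumes i: "i \<in> I" and W: "connected_space W"
    and h: "continuous_map W (C i) h" "continuous_map W (C i) h'"
    and lift: "\<And>w. w \<in> topspace W \<Longrightarrow> p i (h w) = p i (h' w)"
    and v: "v \<in> topspace W" "h v = h' v" and w: "w \<in> topspace W"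
  shows "h w = h' w"
  by (rule unique_lift[OF W galois_coveringD(5,9)[OF galois[OF i]] h lift v w])

text \<open>
  Pointed lifts are unique, so the description in \<^const>\<open>bonding_map\<close> denotes any given pointed lift.
\<close>

lemma bond_exists:
  assumes ij: "i \<in> I" "j \<in> I" and h: "continuous_map (C j) (C i) h"
    and lift: "\<And>y. y \<in> topspace (C j) \<Longrightarrow> p i (h y) = p j y" and hc: "h (c j) = c i"
  shows "cover_le C p i j" "y \<in> topspace (C j) \<Longrightarrow> bond i j y = h y"
proof -
  let ?S = "topspace (C j)"
  have surj: "h ` ?S = topspace (C i)"
    by (rule lift_surjective[OF galois[OF ij(2)] galois[OF ij(1)] _ h lift]) (use base(1)[OF ij(2)] in blast)
  show "cover_le C p i j"
    unfolding cover_le_def using h surj lift by (intro exI[of _ h]) simp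
  have "bond i j = restrict h ?S"
    unfolding bonding_map_def
  proof (rule the_equality)
    show "restrict h ?S \<in> extensional ?S \<and> continuous_map (C j) (C i) (restrict h ?S) \<and>
       restrict h ?S ` ?S = topspace (C i) \<and>
       (\<forall>y\<in>?S. p j y = p i (restrict h ?S y)) \<and> restrict h ?S (c j) = c i"
      using h surj lift hc base(1)[OF ij(2)] by simp
    fix h' assume h': "h' \<in> extensional ?S \<and> continuous_map (C j) (C i) h' \<and> h' ` ?S = topspace (C i) \<and>
       (\<forall>y\<in>?S. p j y = p i (h' y)) \<and> h' (c j) = c i"
    have "h' y = h y" if "y \<in> ?S" for y
    proof (rule lift_unique[OF ij(1), where W = "C j" and v = "c j" and h = h' and h' = h and w = y])
      show "connected_space (C j)" using galois_coveringD(3)[OF galois[OF ij(2)]] .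
      show "p i (h' w) = p i (h w)" if "w \<in> ?S" for w using h' lift that by simp
    qed (use h' h hc base ij that in auto)
    then show "h' = restrict h ?S" using h' by (intro extensionalityI[of _ ?S]) auto
  qed
  then show "y \<in> ?S \<Longrightarrow> bond i j y = h y" by simp
qed

lemma bond:
  assumes ij: "i \<in> I" "j \<in> I" "cover_le C p i j"
  shows "continuous_map (C j) (C i) (bond i j)" "bond i j ` topspace (C j) = topspace (C i)"
    "y \<in> topspace (C j) \<Longrightarrow> p i (bond i j y) = p j y" "bond i j (c j) = c i"
    "y \<in> topspace (C j) \<Longrightarrow> bond i j y \<in> topspace (C i)"
proof -
  let ?S = "topspace (C j)"
  obtain h where h: "continuous_map (C j) (C i) h" "\<And>y. y \<in> ?S \<Longrightarrow> p i (h y) = p j y"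
    using ij(3) unfolding cover_le_def by metis
  have "h (c j) \<in> topspace (C i)" using h(1) base(1)[OF ij(2)] by (auto simp: continuous_map_def)
  moreover have "p i (h (c j)) = p i (c i)" using h(2) base ij by simp
  ultimately obtain k where k: "k \<in> deck_group (C i) (p i)" "k (h (c j)) = c i"
    using galois_coveringD(10)[OF galois[OF ij(1)]] base(1)[OF ij(1)] by metis
  have kh: "continuous_map (C j) (C i) (k \<circ> h)"
    using continuous_map_compose[OF h(1) homeomorphic_imp_continuous_map[OF deck_groupD(1)[OF k(1)]]] .
  have lift: "p i ((k \<circ> h) y) = p j y" if "y \<in> ?S" for y
    using deck_groupD(2)[OF k(1), of "h y"] h that by (auto simp: continuous_map_def)
  have eq: "bond i j y = (k \<circ> h) y" if "y \<in> ?S" for y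
    using bond_exists(2)[OF ij(1,2) kh lift _ that] k(2) by simp
  show "continuous_map (C j) (C i) (bond i j)"
    using continuous_map_eq[OF kh] eq by simp
  then show "y \<in> ?S \<Longrightarrow> bond i j y \<in> topspace (C i)" by (auto simp: continuous_map_def)
  have "(k \<circ> h) ` ?S = topspace (C i)"
    by (rule lift_surjective[OF galois[OF ij(2)] galois[OF ij(1)] _ kh lift]) (use base(1)[OF ij(2)] in blast)
  then show "bond i j ` ?S = topspace (C i)" using eq by simp
  show "y \<in> ?S \<Longrightarrow> p i (bond i j y) = p j y" using eq lift by simp
  show "bond i j (c j) = c i" using eq base(1)[OF ij(2)] k(2) by simp
qed

lemma bond_refl:
  assumes "i \<in> I" shows "cover_le C p i i" "y \<in> topspace (C i) \<Longrightarrow> bond i i y = y"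
  using bond_exists[OF assms assms, of id] by simp_all

lemma bond_trans:
  assumes ij: "i \<in> I" "j \<in> I" "k \<in> I" "cover_le C p i j" "cover_le C p j k"
  shows "cover_le C p i k" "y \<in> topspace (C k) \<Longrightarrow> bond i k y = bond i j (bond j k y)"
proof -
  note b1 = bond[OF ij(1,2,4)] and b2 = bond[OF ij(2,3,5)]
  have 1: "continuous_map (C k) (C i) (bond i j \<circ> bond j k)"
    using continuous_map_compose[OF b2(1) b1(1)] .
  have 2: "p i ((bond i j \<circ> bond j k) y) = p k y" if "y \<in> topspace (C k)" for y
    using b1(3) b2(3,5) that by simp
  have 3: "(bond i j \<circ> bond j k) (c k) = c i" using b1(4) b2(4) by simp
  show "cover_le C p i k" using bond_exists(1)[OF ij(1,3) 1 2 3] .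
  show "y \<in> topspace (C k) \<Longrightarrow> bond i k y = bond i j (bond j k y)"
    using bond_exists(2)[OF ij(1,3) 1 2 3] by simp
qed

lemma directed:
  assumes ij: "i \<in> I" "j \<in> I"
  obtains k where "k \<in> I" "cover_le C p i k" "cover_le C p j k"
proof -
  let ?P = "prod_topology (C i) (C j)"
  obtain D where D: "D \<subseteq> topspace (C i) \<times> topspace (C j)" "(c i, c j) \<in> D" "\<And>a b. (a, b) \<in> D \<Longrightarrow> p i a = p j b"
    and gD: "galois_covering X (subtopology ?P D) (p i \<circ> fst)"
    by (rule galois_covering_fibre_product[OF X galois[OF ij(1)] galois[OF ij(2)] base(1)[OF ij(1)] base(1)[OF ij(2)]])
      (use base(2) ij in auto)
  have tD: "topspace (subtopology ?P D) = D"
    by (rule topspace_subtopology_subset) (use D in auto)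
  obtain k e where k: "k \<in> I" and e: "homeomorphic_map (C k) (subtopology ?P D) e"
      "\<And>y. y \<in> topspace (C k) \<Longrightarrow> (p i \<circ> fst) (e y) = p k y" "e (c k) = (c i, c j)"
    using cover_exists[OF gD, unfolded tD, OF D(2)] base(2)[OF ij(1)] by auto
  have ce: "continuous_map (C k) ?P e"
    using homeomorphic_imp_continuous_map[OF e(1)] by (rule continuous_map_into_fulltopology)
  have "p j (snd (e y)) = p k y" if "y \<in> topspace (C k)" for y
  proof -
    have "e y \<in> D" using homeomorphic_map_into[OF e(1) that] tD by simp
    then show ?thesis using D(3)[of "fst (e y)" "snd (e y)"] e(2)[OF that] by simp
  qed
  then have "cover_le C p j k"
    using continuous_map_compose[OF ce continuous_map_snd] e(3)
    by (intro bond_exists(1)[OF ij(2) k, of "snd \<circ> e"]) auto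
  moreover have "cover_le C p i k"
    using continuous_map_compose[OF ce continuous_map_fst] e(2,3)
    by (intro bond_exists(1)[OF ij(1) k, of "fst \<circ> e"]) auto
  ultimately show ?thesis using that k by metis
qed

text \<open>
  The constraints of the inverse limit that concern indices below \<open>k\<close> only. In contrast to the limit
  itself, a stage is visibly connected: it is a retract of the full product.
\<close>

definition stage :: "'i \<Rightarrow> ('i \<Rightarrow> 'b) set" where
  "stage k = {x \<in> topspace (product_topology C I). \<forall>i\<in>I. cover_le C p i k \<longrightarrow> bond i k (x k) = x i}"

lemma topspace_Xhat: "topspace Xhat = (\<Inter>k\<in>I. stage k)"
  unfolding universal_cover_def topspace_subtopology stage_def using nonempty by auto

lemma in_Xhat:
  "x \<in> topspace Xhat \<longleftrightarrow> x \<in> topspace (product_topology C I) \<and>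
     (\<forall>i\<in>I. \<forall>j\<in>I. cover_le C p i j \<longrightarrow> bond i j (x j) = x i)"
  unfolding universal_cover_def topspace_subtopology by simp

lemma Xhat_coordinate: "x \<in> topspace Xhat \<Longrightarrow> i \<in> I \<Longrightarrow> x i \<in> topspace (C i)"
  unfolding in_Xhat by (auto simp: PiE_iff)

lemma compact_product: "compact_space (product_topology C I)" "Hausdorff_space (product_topology C I)"
  using galois_coveringD(2,5)[OF galois]
  by (simp_all add: compact_space_product_topology Hausdorff_space_product_topology)

lemma stage_mono:
  assumes jk: "j \<in> I" "k \<in> I" "cover_le C p j k"
  shows "stage k \<subseteq> stage j"
proof
  fix x assume x: "x \<in> stage k"
  have xk: "x k \<in> topspace (C k)" using x jk(2) unfolding stage_def by (auto simp: PiE_iff)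
  have "bond i j (x j) = x i" if i: "i \<in> I" "cover_le C p i j" for i
  proof -
    have "x j = bond j k (x k)" using x jk unfolding stage_def by simp
    moreover have "x i = bond i k (x k)"
      using x i(1) bond_trans(1)[OF i(1) jk(1,2) i(2) jk(3)] unfolding stage_def by simp
    ultimately show ?thesis using bond_trans(2)[OF i(1) jk(1,2) i(2) jk(3) xk] by simp
  qed
  then show "x \<in> stage j" using x unfolding stage_def by simp
qed

lemma stage_directed:
  assumes "i \<in> I" "j \<in> I" shows "\<exists>k\<in>I. stage k \<subseteq> stage i \<and> stage k \<subseteq> stage j"
  using directed[OF assms] stage_mono assms by metis

lemma closedin_stage:
  assumes k: "k \<in> I" shows "closedin (product_topology C I) (stage k)"
proof -
  let ?P = "product_topology C I"
  have "closedin ?P {x \<in> topspace ?P. (bond i k \<circ> (\<lambda>x. x k)) x = x i}" if i: "i \<in> I" "cover_le C p i k" for i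
  proof (rule closedin_equalizer)
    show "continuous_map ?P (C i) (bond i k \<circ> (\<lambda>x. x k))"
      using continuous_map_compose[OF continuous_map_product_projection[OF k, of C] bond(1)[OF i(1) k i(2)]] .
    show "continuous_map ?P (C i) (\<lambda>x. x i)" by (rule continuous_map_product_projection[OF i(1)])
    show "Hausdorff_space (C i)" using galois_coveringD(5)[OF galois[OF i(1)]] .
  qed
  then have "closedin ?P (\<Inter>i\<in>{i \<in> I. cover_le C p i k}. {x \<in> topspace ?P. (bond i k \<circ> (\<lambda>x. x k)) x = x i})"
    using k bond_refl(1)[OF k] by (intro closedin_INT) auto
  moreover have "(\<Inter>i\<in>{i \<in> I. cover_le C p i k}. {x \<in> topspace ?P. (bond i k \<circ> (\<lambda>x. x k)) x = x i}) = stage k"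
    using k bond_refl(1)[OF k] unfolding stage_def by auto
  ultimately show ?thesis by simp
qed

text \<open>
  The retraction of the product onto \<open>stage k\<close>.
\<close>

definition spread :: "'i \<Rightarrow> ('i \<Rightarrow> 'b) \<Rightarrow> ('i \<Rightarrow> 'b)" where
  "spread k x = (\<lambda>i\<in>I. if cover_le C p i k then bond i k (x k) else x i)"

lemma spread_in_stage:
  assumes k: "k \<in> I" and x: "x \<in> topspace (product_topology C I)"
  shows "spread k x \<in> stage k" "spread k x k = x k"
proof -
  have xi: "x i \<in> topspace (C i)" if "i \<in> I" for i using x that by (auto simp: PiE_iff)
  show kk: "spread k x k = x k"
    using k bond_refl[OF k] xi by (simp add: spread_def)
  have "spread k x \<in> topspace (product_topology C I)"
    using xi bond(5)[OF _ k _ xi[OF k]] by (auto simp: spread_def PiE_iff extensional_def)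
  moreover have "\<forall>i\<in>I. cover_le C p i k \<longrightarrow> bond i k (spread k x k) = spread k x i"
    unfolding kk by (simp add: spread_def)
  ultimately show "spread k x \<in> stage k" unfolding stage_def by simp
qed

lemma connectedin_stage:
  assumes k: "k \<in> I" shows "connectedin (product_topology C I) (stage k)"
proof -
  let ?P = "product_topology C I"
  have "continuous_map ?P ?P (spread k)"
    unfolding continuous_map_componentwise
  proof (intro conjI ballI)
    show "spread k ` topspace ?P \<subseteq> extensional I" by (auto simp: spread_def)
    show "continuous_map ?P (C i) (\<lambda>x. spread k x i)" if i: "i \<in> I" for i
    proof (cases "cover_le C p i k")
      case True
      then show ?thesis
        using continuous_map_compose[OF continuous_map_product_projection[OF k, of C] bond(1)[OF i k]] i
        by (simp add: spread_def o_def)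
    next
      case False
      then show ?thesis using continuous_map_product_projection[OF i] i by (simp add: spread_def)
    qed
  qed
  moreover have "connectedin ?P (topspace ?P)"
    unfolding connectedin_topspace connected_space_product_topology
    using galois_coveringD(3)[OF galois] by (intro disjI2 ballI)
  ultimately have "connectedin ?P (spread k ` topspace ?P)" by (rule connectedin_continuous_map_image)
  moreover have "spread k ` topspace ?P = stage k"
  proof
    show "spread k ` topspace ?P \<subseteq> stage k" using spread_in_stage(1)[OF k] by blast
    show "stage k \<subseteq> spread k ` topspace ?P"
    proof
      fix x assume x: "x \<in> stage k"
      then have "spread k x i = x i" for i
        by (cases "i \<in> I") (auto simp: spread_def stage_def PiE_iff extensional_def)
      then have "x = spread k x" by auto
      then show "x \<in> spread k ` topspace ?P" using x unfolding stage_def by blast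
    qed
  qed
  ultimately show ?thesis by simp
qed

text \<open>
  The limit is the directed intersection of its stages.
\<close>

lemma Xhat_space: "compact_space Xhat" "Hausdorff_space Xhat" "connected_space Xhat"
proof -
  let ?P = "product_topology C I"
  have cl: "closedin ?P (topspace Xhat)"
    unfolding topspace_Xhat using nonempty closedin_stage by (rule closedin_INT)
  have eq: "Xhat = subtopology ?P (topspace Xhat)"
    unfolding universal_cover_def topspace_subtopology by (rule subtopology_restrict[symmetric])
  show "compact_space Xhat"
    by (subst eq) (rule compact_space_subtopology[OF closedin_compact_space[OF compact_product(1) cl]])
  show "Hausdorff_space Xhat"
    unfolding universal_cover_def using compact_product(2) by (rule Hausdorff_space_subtopology)
  have "connectedin ?P (topspace Xhat)"
    unfolding topspace_Xhat
    by (rule connectedin_directed_Inter[OF compact_product nonempty closedin_stage connectedin_stage stage_directed])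
  then show "connected_space Xhat"
    by (subst eq) (simp add: connectedin_def)
qed

lemma continuous_coordinate: "i \<in> I \<Longrightarrow> continuous_map Xhat (C i) (\<lambda>x. x i)"
  unfolding universal_cover_def
  by (rule continuous_map_from_subtopology[OF continuous_map_product_projection])

lemma base_in_Xhat: "restrict c I \<in> topspace Xhat"
  unfolding in_Xhat using base(1) bond(4) by (auto simp: PiE_iff)

text \<open>
  The points of \<open>stage k\<close> over \<open>z\<close>, for \<open>k\<close> above \<open>i\<close>, form a directed family of nonempty closed sets since
  the bonding maps are onto.
\<close>

lemma coordinate_surjective:
  assumes i: "i \<in> I" and z: "z \<in> topspace (C i)"
  obtains x where "x \<in> topspace Xhat" "x i = z"
proof -
  let ?P = "product_topology C I"
  define J where "J = {k \<in> I. cover_le C p i k}"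
  define F where "F = {x \<in> topspace ?P. x i \<in> {z}}"
  have cF: "closedin ?P F"
    unfolding F_def
    using galois_coveringD(5)[OF galois[OF i]] z
    by (intro closedin_continuous_map_preimage[OF continuous_map_product_projection[OF i]])
      (rule closedin_Hausdorff_singleton)
  have "(\<Inter>k\<in>J. stage k \<inter> F) \<noteq> {}"
  proof (rule directed_closed_Inter_nonempty[OF compact_product(1)])
    show "J \<noteq> {}" using bond_refl(1)[OF i] i J_def by blast
    show "closedin ?P (stage k \<inter> F)" if "k \<in> J" for k
      using that closedin_stage cF J_def by (simp add: closedin_Int)
    show "stage k \<inter> F \<noteq> {}" if k: "k \<in> J" for k
    proof -
      have kI: "k \<in> I" "cover_le C p i k" using k J_def by auto
      obtain w where w: "w \<in> topspace (C k)" "bond i k w = z"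
        using bond(2)[OF i kI] z by (metis imageE)
      \<comment> \<open>Only the coordinate \<open>k\<close> matters; the basepoints merely fill the others.\<close>
      define x where "x = (\<lambda>j\<in>I. if j = k then w else c j)"
      have x: "x \<in> topspace ?P" using w base(1) by (auto simp: x_def PiE_iff)
      have "spread k x i = z" using i kI w by (simp add: spread_def x_def)
      then have "spread k x \<in> stage k \<inter> F"
        using spread_in_stage(1)[OF kI(1) x] by (simp add: F_def stage_def)
      then show ?thesis by auto
    qed
    show "\<exists>k\<in>J. stage k \<inter> F \<subseteq> stage j \<inter> F \<and> stage k \<inter> F \<subseteq> stage l \<inter> F" if jl: "j \<in> J" "l \<in> J" for j l
    proof -
      have jI: "j \<in> I" "l \<in> I" "cover_le C p i j" using jl J_def by auto
      obtain k where k: "k \<in> I" "cover_le C p j k" "cover_le C p l k" using directed[OF jI(1,2)] .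
      have "k \<in> J" using bond_trans(1)[OF i jI(1) k(1) jI(3) k(2)] k(1) J_def by simp
      moreover have "stage k \<subseteq> stage j" "stage k \<subseteq> stage l"
        using stage_mono jI k by auto
      ultimately show ?thesis by (intro bexI[of _ k]) auto
    qed
  qed
  then obtain x where x: "\<And>k. k \<in> J \<Longrightarrow> x \<in> stage k \<inter> F" by blast
  have "x \<in> stage j" if j: "j \<in> I" for j
  proof -
    obtain k where k: "k \<in> I" "cover_le C p i k" "cover_le C p j k" using directed[OF i j] .
    then show ?thesis using x[of k] stage_mono[OF j k(1,3)] by (auto simp: J_def)
  qed
  then have "x \<in> topspace Xhat" unfolding topspace_Xhat by simp
  moreover have "x i = z" using x[of i] bond_refl(1)[OF i] i by (simp add: J_def F_def)
  ultimately show ?thesis using that by metis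
qed

text \<open>
  Any two coordinates are images of a third one.
\<close>

lemma phi_eq:
  assumes x: "x \<in> topspace Xhat" and i: "i \<in> I"
  shows "phi x = p i (x i)"
  unfolding universal_proj_def
proof (rule the_equality)
  show "\<forall>j\<in>I. p j (x j) = p i (x i)"
  proof
    fix j assume j: "j \<in> I"
    obtain k where k: "k \<in> I" "cover_le C p i k" "cover_le C p j k" using directed[OF i j] .
    have xk: "x k \<in> topspace (C k)" using Xhat_coordinate[OF x k(1)] .
    have "x i = bond i k (x k)" "x j = bond j k (x k)" using x i j k unfolding in_Xhat by auto
    then show "p j (x j) = p i (x i)"
      using bond(3)[OF i k(1,2) xk] bond(3)[OF j k(1,3) xk] by simp
  qed
  then show "z = p i (x i)" if "\<forall>j\<in>I. p j (x j) = z" for z using that i by auto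
qed

lemma continuous_into_Xhat:
  assumes "\<And>i. i \<in> I \<Longrightarrow> continuous_map W (C i) (\<lambda>w. h w i)"
    and "\<And>w. w \<in> topspace W \<Longrightarrow> h w \<in> topspace Xhat"
  shows "continuous_map W Xhat h"
  unfolding universal_cover_def
proof (rule continuous_map_into_subtopology)
  show "continuous_map W (product_topology C I) h"
    unfolding continuous_map_componentwise
    using assms(1) assms(2)[unfolded in_Xhat] by (auto simp: PiE_iff)
  show "h \<in> topspace W \<rightarrow> {x. \<forall>i\<in>I. \<forall>j\<in>I. cover_le C p i j \<longrightarrow> bond i j (x j) = x i}"
    using assms(2)[unfolded in_Xhat] by auto
qed

text \<open>
  Deck transformations \<open>l i\<close> that move one point of the limit to another point of the limit commute
  with all bonding maps, by uniqueness of lifts; hence they act on the limit together. This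
  replaces the homomorphisms between the groups of the covers.
\<close>

lemma coordinatewise_deck:
  assumes xy: "x \<in> topspace Xhat" "y \<in> topspace Xhat"
    and l': "\<forall>i\<in>I. l i \<in> deck_group (C i) (p i)" "\<forall>i\<in>I. l i (x i) = y i"
    and g: "g = (\<lambda>z. \<lambda>i\<in>I. l i (z i))"
  shows "z \<in> topspace Xhat \<Longrightarrow> g z \<in> topspace Xhat" "continuous_map Xhat Xhat g"
    "z \<in> topspace Xhat \<Longrightarrow> phi (g z) = phi z"
proof -
  note l = bspec[OF l'(1)] bspec[OF l'(2)]
  have into: "g z \<in> topspace Xhat" if z: "z \<in> topspace Xhat" for z
    unfolding in_Xhat
  proof (intro conjI ballI impI)
    show "g z \<in> topspace (product_topology C I)"
      using deck_groupD(3)[OF l(1)] Xhat_coordinate[OF z] by (simp add: g PiE_iff)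
    fix i j assume ij: "i \<in> I" "j \<in> I" "cover_le C p i j"
    note b = bond[OF ij] and li = deck_groupD[OF l(1)[OF ij(1)]] and lj = deck_groupD[OF l(1)[OF ij(2)]]
    have "(bond i j \<circ> l j) (z j) = (l i \<circ> bond i j) (z j)"
    proof (rule lift_unique[OF ij(1), where W = "C j" and v = "x j" and w = "z j"
          and h = "bond i j \<circ> l j" and h' = "l i \<circ> bond i j"])
      show "connected_space (C j)" using galois_coveringD(3)[OF galois[OF ij(2)]] .
      show "continuous_map (C j) (C i) (bond i j \<circ> l j)"
        using continuous_map_compose[OF homeomorphic_imp_continuous_map[OF lj(1)] b(1)] .
      show "continuous_map (C j) (C i) (l i \<circ> bond i j)"
        using continuous_map_compose[OF b(1) homeomorphic_imp_continuous_map[OF li(1)]] .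
      show "p i ((bond i j \<circ> l j) w) = p i ((l i \<circ> bond i j) w)" if "w \<in> topspace (C j)" for w
        using b(3,5) li(2) lj(2,3) that by simp
      show "x j \<in> topspace (C j)" "z j \<in> topspace (C j)"
        using Xhat_coordinate xy z ij by auto
      show "(bond i j \<circ> l j) (x j) = (l i \<circ> bond i j) (x j)"
        using xy l(2) ij unfolding in_Xhat by auto
    qed
    then show "bond i j (g z j) = g z i"
      using z ij unfolding in_Xhat by (auto simp: g)
  qed
  then show "z \<in> topspace Xhat \<Longrightarrow> g z \<in> topspace Xhat" .
  show "continuous_map Xhat Xhat g"
  proof (rule continuous_into_Xhat[OF _ into])
    show "continuous_map Xhat (C i) (\<lambda>w. g w i)" if i: "i \<in> I" for i
      using continuous_map_compose[OF continuous_coordinate[OF i]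
          homeomorphic_imp_continuous_map[OF deck_groupD(1)[OF l(1)[OF i]]]] i
      by (simp add: g o_def)
  qed
  obtain i where i: "i \<in> I" using nonempty by auto
  show "z \<in> topspace Xhat \<Longrightarrow> phi (g z) = phi z"
    using phi_eq[OF _ i] into deck_groupD(2)[OF l(1)[OF i] Xhat_coordinate[OF _ i]] i
    by (simp add: g)
qed

text \<open>
  The inverses of the chosen \<open>l i\<close> satisfy the same hypotheses with the two points exchanged, which
  provides the inverse homeomorphism.
\<close>

lemma deck_transitive:
  assumes xy: "x \<in> topspace Xhat" "y \<in> topspace Xhat" "phi x = phi y"
  shows "\<exists>g\<in>deck_group Xhat phi. g x = y"
proof -
  have "\<exists>l\<in>deck_group (C i) (p i). l (x i) = y i" if i: "i \<in> I" for i
    using galois_coveringD(10)[OF galois[OF i] Xhat_coordinate[OF xy(1) i] Xhat_coordinate[OF xy(2) i]]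
      phi_eq[OF xy(1) i] phi_eq[OF xy(2) i] xy(3) by simp
  then obtain l where l': "\<forall>i\<in>I. l i \<in> deck_group (C i) (p i)" "\<forall>i\<in>I. l i (x i) = y i"
    by metis
  note l = bspec[OF l'(1)] bspec[OF l'(2)]
  have "\<exists>m\<in>deck_group (C i) (p i). \<forall>z\<in>topspace (C i). m (l i z) = z \<and> l i (m z) = z" if i: "i \<in> I" for i
    using subgroup_BijGroupD(5)[OF subgroup_deck_group l(1)[OF i]] .
  then obtain m where m: "\<forall>i\<in>I. m i \<in> deck_group (C i) (p i)"
    and ml: "\<And>i z. i \<in> I \<Longrightarrow> z \<in> topspace (C i) \<Longrightarrow> m i (l i z) = z"
      "\<And>i z. i \<in> I \<Longrightarrow> z \<in> topspace (C i) \<Longrightarrow> l i (m i z) = z"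
    by metis
  have m2: "\<forall>i\<in>I. m i (y i) = x i"
    using ml(1)[OF _ Xhat_coordinate[OF xy(1)]] l(2) by simp
  define g where "g = (\<lambda>z. \<lambda>i\<in>I. l i (z i))"
  define h where "h = (\<lambda>z. \<lambda>i\<in>I. m i (z i))"
  note g = coordinatewise_deck[OF xy(1,2) l' g_def] and h = coordinatewise_deck[OF xy(2,1) m m2 h_def]
  have ext: "z \<in> extensional I" if "z \<in> topspace Xhat" for z
    using that unfolding in_Xhat by (auto simp: PiE_iff)
  have "h (g z) = z" "g (h z) = z" if z: "z \<in> topspace Xhat" for z
    using ml Xhat_coordinate[OF z] ext[OF z]
    by (auto simp: g_def h_def intro!: extensionalityI[of _ I])
  then have "homeomorphic_maps Xhat Xhat g h"
    unfolding homeomorphic_maps_def using g(2) h(2) by simp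
  then have "homeomorphic_map Xhat Xhat g" unfolding homeomorphic_map_maps by blast
  then have "restrict g (topspace Xhat) \<in> deck_group Xhat phi"
    using g(3) by (intro deck_groupI[where q = phi])
  moreover have "g x = y"
    using l(2) ext[OF xy(2)] by (auto simp: g_def intro!: extensionalityI[of _ I])
  ultimately show ?thesis using xy(1) by (intro bexI[of _ "restrict g (topspace Xhat)"]) auto
qed

text \<open>
  Both \<open>\<lambda>x. g x k\<close> and \<open>\<lambda>x. l (x k)\<close> are lifts of \<open>phi\<close> along \<open>p k\<close>, for every \<open>l\<close>; it suffices to
  choose \<open>l\<close> so that they agree at the basepoint.
\<close>

lemma deck_coordinate:
  assumes g: "g \<in> deck_group Xhat phi" and k: "k \<in> I"
  obtains l where "l \<in> deck_group (C k) (p k)" "\<And>x. x \<in> topspace Xhat \<Longrightarrow> g x k = l (x k)"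
proof -
  note gD = deck_groupD[OF g]
  let ?v = "restrict c I"
  note v = base_in_Xhat
  have "p k (?v k) = p k (g ?v k)"
    using phi_eq[OF v k] phi_eq[OF gD(3)[OF v] k] gD(2)[OF v] by simp
  then obtain l where l: "l \<in> deck_group (C k) (p k)" "l (?v k) = g ?v k"
    using galois_coveringD(10)[OF galois[OF k] Xhat_coordinate[OF v k] Xhat_coordinate[OF gD(3)[OF v] k]] by auto
  have "((\<lambda>x. x k) \<circ> g) x = (l \<circ> (\<lambda>x. x k)) x" if x: "x \<in> topspace Xhat" for x
  proof (rule lift_unique[OF k Xhat_space(3), where v = ?v and w = x
        and h = "(\<lambda>x. x k) \<circ> g" and h' = "l \<circ> (\<lambda>x. x k)"])
    show "continuous_map Xhat (C k) ((\<lambda>x. x k) \<circ> g)"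
      using continuous_map_compose[OF homeomorphic_imp_continuous_map[OF gD(1)] continuous_coordinate[OF k]] .
    show "continuous_map Xhat (C k) (l \<circ> (\<lambda>x. x k))"
      using continuous_map_compose[OF continuous_coordinate[OF k]
          homeomorphic_imp_continuous_map[OF deck_groupD(1)[OF l(1)]]] .
    show "p k (((\<lambda>x. x k) \<circ> g) w) = p k ((l \<circ> (\<lambda>x. x k)) w)" if w: "w \<in> topspace Xhat" for w
      using phi_eq[OF w k] phi_eq[OF gD(3)[OF w] k] gD(2)[OF w]
        deck_groupD(2)[OF l(1) Xhat_coordinate[OF w k]] by simp
  qed (use v x l(2) in auto)
  then show ?thesis using that[OF l(1)] by simp
qed

text \<open>
  The relations \<open>x k = y k\<close> decrease to the diagonal as \<open>k\<close> increases, so by compactness one of them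
  lies inside a given open neighbourhood \<open>Q\<close> of the diagonal. As \<open>(x, y) \<mapsto> (x k, y k)\<close> is a closed
  map, a whole neighbourhood of the diagonal of \<open>C k\<close> pulls back into \<open>Q\<close>.
\<close>

lemma coordinate_entourage:
  assumes D: "D \<in> compact_uniformity Xhat"
  shows "\<exists>k\<in>I. \<exists>E\<in>compact_uniformity (C k).
    \<forall>x\<in>topspace Xhat. \<forall>y\<in>topspace Xhat. (x k, y k) \<in> E \<longrightarrow> (x, y) \<in> D"
proof -
  let ?P = "prod_topology Xhat Xhat" and ?S = "topspace Xhat"
  obtain Q where Q: "openin ?P Q" "Id_on ?S \<subseteq> Q" "Q \<subseteq> D"
    using D unfolding compact_uniformity_eq[OF Xhat_space(1,2)] diagonal_uniformity_def by auto
  have cP: "compact_space ?P" using Xhat_space(1) by (simp add: compact_space_prod_topology)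
  have pair: "continuous_map ?P (prod_topology (C k) (C k)) (map_prod (\<lambda>x. x k) (\<lambda>x. x k))" if k: "k \<in> I" for k
    using continuous_map_prod_top[of Xhat Xhat "C k" "C k" "\<lambda>x. x k" "\<lambda>x. x k"] continuous_coordinate[OF k]
    by (simp add: map_prod_def)
  \<comment> \<open>If all \<open>T k\<close> were nonempty, some pair outside \<open>Q\<close> would agree in all coordinates.\<close>
  define T where "T k = {v \<in> topspace ?P. ((\<lambda>x. x k) \<circ> fst) v = ((\<lambda>x. x k) \<circ> snd) v} - Q" for k
  have "\<exists>k\<in>I. T k = {}"
  proof (rule ccontr)
    assume no: "\<not> (\<exists>k\<in>I. T k = {})"
    have "(\<Inter>k\<in>I. T k) \<noteq> {}"
    proof (rule directed_closed_Inter_nonempty[OF cP nonempty])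
      show "closedin ?P (T k)" if k: "k \<in> I" for k
        unfolding T_def
        using continuous_map_compose[OF continuous_map_fst continuous_coordinate[OF k]]
          continuous_map_compose[OF continuous_map_snd continuous_coordinate[OF k]]
          galois_coveringD(5)[OF galois[OF k]] Q(1)
        by (intro closedin_diff closedin_equalizer)
      show "T k \<noteq> {}" if "k \<in> I" for k using no that by simp
      show "\<exists>k\<in>I. T k \<subseteq> T i \<and> T k \<subseteq> T j" if ij: "i \<in> I" "j \<in> I" for i j
      proof -
        obtain k where k: "k \<in> I" "cover_le C p i k" "cover_le C p j k" using directed[OF ij] .
        have eq: "x i = bond i k (x k)" "x j = bond j k (x k)" if "x \<in> ?S" for x
          using that ij k unfolding in_Xhat by auto
        have "a i = b i" "a j = b j" if "a \<in> ?S" "b \<in> ?S" "a k = b k" for a b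
          using eq(1)[OF that(1)] eq(1)[OF that(2)] eq(2)[OF that(1)] eq(2)[OF that(2)] that(3) by metis+
        then have "T k \<subseteq> T i" "T k \<subseteq> T j" unfolding T_def by auto
        then show ?thesis using k(1) by auto
      qed
    qed
    then obtain x y where xy: "\<And>k. k \<in> I \<Longrightarrow> (x, y) \<in> T k" by auto
    obtain k where k: "k \<in> I" using nonempty by auto
    have S: "x \<in> ?S" "y \<in> ?S" using xy[OF k] by (auto simp: T_def)
    have "x = y"
      using S xy unfolding in_Xhat by (intro extensionalityI[of _ I]) (auto simp: T_def PiE_iff)
    then show False using xy[OF k] S Q(2) by (auto simp: T_def)
  qed
  then obtain k where k: "k \<in> I" "T k = {}" by auto
  note Ck = galois_coveringD[OF galois[OF k(1)]]
  let ?m = "map_prod (\<lambda>x. x k) (\<lambda>x. x k)"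
  have hP: "Hausdorff_space (prod_topology (C k) (C k))"
    using Ck(5) by (simp add: Hausdorff_space_prod_topology)
  define O' where "O' = topspace (prod_topology (C k) (C k)) - ?m ` (topspace ?P - Q)"
  have "closed_map ?P (prod_topology (C k) (C k)) ?m"
    by (rule continuous_imp_closed_map[OF pair[OF k(1)] cP hP])
  moreover have "closedin ?P (topspace ?P - Q)" using Q(1) by (rule closedin_diff[OF closedin_topspace])
  ultimately have "closedin (prod_topology (C k) (C k)) (?m ` (topspace ?P - Q))"
    unfolding closed_map_def by blast
  then have oO: "openin (prod_topology (C k) (C k)) O'"
    unfolding O'_def by (rule openin_diff[OF openin_topspace])
  define E where "E = O' \<inter> O'\<inverse>"
  have "openin (prod_topology (C k) (C k)) E"
    unfolding E_def using oO openin_converse_prod[OF oO] by (rule openin_Int)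
  moreover have "Id_on (topspace (C k)) \<subseteq> E"
  proof
    fix v assume "v \<in> Id_on (topspace (C k))"
    then obtain z where z: "z \<in> topspace (C k)" "v = (z, z)" by (auto elim: Id_onE)
    have "(z, z) \<notin> ?m ` (topspace ?P - Q)" using k(2) by (auto simp: T_def)
    then show "v \<in> E" using z by (auto simp: E_def O'_def)
  qed
  moreover have "E \<subseteq> topspace (C k) \<times> topspace (C k)" "sym E"
    by (auto simp: E_def O'_def sym_def)
  ultimately have "E \<in> compact_uniformity (C k)"
    unfolding compact_uniformity_eq[OF Ck(2,5)] diagonal_uniformity_def mem_Collect_eq
    by (intro conjI exI[of _ E]) auto
  moreover have "(x, y) \<in> D" if "x \<in> ?S" "y \<in> ?S" "(x k, y k) \<in> E" for x y
  proof -
    have "?m (x, y) \<notin> ?m ` (topspace ?P - Q)" using that(3) by (simp add: E_def O'_def)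
    then have "(x, y) \<in> Q" using that(1,2) by (metis Diff_iff SigmaI imageI topspace_prod_topology)
    then show ?thesis using Q(3) by auto
  qed
  ultimately show ?thesis using k(1) by blast
qed

lemma deck_subgroup_acts_isomorphically:
  assumes H: "subgroup H (BijGroup (topspace Xhat))" "H \<subseteq> deck_group Xhat phi"
  shows "acts_isomorphically (compact_uniformity Xhat) H"
  unfolding acts_isomorphically_def
proof
  fix D assume "D \<in> compact_uniformity Xhat"
  then obtain k E where k: "k \<in> I" and E: "E \<in> compact_uniformity (C k)"
    and ED: "\<And>x y. x \<in> topspace Xhat \<Longrightarrow> y \<in> topspace Xhat \<Longrightarrow> (x k, y k) \<in> E \<Longrightarrow> (x, y) \<in> D"
    using coordinate_entourage by metis
  note Ck = galois_coveringD[OF galois[OF k]]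
  obtain F where F: "F \<in> compact_uniformity (C k)" "F \<subseteq> E"
    and inv: "\<And>g x y. g \<in> deck_group (C k) (p k) \<Longrightarrow> (x, y) \<in> F \<Longrightarrow> (g x, g y) \<in> F"
    using galois_covering_invariant_entourage[OF galois[OF k] E] by metis
  define E' where "E' = {(x, y). x \<in> topspace Xhat \<and> y \<in> topspace Xhat \<and> (x k, y k) \<in> F}"
  have "E' \<in> compact_uniformity Xhat"
    unfolding E'_def
    by (rule compact_uniformity_preimage[OF Xhat_space(1,2) Ck(2,5) continuous_coordinate[OF k] F(1)])
  moreover have "E' \<subseteq> D" using ED F(2) by (auto simp: E'_def)
  moreover have "map_prod g g ` E' = E'" if g: "g \<in> H" for g
  proof -
    have sub: "map_prod g g ` E' \<subseteq> E'" if "g \<in> H" for g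
    proof -
      have gd: "g \<in> deck_group Xhat phi" using that H(2) by auto
      obtain l where l: "l \<in> deck_group (C k) (p k)" "\<And>x. x \<in> topspace Xhat \<Longrightarrow> g x k = l (x k)"
        using deck_coordinate[OF gd k] by blast
      show ?thesis using l inv deck_groupD(3)[OF gd] by (auto simp: E'_def)
    qed
    obtain h where h: "h \<in> H" "\<forall>x\<in>topspace Xhat. h (g x) = x \<and> g (h x) = x"
      using subgroup_BijGroupD(5)[OF H(1) g] by auto
    have "v \<in> map_prod g g ` E'" if v: "v \<in> E'" for v
    proof -
      have "map_prod h h v \<in> E'" using sub[OF h(1)] v by auto
      moreover have "map_prod g g (map_prod h h v) = v" using v h(2) by (auto simp: E'_def)
      ultimately show ?thesis by (metis imageI)
    qed
    then show ?thesis using sub[OF g] by blast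
  qed
  ultimately show "\<exists>E\<in>compact_uniformity Xhat. E \<subseteq> D \<and> (\<forall>g\<in>H. map_prod g g ` E = E)"
    by (intro bexI[of _ E']) auto
qed

text \<open>
  An element that is small at one point in the sense of the discrete entourage of \<open>C k\<close> fixes the
  coordinate \<open>k\<close> of every point, and the elements with this property form a subgroup.
\<close>

lemma deck_subgroup_acts_prodiscretely:
  assumes H: "subgroup H (BijGroup (topspace Xhat))" "H \<subseteq> deck_group Xhat phi"
  shows "acts_prodiscretely (topspace Xhat) (compact_uniformity Xhat) H"
  unfolding acts_prodiscretely_def
proof
  let ?S = "topspace Xhat"
  fix D assume "D \<in> compact_uniformity Xhat"
  then obtain k E where k: "k \<in> I" and E: "E \<in> compact_uniformity (C k)"
    and ED: "\<And>x y. x \<in> ?S \<Longrightarrow> y \<in> ?S \<Longrightarrow> (x k, y k) \<in> E \<Longrightarrow> (x, y) \<in> D"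
    using coordinate_entourage by metis
  note Ck = galois_coveringD[OF galois[OF k]]
  note sub = subgroup_BijGroupD[OF H(1)]
  define F where "F = {(x, y). x \<in> ?S \<and> y \<in> ?S \<and> (p k (x k) = p k (y k) \<longrightarrow> x k = y k)}"
  have "{(x, y). x \<in> ?S \<and> y \<in> ?S \<and> (x k, y k) \<in> {(x, y). x \<in> topspace (C k) \<and> y \<in> topspace (C k) \<and>
      (p k x = p k y \<longrightarrow> x = y)}} \<in> compact_uniformity Xhat"
    by (rule compact_uniformity_preimage[OF Xhat_space(1,2) Ck(2,5) continuous_coordinate[OF k]
          galois_covering_discrete_entourage[OF galois[OF k]]])
  moreover have "{(x, y). x \<in> ?S \<and> y \<in> ?S \<and> (x k, y k) \<in> {(x, y). x \<in> topspace (C k) \<and> y \<in> topspace (C k) \<and>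
      (p k x = p k y \<longrightarrow> x = y)}} = F"
    unfolding F_def using Xhat_coordinate[OF _ k] by auto
  ultimately have F: "F \<in> compact_uniformity Xhat" by simp
  define M where "M = {g \<in> H. \<forall>x\<in>?S. g x k = x k}"
  have "subgroup M (BijGroup ?S)"
  proof (rule subgroup_BijGroupI)
    show "(\<lambda>x\<in>?S. x) \<in> M" using sub(3) by (simp add: M_def)
    show "compose ?S g h \<in> M" if "g \<in> M" "h \<in> M" for g h
      using that sub(2,4) by (simp add: M_def compose_eq)
    show "\<exists>h\<in>M. \<forall>x\<in>?S. h (g x) = x" if g: "g \<in> M" for g
    proof -
      have gH: "g \<in> H" using g by (simp add: M_def)
      obtain h where h: "h \<in> H" "\<forall>x\<in>?S. h (g x) = x \<and> g (h x) = x" using sub(5)[OF gH] by auto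
      have "h x k = x k" if x: "x \<in> ?S" for x
      proof -
        have "g (h x) k = h x k" using g sub(2)[OF h(1) x] by (simp add: M_def)
        then show ?thesis using h(2) x by simp
      qed
      then show ?thesis using h by (intro bexI[of _ h]) (auto simp: M_def)
    qed
  qed (use sub in \<open>auto simp: M_def\<close>)
  moreover have "S_set ?S F H \<subseteq> M"
  proof
    fix g assume "g \<in> S_set ?S F H"
    then obtain x where g: "g \<in> H" and x: "x \<in> ?S" "(x, g x) \<in> F" by (auto simp: S_set_def)
    have gd: "g \<in> deck_group Xhat phi" using g H(2) by auto
    obtain l where l: "l \<in> deck_group (C k) (p k)" "\<And>x. x \<in> ?S \<Longrightarrow> g x k = l (x k)"
      using deck_coordinate[OF gd k] by blast
    have xk: "x k \<in> topspace (C k)" using Xhat_coordinate[OF x(1) k] .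
    have "p k (g x k) = p k (x k)" using l(2)[OF x(1)] deck_groupD(2)[OF l(1) xk] by simp
    then have "l (x k) = x k" using x l(2)[OF x(1)] by (simp add: F_def)
    then have "l = (\<lambda>z\<in>topspace (C k). z)"
      using deck_group_agree[OF galois[OF k] l(1) subgroup_BijGroupD(3)[OF subgroup_deck_group] xk] xk by simp
    then have "g y k = y k" if "y \<in> ?S" for y
      using l(2)[OF that] Xhat_coordinate[OF that k] by simp
    then show "g \<in> M" using g by (simp add: M_def)
  qed
  ultimately have "N_set ?S F H \<subseteq> M"
    unfolding N_set_def using group.generate_subgroup_incl[OF group_BijGroup] by blast
  moreover have "M \<subseteq> U_set ?S D H"
  proof
    fix g assume g: "g \<in> M"
    have "(x, g x) \<in> D" if x: "x \<in> ?S" for x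
    proof (rule ED[OF x])
      show "g x \<in> ?S" using g x sub(2) by (simp add: M_def)
      show "(x k, g x k) \<in> E"
        using g x is_uniformityD(3)[OF is_uniformity_compact_uniformity[OF Ck(2,5)] E Xhat_coordinate[OF x k]]
        by (simp add: M_def)
    qed
    then show "g \<in> U_set ?S D H" using g by (simp add: U_set_def M_def)
  qed
  ultimately show "\<exists>F\<in>compact_uniformity Xhat. N_set ?S F H \<subseteq> U_set ?S D H"
    using F by (intro bexI[of _ F]) auto
qed

end

section \<open>Generalized regular coverings of compact spaces\<close>

text \<open>
  Invariant entourages make the action equicontinuous.
\<close>

lemma isomorphic_action_homeomorphic:
  assumes W: "compact_space W" "Hausdorff_space W"
    and H: "subgroup H (BijGroup (topspace W))" "acts_isomorphically (compact_uniformity W) H"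
    and g: "g \<in> H"
  shows "homeomorphic_map W W g"
proof -
  let ?S = "topspace W"
  note sub = subgroup_BijGroupD[OF H(1)]
  have cont: "continuous_map W W g" if g: "g \<in> H" for g
    unfolding continuous_map_def
  proof (intro conjI allI impI)
    show "g \<in> ?S \<rightarrow> ?S" using sub(2)[OF g] by auto
    fix U assume U: "openin W U"
    have "\<exists>E\<in>compact_uniformity W. E `` {x} \<subseteq> {x \<in> ?S. g x \<in> U}" if x: "x \<in> ?S" "g x \<in> U" for x
    proof -
      obtain D where D: "D \<in> compact_uniformity W" "D `` {g x} \<subseteq> U"
        using U x(2) unfolding openin_compact_uniformity[OF W] by auto
      obtain E where E: "E \<in> compact_uniformity W" "E \<subseteq> D" "map_prod g g ` E = E"
        using H(2) D(1) g unfolding acts_isomorphically_def by metis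
      have "y \<in> ?S \<and> g y \<in> U" if y: "(x, y) \<in> E" for y
      proof
        show "y \<in> ?S" using is_uniformityD(2)[OF is_uniformity_compact_uniformity[OF W] E(1)] y by auto
        have "(g x, g y) \<in> map_prod g g ` E" using y by force
        then show "g y \<in> U" using E D(2) by auto
      qed
      then show ?thesis using E(1) by (intro bexI[of _ E]) auto
    qed
    then show "openin W {x \<in> ?S. g x \<in> U}" unfolding openin_compact_uniformity[OF W] by auto
  qed
  obtain h where "h \<in> H" "\<forall>x\<in>?S. h (g x) = x \<and> g (h x) = x" using sub(5)[OF g] by auto
  then have "homeomorphic_maps W W g h" unfolding homeomorphic_maps_def using cont g by auto
  then show ?thesis unfolding homeomorphic_map_maps by auto
qed

lemma compact_generalized_regular_coveringD:
  assumes W: "compact_space W" "Hausdorff_space W" and Y: "compact_space Y" "Hausdorff_space Y"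
    and h: "compact_generalized_regular_covering W Y H h"
  shows "subgroup H (BijGroup (topspace W))" "acts_isomorphically (compact_uniformity W) H"
    "acts_prodiscretely (topspace W) (compact_uniformity W) H" "orbit_map (topspace W) (topspace Y) H h"
    "g \<in> H \<Longrightarrow> homeomorphic_map W W g" "continuous_map W Y h"
proof -
  show sub: "subgroup H (BijGroup (topspace W))" and iso: "acts_isomorphically (compact_uniformity W) H"
    and "acts_prodiscretely (topspace W) (compact_uniformity W) H"
    and orb: "orbit_map (topspace W) (topspace Y) H h"
    using h by (simp_all add: compact_generalized_regular_covering_def generalized_regular_covering_def)
  show "g \<in> H \<Longrightarrow> homeomorphic_map W W g" using isomorphic_action_homeomorphic[OF W sub iso] .
  have quot: "compact_uniformity Y = (\<lambda>E. map_prod h h ` E) ` compact_uniformity W"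
    using h by (simp add: compact_generalized_regular_covering_def generalized_regular_covering_def)
  have im: "h ` topspace W = topspace Y" using orb by (simp add: orbit_map_def)
  show "continuous_map W Y h"
    unfolding continuous_map_def
  proof (intro conjI allI impI)
    show "h \<in> topspace W \<rightarrow> topspace Y" using im by auto
    fix U assume U: "openin Y U"
    have "\<exists>E\<in>compact_uniformity W. E `` {x} \<subseteq> {x \<in> topspace W. h x \<in> U}" if x: "x \<in> topspace W" "h x \<in> U" for x
    proof -
      obtain D where D: "D \<in> compact_uniformity Y" "D `` {h x} \<subseteq> U"
        using U x(2) unfolding openin_compact_uniformity[OF Y] by auto
      obtain E where E: "E \<in> compact_uniformity W" "D = map_prod h h ` E" using D(1) quot by auto
      have "y \<in> topspace W \<and> h y \<in> U" if y: "(x, y) \<in> E" for y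
      proof
        show "y \<in> topspace W"
          using is_uniformityD(2)[OF is_uniformity_compact_uniformity[OF W] E(1)] y by auto
        have "(h x, h y) \<in> D" unfolding E(2) using y by force
        then show "h y \<in> U" using D(2) by auto
      qed
      then show ?thesis using E(1) by (intro bexI[of _ E]) auto
    qed
    then show "openin W {x \<in> topspace W. h x \<in> U}" unfolding openin_compact_uniformity[OF W] by auto
  qed
qed

lemma cluster_point:
  assumes W: "compact_space W" "Hausdorff_space W" and F: "F \<noteq> bot" and x: "eventually (\<lambda>g. x g \<in> topspace W) F"
  shows "\<exists>z\<in>topspace W. \<forall>E\<in>compact_uniformity W. frequently (\<lambda>g. (z, x g) \<in> E) F"
proof (rule ccontr)
  assume no: "\<not> ?thesis"
  have "\<exists>E V. openin W V \<and> z \<in> V \<and> V \<subseteq> E `` {z} \<and> eventually (\<lambda>g. (z, x g) \<notin> E) F"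
    if z: "z \<in> topspace W" for z
  proof -
    obtain E where E: "E \<in> compact_uniformity W" "\<not> frequently (\<lambda>g. (z, x g) \<in> E) F"
      using no z by blast
    obtain V where "openin W V" "z \<in> V" "V \<subseteq> E `` {z}"
      using compatible_uniformity_neighbourhood[OF compatible_compact_uniformity[OF W] E(1) z] .
    then show ?thesis using E(2) unfolding not_frequently by blast
  qed
  then obtain E V where EV: "\<And>z. z \<in> topspace W \<Longrightarrow> openin W (V z) \<and> z \<in> V z"
      "\<And>z. z \<in> topspace W \<Longrightarrow> V z \<subseteq> E z `` {z}"
      "\<And>z. z \<in> topspace W \<Longrightarrow> eventually (\<lambda>g. (z, x g) \<notin> E z) F"
    by metis
  obtain A where A: "finite A" "A \<subseteq> topspace W" "topspace W \<subseteq> (\<Union>z\<in>A. V z)"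
    using compact_space_pointwise_subcover[OF W(1) EV(1)] .
  have "eventually (\<lambda>g. \<forall>z\<in>A. (z, x g) \<notin> E z) F"
    using A(1,2) EV(3) by (intro eventually_ball_finite) auto
  then have "eventually (\<lambda>g. False) F"
    using x
  proof eventually_elim
    case (elim g)
    then obtain z where "z \<in> A" "x g \<in> V z" using A(3) by auto
    then show ?case using elim(1) EV(2)[of z] A(2) by auto
  qed
  then show False using F by (simp add: eventually_False)
qed

text \<open>
  Given a Cauchy filter \<open>F\<close> and a point \<open>w\<close>, the points \<open>g w\<close> cluster at some \<open>z\<close>, which lies in the
  orbit of \<open>w\<close> because fibres of \<open>h\<close> are closed, say \<open>z = g0 w\<close>. If \<open>g\<close> is eventually close to \<open>g0\<close> at
  the single point \<open>w\<close>, then \<open>g0\<close>-inverse times \<open>g\<close> is small at \<open>w\<close>, so by prodiscreteness it is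
  small everywhere; hence \<open>F\<close> converges to \<open>g0\<close>.
\<close>

lemma complete_group_compact:
  assumes W: "compact_space W" "Hausdorff_space W" and Y: "Hausdorff_space Y"
    and H: "subgroup H (BijGroup (topspace W))" "acts_isomorphically (compact_uniformity W) H"
      "acts_prodiscretely (topspace W) (compact_uniformity W) H"
    and orb: "orbit_map (topspace W) (topspace Y) H h" and h: "continuous_map W Y h"
  shows "complete_group (topspace W) (compact_uniformity W) H"
  unfolding complete_group_def
proof (intro allI impI, elim conjE)
  let ?S = "topspace W" and ?U = "compact_uniformity W"
  fix F :: "('a \<Rightarrow> 'a) filter"
  assume F: "F \<noteq> bot" "F \<le> principal H"
    and cauchy: "\<forall>E\<in>?U. \<forall>\<^sub>F (g, h) in F \<times>\<^sub>F F. \<forall>y\<in>?S. (g y, h y) \<in> E"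
  note sub = subgroup_BijGroupD[OF H(1)]
  note ud = is_uniformityD[OF is_uniformity_compact_uniformity[OF W]]
  have evH: "eventually (\<lambda>g. g \<in> H) F" using F(2) by (simp add: le_principal)
  show "\<exists>g\<in>H. \<forall>E\<in>?U. \<forall>\<^sub>F h in F. \<forall>y\<in>?S. (g y, h y) \<in> E"
  proof (cases "?S = {}")
    case True
    then show ?thesis using sub(3) by (intro bexI[OF _ sub(3)]) auto
  next
    case False
    then obtain w where w: "w \<in> ?S" by blast
    have "eventually (\<lambda>g. g w \<in> ?S) F" using evH by eventually_elim (rule sub(2)[OF _ w])
    then obtain z where z: "z \<in> ?S" and cl: "\<And>E. E \<in> ?U \<Longrightarrow> frequently (\<lambda>g. (z, g w) \<in> E) F"
      using cluster_point[OF W F(1), of "\<lambda>g. g w"] by blast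
    have "h w = h z"
    proof (rule ccontr)
      assume ne: "h w \<noteq> h z"
      have "closedin Y {h w}" using h w Y by (intro closedin_Hausdorff_singleton) (auto simp: continuous_map_def)
      then have "openin W (?S - {x \<in> ?S. h x \<in> {h w}})"
        by (intro openin_diff openin_topspace closedin_continuous_map_preimage[OF h])
      moreover have "z \<in> ?S - {x \<in> ?S. h x \<in> {h w}}" using z ne by auto
      ultimately obtain E where E: "E \<in> ?U" "E `` {z} \<subseteq> ?S - {x \<in> ?S. h x \<in> {h w}}"
        using bspec[OF conjunct2[OF iffD1[OF openin_compact_uniformity[OF W]]]] by blast
      have "frequently (\<lambda>g. (z, g w) \<in> E \<and> g \<in> H) F"
        using frequently_eventually_frequently[OF cl[OF E(1)] evH] .
      then obtain g where g: "(z, g w) \<in> E" "g \<in> H" using frequently_ex by blast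
      have "h w = h (g w)" using orb w g(2) sub(2)[OF g(2) w] unfolding orbit_map_def by metis
      then show False using g E(2) by auto
    qed
    then obtain g0 where g0: "g0 \<in> H" "g0 w = z" using orb w z unfolding orbit_map_def by metis
    obtain k where k: "k \<in> H" "\<forall>x\<in>?S. k (g0 x) = x \<and> g0 (k x) = x" using sub(5)[OF g0(1)] by auto
    have "\<forall>\<^sub>F h in F. \<forall>y\<in>?S. (g0 y, h y) \<in> E" if E: "E \<in> ?U" for E
    proof -
      obtain E1 where E1: "E1 \<in> ?U" "E1 \<subseteq> E" "map_prod g0 g0 ` E1 = E1"
        using H(2) E g0(1) unfolding acts_isomorphically_def by metis
      obtain F1 where F1: "F1 \<in> ?U" "N_set ?S F1 H \<subseteq> U_set ?S E1 H"
        using H(3) E1(1) unfolding acts_prodiscretely_def by metis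
      obtain F2 where F2: "F2 \<in> ?U" "F2 \<subseteq> F1" "map_prod k k ` F2 = F2"
        using H(2) F1(1) k(1) unfolding acts_isomorphically_def by metis
      \<comment> \<open>\<open>F3\<close> is halved for the triangle through \<open>g w\<close>, where \<open>g\<close> is both late in the filter and close to \<open>z\<close>.\<close>
      obtain F3 where F3: "F3 \<in> ?U" "F3 O F3 \<subseteq> F2" using ud(7)[OF F2(1)] by auto
      obtain P Q where PQ: "eventually P F" "eventually Q F"
        and PQ': "\<And>g h. P g \<Longrightarrow> Q h \<Longrightarrow> \<forall>y\<in>?S. (g y, h y) \<in> F3"
        using bspec[OF cauchy F3(1)] unfolding eventually_prod_filter by auto
      have "frequently (\<lambda>g. (z, g w) \<in> F3 \<and> P g) F"
        using frequently_eventually_frequently[OF cl[OF F3(1)] PQ(1)] .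
      then obtain g where g: "(z, g w) \<in> F3" "P g" using frequently_ex by blast
      show ?thesis
        using PQ(2) evH
      proof eventually_elim
        case (elim h)
        have "(g w, h w) \<in> F3" using PQ'[OF g(2) elim(1)] w by auto
        then have "(z, h w) \<in> F2" using g(1) F3(2) by auto
        then have "(k z, k (h w)) \<in> map_prod k k ` F2" by force
        then have "(w, k (h w)) \<in> F1" using F2(2,3) g0(2) k(2) w by auto
        then have "compose ?S k h \<in> S_set ?S F1 H"
          using sub(4)[OF k(1) elim(2)] w by (auto simp: S_set_def compose_eq)
        then have "compose ?S k h \<in> U_set ?S E1 H"
          using F1(2) unfolding N_set_def by (meson generate.incl subsetD)
        then have 1: "(y, k (h y)) \<in> E1" if "y \<in> ?S" for y
          using that by (auto simp: U_set_def compose_eq)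
        show ?case
        proof
          fix y assume y: "y \<in> ?S"
          have "(g0 y, g0 (k (h y))) \<in> map_prod g0 g0 ` E1" using 1[OF y] by force
          then show "(g0 y, h y) \<in> E" using E1(2,3) k(2) sub(2)[OF elim(2) y] by auto
        qed
      qed
    qed
    then show ?thesis using g0(1) by (intro bexI[of _ g0]) auto
  qed
qed

text \<open>
  Between compact Hausdorff spaces, completeness of the group and the description of the quotient
  uniformity come for free: \<open>h\<close> is uniformly continuous, and it is open as an orbit map.
\<close>

lemma compact_generalized_regular_coveringI:
  assumes W: "compact_space W" "Hausdorff_space W" and Y: "compact_space Y" "Hausdorff_space Y"
    and H: "subgroup H (BijGroup (topspace W))" "acts_isomorphically (compact_uniformity W) H"
      "acts_prodiscretely (topspace W) (compact_uniformity W) H"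
    and orb: "orbit_map (topspace W) (topspace Y) H h" and h: "continuous_map W Y h"
  shows "compact_generalized_regular_covering W Y H h"
proof -
  have im: "h ` topspace W = topspace Y" using orb by (simp add: orbit_map_def)
  have oh: "open_map W Y h"
    using orbit_map_open[OF isomorphic_action_homeomorphic[OF W H(1,2)] orb
        continuous_imp_quotient_map[OF h W(1) Y(2) im]] .
  have "compact_uniformity Y = (\<lambda>E. map_prod h h ` E) ` compact_uniformity W"
  proof
    show "compact_uniformity Y \<subseteq> (\<lambda>E. map_prod h h ` E) ` compact_uniformity W"
    proof
      fix E assume E: "E \<in> compact_uniformity Y"
      let ?P = "{(x, y). x \<in> topspace W \<and> y \<in> topspace W \<and> (h x, h y) \<in> E}"
      have "?P \<in> compact_uniformity W" using compact_uniformity_preimage[OF W Y h E] .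
      moreover have "E = map_prod h h ` ?P"
      proof
        show "map_prod h h ` ?P \<subseteq> E" by auto
        show "E \<subseteq> map_prod h h ` ?P"
        proof clarify
          fix a b assume ab: "(a, b) \<in> E"
          then have "a \<in> h ` topspace W" "b \<in> h ` topspace W"
            using is_uniformityD(2)[OF is_uniformity_compact_uniformity[OF Y] E] im by auto
          then obtain x y where "x \<in> topspace W" "a = h x" "y \<in> topspace W" "b = h y" by auto
          then show "(a, b) \<in> map_prod h h ` ?P" using ab by (intro image_eqI[of _ _ "(x, y)"]) auto
        qed
      qed
      ultimately show "E \<in> (\<lambda>E. map_prod h h ` E) ` compact_uniformity W" by (rule rev_image_eqI)
    qed
    show "(\<lambda>E. map_prod h h ` E) ` compact_uniformity W \<subseteq> compact_uniformity Y"
    proof clarify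
      fix E assume E: "E \<in> compact_uniformity W"
      obtain Q where Q: "openin (prod_topology W W) Q" "Id_on (topspace W) \<subseteq> Q" "Q \<subseteq> E"
        and E': "E \<subseteq> topspace W \<times> topspace W" "sym E"
        using E unfolding compact_uniformity_eq[OF W] diagonal_uniformity_def by auto
      have "openin (prod_topology Y Y) (map_prod h h ` Q)"
        unfolding openin_prod_topology_alt
      proof (intro allI impI)
        fix a b assume "(a, b) \<in> map_prod h h ` Q"
        then obtain x y where xy: "(x, y) \<in> Q" "a = h x" "b = h y" by auto
        obtain A B where AB: "openin W A" "openin W B" "x \<in> A" "y \<in> B" "A \<times> B \<subseteq> Q"
          using openin_prod_topology_alt[THEN iffD1, rule_format, OF Q(1) xy(1)] by metis
        have "h ` A \<times> h ` B \<subseteq> map_prod h h ` Q" using AB(5) by force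
        then show "\<exists>U V. openin Y U \<and> openin Y V \<and> a \<in> U \<and> b \<in> V \<and> U \<times> V \<subseteq> map_prod h h ` Q"
          using AB xy oh unfolding open_map_def by (intro exI[of _ "h ` A"] exI[of _ "h ` B"]) auto
      qed
      moreover have "Id_on (topspace Y) \<subseteq> map_prod h h ` Q"
      proof
        fix v assume "v \<in> Id_on (topspace Y)"
        then obtain x where x: "x \<in> topspace W" "v = (h x, h x)" using im by (auto elim!: Id_onE)
        then show "v \<in> map_prod h h ` Q" using Q(2) by (intro image_eqI[of _ _ "(x, x)"]) auto
      qed
      moreover have "map_prod h h ` E \<subseteq> topspace Y \<times> topspace Y" using E'(1) im by auto
      moreover have "sym (map_prod h h ` E)"
        using E'(2) unfolding sym_def by force
      ultimately show "map_prod h h ` E \<in> compact_uniformity Y"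
        unfolding compact_uniformity_eq[OF Y] diagonal_uniformity_def mem_Collect_eq
        using Q(3) by (intro conjI exI[of _ "map_prod h h ` Q"]) auto
    qed
  qed
  then show ?thesis
    unfolding compact_generalized_regular_covering_def generalized_regular_covering_def
    using is_uniformity_compact_uniformity[OF W] H orb complete_group_compact[OF W Y(2) H orb h] by simp
qed

section \<open>Invariant metrics\<close>

text \<open>
  The supremum of a bounded metric over all translates. It is finer than the given metric, and not
  strictly finer because the action has arbitrarily small invariant entourages.
\<close>

lemma invariant_metric:
  assumes Y: "compact_space Y" "metrizable_space Y"
    and G: "subgroup G (BijGroup (topspace Y))" "acts_isomorphically (compact_uniformity Y) G"
  obtains d where "Metric_space (topspace Y) d" "Metric_space.mtopology (topspace Y) d = Y"
    "\<And>g x y. g \<in> G \<Longrightarrow> x \<in> topspace Y \<Longrightarrow> y \<in> topspace Y \<Longrightarrow> d (g x) (g y) = d x y"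
proof -
  obtain M' d0 where "Metric_space M' d0" and Yd0: "Y = Metric_space.mtopology M' d0"
    using Y(2)[unfolded metrizable_space_def] by (elim exE conjE)
  interpret M0: Metric_space M' d0 by fact
  define M where "M = topspace Y"
  define d1 where "d1 = M0.capped_dist 1"
  have M': "M' = M" using Yd0 by (simp add: M_def)
  interpret M1: Metric_space M d1
    unfolding d1_def M'[symmetric] by (rule M0.capped_dist)
  have Y1: "M1.mtopology = Y"
    unfolding Yd0 d1_def M'[symmetric] by (rule M0.mtopology_capped_metric)
  have le1: "d1 x y \<le> 1" for x y by (simp add: d1_def M0.capped_dist_def)
  note sub = subgroup_BijGroupD[OF G(1), folded M_def]
  define D where "D x y = (if x \<in> M \<and> y \<in> M then SUP g\<in>G. d1 (g x) (g y) else 0)" for x y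
  have bdd: "bdd_above ((\<lambda>g. d1 (g x) (g y)) ` G)" for x y
    using le1 by (auto intro: bdd_aboveI[of _ 1])
  have ne: "G \<noteq> {}" using sub(3) by auto
  have upper: "d1 (g x) (g y) \<le> D x y" if "g \<in> G" "x \<in> M" "y \<in> M" for g x y
    unfolding D_def using that cSUP_upper[OF that(1) bdd] by simp
  have least: "D x y \<le> e" if "\<And>g. g \<in> G \<Longrightarrow> d1 (g x) (g y) \<le> e" "x \<in> M" "y \<in> M" for x y e
    unfolding D_def using that cSUP_least[OF ne, of "\<lambda>g. d1 (g x) (g y)" e] by simp
  have d1D: "d1 x y \<le> D x y" if "x \<in> M" "y \<in> M" for x y
    using upper[OF sub(3) that] that by simp
  interpret MD: Metric_space M D
  proof
    show "0 \<le> D x y" for x y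
    proof (cases "x \<in> M \<and> y \<in> M")
      case True
      then show ?thesis using d1D[of x y] M1.nonneg[of x y] by linarith
    next
      case False
      then show ?thesis by (auto simp: D_def)
    qed
    show "D x y = D y x" for x y
      by (simp add: D_def M1.commute)
    show "(D x y = 0) = (x = y)" if xy: "x \<in> M" "y \<in> M" for x y
    proof
      assume "D x y = 0"
      then have "d1 x y = 0" using d1D[OF xy] M1.nonneg[of x y] by simp
      then show "x = y" using xy by simp
    next
      assume "x = y"
      then have "D x y \<le> 0" using xy sub(2) by (intro least) auto
      then show "D x y = 0" using d1D[OF xy] M1.nonneg[of x y] by linarith
    qed
    show "D x z \<le> D x y + D y z" if xyz: "x \<in> M" "y \<in> M" "z \<in> M" for x y z
    proof (rule least)
      fix g assume g: "g \<in> G"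
      have "d1 (g x) (g z) \<le> d1 (g x) (g y) + d1 (g y) (g z)"
        using sub(2)[OF g] xyz by (intro M1.triangle) auto
      then show "d1 (g x) (g z) \<le> D x y + D y z"
        using upper[OF g xyz(1,2)] upper[OF g xyz(2,3)] by simp
    qed (use xyz in auto)
  qed
  have "MD.mtopology = M1.mtopology"
    unfolding topology_eq MD.openin_mtopology M1.openin_mtopology
  proof (intro allI iffI conjI impI; elim conjE)
    fix U x assume U: "\<forall>x. x \<in> U \<longrightarrow> (\<exists>r>0. M1.mball x r \<subseteq> U)" "U \<subseteq> M" and x: "x \<in> U"
    then obtain r where r: "r > 0" "M1.mball x r \<subseteq> U" by blast
    have "MD.mball x r \<subseteq> M1.mball x r" using le_less_trans[OF d1D] by auto
    then show "\<exists>r>0. MD.mball x r \<subseteq> U" using r by blast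
  next
    fix U x assume U: "\<forall>x. x \<in> U \<longrightarrow> (\<exists>r>0. MD.mball x r \<subseteq> U)" "U \<subseteq> M" and x: "x \<in> U"
    then obtain r where r: "r > 0" "MD.mball x r \<subseteq> U" by blast
    let ?E = "{(x, y). x \<in> M \<and> y \<in> M \<and> d1 x y < r/2}"
    have cu: "compact_uniformity Y = {E. E \<subseteq> M \<times> M \<and> sym E \<and> (\<exists>e>0. \<forall>x\<in>M. \<forall>y\<in>M. d1 x y < e \<longrightarrow> (x, y) \<in> E)}"
      using compact_uniformity_metric[OF M1.Metric_space_axioms] Y(1) Y1 by simp
    have E0: "?E \<in> compact_uniformity Y"
      unfolding cu using r(1) by (auto simp: sym_def M1.commute intro!: exI[of _ "r/2"])
    obtain E where E: "E \<in> compact_uniformity Y" "E \<subseteq> ?E" "\<forall>g\<in>G. map_prod g g ` E = E"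
      using bspec[OF G(2)[unfolded acts_isomorphically_def] E0] by (elim bexE conjE)
    then obtain e where e: "e > 0" "\<forall>x\<in>M. \<forall>y\<in>M. d1 x y < e \<longrightarrow> (x, y) \<in> E" unfolding cu by auto
    have "M1.mball x e \<subseteq> MD.mball x r"
    proof
      fix y assume y: "y \<in> M1.mball x e"
      then have xy: "x \<in> M" "y \<in> M" "(x, y) \<in> E" using e(2) by auto
      have "D x y \<le> r/2"
      proof (rule least)
        fix g assume "g \<in> G"
        then have "map_prod g g ` E = E" using E(3) by auto
        moreover have "(g x, g y) \<in> map_prod g g ` E" using xy(3) by force
        ultimately show "d1 (g x) (g y) \<le> r/2" using E(2) by auto
      qed (use xy in auto)
      then show "y \<in> MD.mball x r" using xy r(1) by auto
    qed
    then show "\<exists>r>0. M1.mball x r \<subseteq> U" using e(1) r(2) by blast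
  qed auto
  then have "MD.mtopology = Y" using Y1 by simp
  moreover have "D (g x) (g y) = D x y" if g: "g \<in> G" and xy: "x \<in> M" "y \<in> M" for g x y
  proof -
    have le: "D (g x) (g y) \<le> D x y" if g: "g \<in> G" and xy: "x \<in> M" "y \<in> M" for g x y
    proof (rule least)
      fix h assume h: "h \<in> G"
      show "d1 (h (g x)) (h (g y)) \<le> D x y"
        using upper[OF sub(4)[OF h g] xy] xy by (simp add: compose_eq)
    qed (use sub(2)[OF g] xy in auto)
    obtain h where h: "h \<in> G" "\<forall>x\<in>M. h (g x) = x \<and> g (h x) = x" using sub(5)[OF g] by auto
    have "D (h (g x)) (h (g y)) \<le> D (g x) (g y)" using sub(2)[OF g] xy by (intro le[OF h(1)]) auto
    then show ?thesis using le[OF g xy] h(2) xy by simp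
  qed
  ultimately show ?thesis using that[of D] MD.Metric_space_axioms by (simp add: M_def)
qed

section \<open>Orbit spaces of small displacement subgroups\<close>

text \<open>
  A generalized regular covering of a compact metrizable space, with an invariant metric. Prodiscreteness
  is expressed with the entourages that the metric gives.
\<close>

locale isometric_prodiscrete_cover = Metric_space M d for M :: "'c set" and d +
  fixes X :: "'a topology" and G :: "('c \<Rightarrow> 'c) set" and f :: "'c \<Rightarrow> 'a"
  assumes compact: "compact_space mtopology" and connected: "connected_space mtopology"
    and X_Hausdorff: "Hausdorff_space X"
    and G: "subgroup G (BijGroup M)"
    and isometry: "\<And>g x y. g \<in> G \<Longrightarrow> x \<in> M \<Longrightarrow> y \<in> M \<Longrightarrow> d (g x) (g y) = d x y"
    and prodiscrete: "\<And>e. e > 0 \<Longrightarrow> \<exists>r>0. \<forall>n\<in>N_set M {(x, y). x \<in> M \<and> y \<in> M \<and> d x y < r} G. \<forall>y\<in>M. d y (n y) < e"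
    and f: "continuous_map mtopology X f" and orb_f: "orbit_map M (topspace X) G f"
begin

definition S :: "real \<Rightarrow> ('c \<Rightarrow> 'c) set" where
  "S r = S_set M {(x, y). x \<in> M \<and> y \<in> M \<and> d x y < r} G"

definition N :: "real \<Rightarrow> ('c \<Rightarrow> 'c) set" where
  "N r = generate (BijGroup M) (S r)"

lemmas G_sub = subgroup_BijGroupD[OF G]

lemma S_iff: "g \<in> S r \<longleftrightarrow> g \<in> G \<and> (\<exists>y\<in>M. d y (g y) < r)"
  using G_sub(2) by (auto simp: S_def S_set_def)

lemma S_subset: "S r \<subseteq> G" by (auto simp: S_iff)

lemma N_subgroup: "subgroup (N r) (BijGroup M)"
  unfolding N_def
  by (rule group.generate_is_subgroup[OF group_BijGroup])
    (use S_subset subgroup.subset[OF G] in blast)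

lemmas N_sub = subgroup_BijGroupD[OF N_subgroup]

lemma N_least: "subgroup H (BijGroup M) \<Longrightarrow> S r \<subseteq> H \<Longrightarrow> N r \<subseteq> H"
  unfolding N_def using group.generate_subgroup_incl[OF group_BijGroup] by blast

lemma N_subset: "N r \<subseteq> G" using N_least[OF G S_subset] .

lemma S_subset_N: "S r \<subseteq> N r" unfolding N_def by (auto intro: generate.incl)

lemma small_in_N: "g \<in> G \<Longrightarrow> y \<in> M \<Longrightarrow> d y (g y) < r \<Longrightarrow> g \<in> N r"
  using S_subset_N[of r] S_iff[of g r] by blast

lemma N_mono: "r \<le> s \<Longrightarrow> N r \<subseteq> N s"
  using S_subset_N[of s] by (intro N_least N_subgroup) (force simp: S_iff)

lemma N_small: "e > 0 \<Longrightarrow> \<exists>r>0. \<forall>n\<in>N r. \<forall>y\<in>M. d y (n y) < e"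
  using prodiscrete unfolding N_def S_def N_set_def .

lemma f_invariant: "g \<in> G \<Longrightarrow> x \<in> M \<Longrightarrow> f (g x) = f x"
  using orb_f G_sub(2) unfolding orbit_map_def by metis

lemma f_fibre: "x \<in> M \<Longrightarrow> y \<in> M \<Longrightarrow> f x = f y \<Longrightarrow> \<exists>g\<in>G. g x = y"
  using orb_f unfolding orbit_map_def by metis

text \<open>
  The displacement of \<open>g s g\<^sup>-\<^sup>1\<close> at \<open>g y\<close> equals that of \<open>s\<close> at \<open>y\<close>, so the generating set is invariant
  under conjugation. The elements of \<open>G\<close> whose conjugate lies in \<open>N r\<close> form a subgroup.
\<close>

lemma N_normal:
  assumes g: "g \<in> G" and n: "n \<in> N r"
  shows "\<exists>n'\<in>N r. \<forall>x\<in>M. n' (g x) = g (n x)"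
proof -
  \<comment> \<open>The relation \<open>n' (g x) = g (n x)\<close> says that \<open>n'\<close> is the conjugate of \<open>n\<close> by \<open>g\<close>.\<close>
  define K where "K = {n \<in> G. \<exists>n'\<in>N r. \<forall>x\<in>M. n' (g x) = g (n x)}"
  have "subgroup K (BijGroup M)"
  proof (rule subgroup_BijGroupI)
    show "(\<lambda>x\<in>M. x) \<in> K"
      using G_sub(2,3) g N_sub(3) by (auto simp: K_def intro!: bexI[OF _ N_sub(3)])
    show "compose M a b \<in> K" if ab: "a \<in> K" "b \<in> K" for a b
    proof -
      obtain a' b' where a': "a' \<in> N r" "\<forall>x\<in>M. a' (g x) = g (a x)"
        and b': "b' \<in> N r" "\<forall>x\<in>M. b' (g x) = g (b x)"
        using ab by (auto simp: K_def)
      have abG: "a \<in> G" "b \<in> G" using ab by (auto simp: K_def)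
      have "compose M a' b' (g x) = g (compose M a b x)" if "x \<in> M" for x
        using a'(2) b'(2) G_sub(2)[OF g that] G_sub(2)[OF abG(2) that] that by (simp add: compose_eq)
      then show ?thesis
        using N_sub(4)[OF a'(1) b'(1)] G_sub(4)[OF abG] unfolding K_def by blast
    qed
    show "\<exists>h\<in>K. \<forall>x\<in>M. h (a x) = x" if a: "a \<in> K" for a
    proof -
      obtain a' where a': "a' \<in> N r" "\<forall>x\<in>M. a' (g x) = g (a x)"
        using a by (auto simp: K_def)
      have aG: "a \<in> G" using a by (auto simp: K_def)
      obtain m where m: "m \<in> G" "\<forall>x\<in>M. m (a x) = x \<and> a (m x) = x" using G_sub(5)[OF aG] by auto
      obtain m' where m': "m' \<in> N r" "\<forall>x\<in>M. m' (a' x) = x \<and> a' (m' x) = x" using N_sub(5)[OF a'(1)] by auto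
      have "m' (g x) = g (m x)" if x: "x \<in> M" for x
      proof -
        have mx: "m x \<in> M" using G_sub(2)[OF m(1) x] .
        have "a' (g (m x)) = g x" using a'(2) mx m(2) x by simp
        then show ?thesis using m'(2) G_sub(2)[OF g mx] by metis
      qed
      then have "m \<in> K" using m(1) m'(1) by (auto simp: K_def)
      then show ?thesis using m(2) by auto
    qed
  qed (use G_sub in \<open>auto simp: K_def\<close>)
  moreover have "S r \<subseteq> K"
  proof
    fix s assume "s \<in> S r"
    then obtain y where s: "s \<in> G" and y: "y \<in> M" "d y (s y) < r" by (auto simp: S_iff)
    obtain h where h: "h \<in> G" "\<forall>x\<in>M. h (g x) = x \<and> g (h x) = x" using G_sub(5)[OF g] by auto
    define n' where "n' = compose M g (compose M s h)"
    have n': "n' (g x) = g (s x)" if "x \<in> M" for x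
      using that h(2) G_sub(2)[OF g that] by (simp add: n'_def compose_eq)
    have "n' \<in> G" unfolding n'_def using G_sub(4) g s h(1) by auto
    moreover have "d (g y) (n' (g y)) < r"
      using isometry[OF g y(1) G_sub(2)[OF s y(1)]] n'[OF y(1)] y(2) by simp
    ultimately have "n' \<in> S r" using G_sub(2)[OF g y(1)] by (auto simp: S_iff)
    then show "s \<in> K" using s n' S_subset_N by (auto simp: K_def)
  qed
  ultimately have "N r \<subseteq> K" by (rule N_least)
  then show ?thesis using n by (auto simp: K_def)
qed

definition orb :: "real \<Rightarrow> 'c \<Rightarrow> 'c set" where
  "orb r y = (\<lambda>n. n y) ` N r"

lemma orb_self: "y \<in> M \<Longrightarrow> y \<in> orb r y"
  unfolding orb_def using N_sub(3) by (intro image_eqI[OF _ N_sub(3)]) simp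

lemma orb_subset: "y \<in> M \<Longrightarrow> orb r y \<subseteq> M"
  unfolding orb_def using N_sub(2) by auto

lemma orb_eq:
  assumes y: "y \<in> M" and n: "n \<in> N r"
  shows "orb r (n y) = orb r y"
proof -
  have sub: "orb r (n y) \<subseteq> orb r y" if y: "y \<in> M" and n: "n \<in> N r" for y n
  proof
    fix x assume "x \<in> orb r (n y)"
    then obtain m where m: "m \<in> N r" "x = m (n y)" by (auto simp: orb_def)
    then have "x = compose M m n y" using y by (simp add: compose_eq)
    then show "x \<in> orb r y" using N_sub(4)[OF m(1) n] by (auto simp: orb_def)
  qed
  obtain m where m: "m \<in> N r" "\<forall>x\<in>M. m (n x) = x \<and> n (m x) = x" using N_sub(5)[OF n] by auto
  have "orb r (m (n y)) \<subseteq> orb r (n y)" using N_sub(2)[OF n y] m(1) by (rule sub)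
  then show ?thesis using sub[OF y n] m(2) y by auto
qed

lemma orb_eq_iff: "x \<in> M \<Longrightarrow> y \<in> M \<Longrightarrow> orb r x = orb r y \<longleftrightarrow> (\<exists>n\<in>N r. x = n y)"
  using orb_self[of x r] orb_eq[of y _ r] by (auto simp: orb_def)

definition orbits :: "real \<Rightarrow> 'c set set" where
  "orbits r = orb r ` M"

text \<open>
  The distance of two orbits as sets. The value \<open>0\<close> elsewhere is needed because \<^locale>\<open>Metric_space\<close>
  requires a metric to be symmetric and nonnegative on the whole type.
\<close>

definition orbit_dist :: "real \<Rightarrow> 'c set \<Rightarrow> 'c set \<Rightarrow> real" where
  "orbit_dist r A B =
     (if A \<in> orbits r \<and> B \<in> orbits r then INF v\<in>A \<times> B. d (fst v) (snd v) else 0)"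

lemma orbit_dist_less:
  assumes xy: "x \<in> M" "y \<in> M"
  shows "orbit_dist r (orb r x) (orb r y) < e \<longleftrightarrow> (\<exists>n\<in>N r. d x (n y) < e)"
proof -
  have ne: "orb r x \<times> orb r y \<noteq> {}" using orb_self xy by auto
  have bdd: "bdd_below ((\<lambda>v. d (fst v) (snd v)) ` (orb r x \<times> orb r y))"
    by (rule bdd_belowI[of _ 0]) auto
  have "orbit_dist r (orb r x) (orb r y) < e \<longleftrightarrow> (\<exists>v\<in>orb r x \<times> orb r y. d (fst v) (snd v) < e)"
    unfolding orbit_dist_def using cINF_less_iff[OF ne bdd] xy by (simp add: orbits_def)
  also have "\<dots> \<longleftrightarrow> (\<exists>n\<in>N r. d x (n y) < e)"
  proof
    assume "\<exists>v\<in>orb r x \<times> orb r y. d (fst v) (snd v) < e"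
    then obtain m n where mn: "m \<in> N r" "n \<in> N r" "d (m x) (n y) < e" by (auto simp: orb_def)
    obtain k where k: "k \<in> N r" "\<forall>x\<in>M. k (m x) = x \<and> m (k x) = x" using N_sub(5)[OF mn(1)] by auto
    have "d (k (m x)) (k (n y)) = d (m x) (n y)"
      using k(1) N_subset N_sub(2)[OF mn(1) xy(1)] N_sub(2)[OF mn(2) xy(2)] by (intro isometry) auto
    then have "d x (compose M k n y) < e" using k(2) xy mn(3) by (simp add: compose_eq)
    then show "\<exists>n\<in>N r. d x (n y) < e" using N_sub(4)[OF k(1) mn(2)] by auto
  next
    assume "\<exists>n\<in>N r. d x (n y) < e"
    then obtain n where "n \<in> N r" "d x (n y) < e" by auto
    then show "\<exists>v\<in>orb r x \<times> orb r y. d (fst v) (snd v) < e"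
      using orb_self[OF xy(1)] by (intro bexI[of _ "(x, n y)"]) (auto simp: orb_def)
  qed
  finally show ?thesis .
qed

lemma closed_fibre: "y \<in> M \<Longrightarrow> closedin mtopology {z \<in> M. f z = f y}"
  using closedin_continuous_map_preimage[OF f closedin_Hausdorff_singleton[OF X_Hausdorff, of "f y"]] f
  by (auto simp: continuous_map_def)

text \<open>
  Points in the closure of the orbit of \<open>y\<close> lie in the same fibre of \<open>f\<close>, so \<open>x = g y\<close> for some \<open>g\<close>. If
  moreover \<open>d x (n y) < r\<close>, then \<open>n g\<^sup>-\<^sup>1\<close> moves \<open>x\<close> by less than \<open>r\<close> and lies in \<open>N r\<close>; hence so does
  \<open>g\<close>.
\<close>

lemma orbits_separated:
  assumes r: "r > 0" and xy: "x \<in> M" "y \<in> M" and close: "\<And>e. e > 0 \<Longrightarrow> \<exists>n\<in>N r. d x (n y) < e"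
  shows "orb r x = orb r y"
proof -
  have "f x = f y"
  proof (rule ccontr)
    assume ne: "f x \<noteq> f y"
    have "openin mtopology (M - {z \<in> M. f z = f y})"
      using openin_diff[OF openin_topspace closed_fibre[OF xy(2)]] by simp
    moreover have "x \<in> M - {z \<in> M. f z = f y}" using ne xy(1) by simp
    ultimately obtain e where e: "e > 0" "mball x e \<subseteq> M - {z \<in> M. f z = f y}"
      unfolding openin_mtopology by blast
    obtain n where n: "n \<in> N r" "d x (n y) < e" using close[OF e(1)] by auto
    have "n y \<in> mball x e" using n N_sub(2)[OF n(1) xy(2)] xy(1) by simp
    moreover have "f (n y) = f y" using n(1) N_subset f_invariant[OF _ xy(2)] by blast
    ultimately show False using e(2) by auto
  qed
  then obtain g where g: "g \<in> G" "g y = x" using f_fibre[OF xy(2,1)] by auto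
  obtain n where n: "n \<in> N r" "d x (n y) < r" using close[OF r] by auto
  obtain h where h: "h \<in> G" "\<forall>x\<in>M. h (g x) = x \<and> g (h x) = x" using G_sub(5)[OF g(1)] by auto
  have hx: "h x = y" using h(2) g(2) xy(2) by auto
  have "compose M n h \<in> G" using n(1) N_subset h(1) by (intro G_sub(4)) auto
  moreover have "d x (compose M n h x) < r" using n(2) hx xy(1) by (simp add: compose_eq)
  ultimately have nh: "compose M n h \<in> N r" using xy(1) by (intro small_in_N)
  have "orb r (n y) = orb r x" using orb_eq[OF xy(1) nh] hx xy(1) by (simp add: compose_eq)
  then show ?thesis using orb_eq[OF xy(2) n(1)] by simp
qed

lemma orbit_metric:
  assumes r: "r > 0"
  shows "Metric_space (orbits r) (orbit_dist r)"
proof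
  have nn: "orbit_dist r A B \<ge> 0" for A B
  proof (cases "A \<in> orbits r \<and> B \<in> orbits r")
    case True
    then obtain x y where xy: "x \<in> M" "y \<in> M" "A = orb r x" "B = orb r y" by (auto simp: orbits_def)
    show ?thesis
    proof (rule ccontr)
      assume "\<not> orbit_dist r A B \<ge> 0"
      then have "\<exists>n\<in>N r. d x (n y) < 0" using orbit_dist_less[OF xy(1,2), of r 0] xy(3,4) by simp
      then show False using nonneg by (auto simp: not_less[symmetric])
    qed
  next
    case False
    then show ?thesis by (auto simp: orbit_dist_def)
  qed
  show "0 \<le> orbit_dist r A B" for A B by (rule nn)
  show "orbit_dist r A B = orbit_dist r B A" for A B
  proof -
    have "(\<lambda>v. d (fst v) (snd v)) ` (A \<times> B) = (\<lambda>v. d (fst v) (snd v)) ` (B \<times> A)"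
      by (subst product_swap[of B A, symmetric]) (simp add: image_image commute)
    then show ?thesis by (simp add: orbit_dist_def)
  qed
  show "(orbit_dist r A B = 0) = (A = B)" if AB: "A \<in> orbits r" "B \<in> orbits r" for A B
  proof -
    obtain x y where xy: "x \<in> M" "y \<in> M" "A = orb r x" "B = orb r y" using AB by (auto simp: orbits_def)
    show ?thesis
    proof
      assume 0: "orbit_dist r A B = 0"
      have "\<exists>n\<in>N r. d x (n y) < e" if "e > 0" for e
        using orbit_dist_less[OF xy(1,2), of r e] 0 that xy(3,4) by simp
      then show "A = B" using orbits_separated[OF r xy(1,2)] xy(3,4) by simp
    next
      assume "A = B"
      then obtain n where n: "n \<in> N r" "x = n y" using orb_eq_iff[OF xy(1,2)] xy(3,4) by auto
      have less: "orbit_dist r A B < e" if "e > 0" for e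
        unfolding xy(3,4) orbit_dist_less[OF xy(1,2)] using n(2) that xy(1) by (intro bexI[OF _ n(1)]) simp
      show "orbit_dist r A B = 0"
        using less[of "orbit_dist r A B"] nn[of A B] by linarith
    qed
  qed
  show "orbit_dist r A C \<le> orbit_dist r A B + orbit_dist r B C"
    if ABC: "A \<in> orbits r" "B \<in> orbits r" "C \<in> orbits r" for A B C
  proof (rule field_le_epsilon)
    fix e :: real assume e: "e > 0"
    obtain x y z where xyz: "x \<in> M" "y \<in> M" "z \<in> M" "A = orb r x" "B = orb r y" "C = orb r z"
      using ABC by (auto simp: orbits_def)
    have "orbit_dist r (orb r x) (orb r y) < orbit_dist r A B + e/2" using e xyz(4,5) by simp
    then obtain n where n: "n \<in> N r" "d x (n y) < orbit_dist r A B + e/2"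
      unfolding orbit_dist_less[OF xyz(1,2)] by blast
    have "orbit_dist r (orb r y) (orb r z) < orbit_dist r B C + e/2" using e xyz(5,6) by simp
    then obtain m where m: "m \<in> N r" "d y (m z) < orbit_dist r B C + e/2"
      unfolding orbit_dist_less[OF xyz(2,3)] by blast
    have mz: "m z \<in> M" "n y \<in> M" "n (m z) \<in> M"
      using N_sub(2) n(1) m(1) xyz by auto
    have "d (n y) (n (m z)) = d y (m z)" using n(1) N_subset xyz(2) mz(1) by (intro isometry) auto
    then have "d x (compose M n m z) < orbit_dist r A B + orbit_dist r B C + e"
      using triangle[OF xyz(1) mz(2,3)] n(2) m(2) xyz(3) by (simp add: compose_eq)
    then have "orbit_dist r (orb r x) (orb r z) < orbit_dist r A B + orbit_dist r B C + e"
      unfolding orbit_dist_less[OF xyz(1,3)] using N_sub(4)[OF n(1) m(1)] by blast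
    then show "orbit_dist r A C \<le> orbit_dist r A B + orbit_dist r B C + e" using xyz(4,6) by simp
  qed
qed

definition orbit_space :: "real \<Rightarrow> 'c set topology" where
  "orbit_space r = Metric_space.mtopology (orbits r) (orbit_dist r)"

lemma topspace_orbit_space: "r > 0 \<Longrightarrow> topspace (orbit_space r) = orbits r"
  unfolding orbit_space_def by (rule Metric_space.topspace_mtopology[OF orbit_metric])

definition orbit_proj :: "'c set \<Rightarrow> 'a" where
  "orbit_proj A = f (SOME a. a \<in> A)"

lemma orbit_proj: "y \<in> M \<Longrightarrow> orbit_proj (orb r y) = f y"
proof -
  assume y: "y \<in> M"
  have "(SOME a. a \<in> orb r y) \<in> orb r y" using orb_self[OF y] by (rule someI)
  then obtain n where n: "n \<in> N r" "(SOME a. a \<in> orb r y) = n y" unfolding orb_def by blast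
  have "n \<in> G" using n(1) N_subset by blast
  then show ?thesis unfolding orbit_proj_def n(2) using y by (rule f_invariant)
qed

text \<open>
  The metric topology on orbits is the quotient topology, expressed with the metric of \<open>M\<close>.
\<close>

lemma openin_orbit_space:
  assumes r: "r > 0"
  shows "openin (orbit_space r) U \<longleftrightarrow> U \<subseteq> orbits r \<and>
    (\<forall>x\<in>M. orb r x \<in> U \<longrightarrow> (\<exists>e>0. \<forall>y\<in>M. d x y < e \<longrightarrow> orb r y \<in> U))" (is "_ \<longleftrightarrow> ?R")
proof -
  interpret O: Metric_space "orbits r" "orbit_dist r" by (rule orbit_metric[OF r])
  have less: "orbit_dist r (orb r x) (orb r y) < e \<longleftrightarrow> (\<exists>n\<in>N r. d x (n y) < e)" if "x \<in> M" "y \<in> M" for x y e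
    using orbit_dist_less[OF that] .
  have "openin (orbit_space r) U \<longleftrightarrow> U \<subseteq> orbits r \<and> (\<forall>A. A \<in> U \<longrightarrow> (\<exists>e>0. O.mball A e \<subseteq> U))"
    unfolding orbit_space_def O.openin_mtopology ..
  also have "\<dots> \<longleftrightarrow> ?R"
  proof (intro conj_cong refl iffI ballI allI impI)
    fix x assume U: "\<forall>A. A \<in> U \<longrightarrow> (\<exists>e>0. O.mball A e \<subseteq> U)" and x: "x \<in> M" "orb r x \<in> U"
    then obtain e where e: "e > 0" "O.mball (orb r x) e \<subseteq> U" by blast
    have "orb r y \<in> U" if y: "y \<in> M" "d x y < e" for y
    proof -
      have "orbit_dist r (orb r x) (orb r y) < e"
        unfolding less[OF x(1) y(1)] using y by (intro bexI[OF _ N_sub(3)]) simp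
      moreover have "orb r x \<in> orbits r" "orb r y \<in> orbits r" using x y by (auto simp: orbits_def)
      ultimately have "orb r y \<in> O.mball (orb r x) e" by simp
      then show ?thesis using e(2) by auto
    qed
    then show "\<exists>e>0. \<forall>y\<in>M. d x y < e \<longrightarrow> orb r y \<in> U" using e(1) by auto
  next
    fix A assume US: "U \<subseteq> orbits r" and A: "A \<in> U"
      and U: "\<forall>x\<in>M. orb r x \<in> U \<longrightarrow> (\<exists>e>0. \<forall>y\<in>M. d x y < e \<longrightarrow> orb r y \<in> U)"
    obtain x where x: "x \<in> M" "A = orb r x" using A US by (auto simp: orbits_def)
    then obtain e where e: "e > 0" "\<And>y. y \<in> M \<Longrightarrow> d x y < e \<Longrightarrow> orb r y \<in> U" using U A by auto
    have "O.mball A e \<subseteq> U"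
    proof
      fix B assume "B \<in> O.mball A e"
      then have "B \<in> orbits r" "orbit_dist r A B < e" by auto
      then obtain y where y: "y \<in> M" "B = orb r y" "orbit_dist r A B < e" by (auto simp: orbits_def)
      then obtain n where n: "n \<in> N r" "d x (n y) < e" using less[OF x(1) y(1)] x(2) by auto
      then show "B \<in> U" using e(2)[OF N_sub(2)[OF n(1) y(1)] n(2)] orb_eq[OF y(1) n(1)] y(2) by simp
    qed
    then show "\<exists>e>0. O.mball A e \<subseteq> U" using e(1) by auto
  qed
  finally show ?thesis .
qed

lemma continuous_map_orb:
  assumes r: "r > 0" shows "continuous_map mtopology (orbit_space r) (orb r)"
  unfolding continuous_map_def topspace_orbit_space[OF r] topspace_mtopology
proof (intro conjI allI impI)
  show "orb r \<in> M \<rightarrow> orbits r" by (auto simp: orbits_def)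
  fix U assume U: "openin (orbit_space r) U"
  show "openin mtopology {x \<in> M. orb r x \<in> U}"
    unfolding openin_mtopology
  proof (intro conjI allI impI)
    fix x assume x: "x \<in> {x \<in> M. orb r x \<in> U}"
    then obtain e where "e > 0" "\<forall>y\<in>M. d x y < e \<longrightarrow> orb r y \<in> U"
      using U unfolding openin_orbit_space[OF r] by auto
    then show "\<exists>e>0. mball x e \<subseteq> {x \<in> M. orb r x \<in> U}" by (intro exI[of _ e]) auto
  qed auto
qed

lemma quotient_map_orb:
  assumes r: "r > 0" shows "quotient_map mtopology (orbit_space r) (orb r)"
proof (rule continuous_imp_quotient_map[OF continuous_map_orb[OF r] compact])
  show "Hausdorff_space (orbit_space r)"
    unfolding orbit_space_def by (rule Metric_space.Hausdorff_space_mtopology[OF orbit_metric[OF r]])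
  show "orb r ` topspace mtopology = topspace (orbit_space r)"
    by (simp add: topspace_orbit_space[OF r] orbits_def)
qed

lemma G_homeomorphic:
  assumes g: "g \<in> G" shows "homeomorphic_map mtopology mtopology g"
proof -
  have "continuous_map mtopology mtopology g" if g: "g \<in> G" for g
    unfolding metric_continuous_map[OF Metric_space_axioms]
    using isometry[OF g] G_sub(2)[OF g] by auto
  moreover obtain h where "h \<in> G" "\<forall>x\<in>M. h (g x) = x \<and> g (h x) = x" using G_sub(5)[OF g] by auto
  ultimately have "homeomorphic_maps mtopology mtopology g h"
    using g by (simp add: homeomorphic_maps_def)
  then show ?thesis unfolding homeomorphic_map_maps by auto
qed

lemma open_f: "open_map mtopology X f"
proof (rule orbit_map_open[where G = G])
  show "orbit_map (topspace mtopology) (topspace X) G f" using orb_f by simp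
  then show "quotient_map mtopology X f"
    by (intro continuous_imp_quotient_map[OF f compact X_Hausdorff]) (simp add: orbit_map_def)
qed (rule G_homeomorphic)

lemma image_orb:
  assumes g: "g \<in> G" and y: "y \<in> M"
  shows "g ` orb r y = orb r (g y)"
proof
  show "g ` orb r y \<subseteq> orb r (g y)"
  proof clarify
    fix x assume "x \<in> orb r y"
    then obtain n where n: "n \<in> N r" "x = n y" by (auto simp: orb_def)
    then obtain n' where "n' \<in> N r" "n' (g y) = g x" using N_normal[OF g n(1)] y by auto
    then show "g x \<in> orb r (g y)"
      unfolding orb_def by (intro image_eqI[of "g x" "\<lambda>n. n (g y)" n']) simp_all
  qed
  show "orb r (g y) \<subseteq> g ` orb r y"
  proof
    fix x assume "x \<in> orb r (g y)"
    then obtain n where n: "n \<in> N r" "x = n (g y)" by (auto simp: orb_def)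
    obtain h where h: "h \<in> G" "\<forall>x\<in>M. h (g x) = x \<and> g (h x) = x" using G_sub(5)[OF g] by auto
    have gy: "g y \<in> M" using G_sub(2)[OF g y] .
    obtain n' where n': "n' \<in> N r" "n' (h (g y)) = h (n (g y))" using N_normal[OF h(1) n(1)] gy by auto
    have "x = g (h x)" using h(2) n N_sub(2)[OF n(1) gy] by simp
    also have "h x = n' y" using n'(2) h(2) y n(2) by simp
    finally show "x \<in> g ` orb r y" using n'(1) by (auto simp: orb_def)
  qed
qed

text \<open>
  Two points of one fibre at distance less than \<open>r\<close> in the orbit space are related by an element of
  \<open>N r\<close>, hence equal; so the projection is injective on balls of radius \<open>r/2\<close>. The group \<open>G\<close> permutes
  the orbits of its normal subgroup \<open>N r\<close> and provides the deck transformations.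
\<close>

lemma galois_covering_orbit_space:
  assumes r: "r > 0"
  shows "galois_covering X (orbit_space r) orbit_proj"
  unfolding galois_covering_def topspace_orbit_space[OF r]
proof (intro conjI ballI impI)
  let ?Q = "orbit_space r"
  interpret O: Metric_space "orbits r" "orbit_dist r" by (rule orbit_metric[OF r])
  show "continuum ?Q"
    unfolding continuum_def
  proof (intro conjI)
    show "compact_space ?Q"
      using image_compactin[OF compact[unfolded compact_space_def] continuous_map_orb[OF r]]
      by (simp add: compact_space_def topspace_orbit_space[OF r] orbits_def)
    show "connected_space ?Q"
      using connected_space_quotient_map_image[OF quotient_map_orb[OF r] connected] .
    show "metrizable_space ?Q" unfolding orbit_space_def by (rule O.metrizable_space_mtopology)
  qed
  have comp: "orbit_proj (orb r y) = f y" if "y \<in> M" for y using orbit_proj[OF that] .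
  have "continuous_map mtopology X (orbit_proj \<circ> orb r)"
    by (rule continuous_map_eq[OF f]) (simp add: comp)
  then show "continuous_map ?Q X orbit_proj"
    using continuous_compose_quotient_map[OF quotient_map_orb[OF r]] by blast
  show "orbit_proj ` orbits r = topspace X"
  proof -
    have "orbit_proj ` orbits r = f ` M"
      unfolding orbits_def image_image using comp by (intro image_cong) auto
    then show ?thesis using orb_f by (simp add: orbit_map_def)
  qed
  show "open_map ?Q X orbit_proj"
    unfolding open_map_def
  proof (intro allI impI)
    fix U assume U: "openin ?Q U"
    have US: "U \<subseteq> orbits r" using U topspace_orbit_space[OF r] openin_subset by blast
    have "openin mtopology {x \<in> topspace mtopology. orb r x \<in> U}"
      by (rule openin_continuous_map_preimage[OF continuous_map_orb[OF r] U])
    then have "openin X (f ` {x \<in> M. orb r x \<in> U})" using open_f by (simp add: open_map_def)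
    moreover have "f ` {x \<in> M. orb r x \<in> U} = orbit_proj ` U"
    proof
      show "f ` {x \<in> M. orb r x \<in> U} \<subseteq> orbit_proj ` U"
      proof clarify
        fix x assume "x \<in> M" "orb r x \<in> U"
        then show "f x \<in> orbit_proj ` U" using comp by (metis imageI)
      qed
      show "orbit_proj ` U \<subseteq> f ` {x \<in> M. orb r x \<in> U}"
      proof clarify
        fix A assume A: "A \<in> U"
        then obtain x where "x \<in> M" "A = orb r x" using US by (auto simp: orbits_def)
        then show "orbit_proj A \<in> f ` {x \<in> M. orb r x \<in> U}" using A comp by auto
      qed
    qed
    ultimately show "openin X (orbit_proj ` U)" by simp
  qed
  show "locally_injective ?Q orbit_proj"
    unfolding locally_injective_def topspace_orbit_space[OF r]
  proof
    fix A assume A: "A \<in> orbits r"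
    have "inj_on orbit_proj (O.mball A (r/2))"
    proof (rule inj_onI)
      fix B D assume B: "B \<in> O.mball A (r/2)" and D: "D \<in> O.mball A (r/2)" and eq: "orbit_proj B = orbit_proj D"
      have "B \<in> orbits r" "D \<in> orbits r" using B D by auto
      then obtain u v where uv: "u \<in> M" "B = orb r u" "v \<in> M" "D = orb r v"
        by (auto simp: orbits_def)
      have "orbit_dist r B D < r"
        using O.triangle'[of B A D] O.commute[of A B] O.commute[of A D] B D by auto
      then obtain n where n: "n \<in> N r" "d u (n v) < r" using orbit_dist_less[OF uv(1,3)] uv by auto
      obtain g where g: "g \<in> G" "g u = v" using f_fibre[OF uv(1,3)] eq comp uv by auto
      have "compose M n g \<in> G" using n(1) N_subset g(1) by (intro G_sub(4)) auto
      moreover have "d u (compose M n g u) < r" using n(2) g(2) uv(1) by (simp add: compose_eq)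
      ultimately have ng: "compose M n g \<in> N r" using uv(1) by (intro small_in_N)
      have "orb r (n v) = orb r u" using orb_eq[OF uv(1) ng] g(2) uv(1) by (simp add: compose_eq)
      then show "B = D" using orb_eq[OF uv(3) n(1)] uv by simp
    qed
    moreover have "openin ?Q (O.mball A (r/2))" unfolding orbit_space_def by (rule O.openin_mball)
    moreover have "A \<in> O.mball A (r/2)" using A r by simp
    ultimately show "\<exists>V. openin ?Q V \<and> A \<in> V \<and> inj_on orbit_proj V" by blast
  qed
  fix A B assume A: "A \<in> orbits r" and B: "B \<in> orbits r" and eq: "orbit_proj A = orbit_proj B"
  obtain u v where uv: "u \<in> M" "A = orb r u" "v \<in> M" "B = orb r v"
    using A B by (auto simp: orbits_def)
  obtain g where g: "g \<in> G" "g u = v" using f_fibre[OF uv(1,3)] eq comp uv by auto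
  have cont: "continuous_map ?Q ?Q (image g)" if g: "g \<in> G" for g
  proof -
    have "continuous_map mtopology ?Q (image g \<circ> orb r)"
      by (rule continuous_map_eq[OF continuous_map_compose[OF homeomorphic_imp_continuous_map[OF G_homeomorphic[OF g]]
              continuous_map_orb[OF r]]]) (simp add: image_orb[OF g])
    then show ?thesis using continuous_compose_quotient_map[OF quotient_map_orb[OF r]] by blast
  qed
  obtain h where h: "h \<in> G" "\<forall>x\<in>M. h (g x) = x \<and> g (h x) = x" using G_sub(5)[OF g(1)] by auto
  have inv: "h ` g ` D = D" "g ` h ` D = D" if "D \<in> orbits r" for D
  proof -
    have "D \<subseteq> M" using that orb_subset by (auto simp: orbits_def)
    then have "h ` g ` D = (\<lambda>x. x) ` D" "g ` h ` D = (\<lambda>x. x) ` D"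
      unfolding image_image using h(2) by (intro image_cong; auto)+
    then show "h ` g ` D = D" "g ` h ` D = D" by simp_all
  qed
  have "homeomorphic_maps ?Q ?Q (image g) (image h)"
    unfolding homeomorphic_maps_def topspace_orbit_space[OF r]
    by (intro conjI ballI cont[OF g(1)] cont[OF h(1)] inv)
  then have "homeomorphic_map ?Q ?Q (image g)" unfolding homeomorphic_map_maps by blast
  moreover have "orbit_proj (g ` D) = orbit_proj D" if D: "D \<in> topspace ?Q" for D
  proof -
    obtain w where "w \<in> M" "D = orb r w" using D topspace_orbit_space[OF r] by (auto simp: orbits_def)
    then show ?thesis using image_orb[OF g(1)] comp G_sub(2)[OF g(1)] f_invariant[OF g(1)] by simp
  qed
  ultimately have "restrict (image g) (topspace ?Q) \<in> deck_group ?Q orbit_proj"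
    by (intro deck_groupI[where q = orbit_proj])
  moreover have "restrict (image g) (topspace ?Q) A = B"
    using A topspace_orbit_space[OF r] image_orb[OF g(1) uv(1)] g(2) uv by simp
  ultimately show "\<exists>g\<in>deck_group ?Q orbit_proj. g A = B" by blast
qed

text \<open>
  Elements of \<open>N r\<close> move all points by little if \<open>r\<close> is small.
\<close>

lemma orb_separates:
  assumes xy: "x \<in> M" "y \<in> M" and eq: "\<And>r. r > 0 \<Longrightarrow> orb r x = orb r y"
  shows "x = y"
proof (rule ccontr)
  assume "x \<noteq> y"
  then have "d y x > 0" using xy by simp
  then obtain r where r: "r > 0" "\<forall>n\<in>N r. \<forall>z\<in>M. d z (n z) < d y x" using N_small by blast
  obtain n where "n \<in> N r" "x = n y" using eq[OF r(1)] orb_eq_iff[OF xy] by auto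
  then show False using r(2) xy by auto
qed

text \<open>
  The map \<open>f\<close> itself need not be locally injective, but the composites of \<open>h\<close> and \<open>h'\<close> with the
  projections to all the orbit spaces are lifts along honest covers.
\<close>

lemma lift_unique_prodiscrete:
  assumes W: "connected_space W" and h: "continuous_map W mtopology h" "continuous_map W mtopology h'"
    and lift: "\<And>w. w \<in> topspace W \<Longrightarrow> f (h w) = f (h' w)"
    and v: "v \<in> topspace W" "h v = h' v" and w: "w \<in> topspace W"
  shows "h w = h' w"
proof (rule orb_separates)
  have into: "h w \<in> M" "h' w \<in> M" if "w \<in> topspace W" for w
    using h that by (auto simp: continuous_map_def)
  then show "h w \<in> M" "h' w \<in> M" using w by auto
  fix r :: real assume r: "r > 0"
  note Q = galois_coveringD[OF galois_covering_orbit_space[OF r]]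
  have "(orb r \<circ> h) w = (orb r \<circ> h') w"
  proof (rule unique_lift[OF W Q(5,9), where h = "orb r \<circ> h" and h' = "orb r \<circ> h'"])
    show "continuous_map W (orbit_space r) (orb r \<circ> h)" "continuous_map W (orbit_space r) (orb r \<circ> h')"
      using continuous_map_compose[OF h(1) continuous_map_orb[OF r]]
        continuous_map_compose[OF h(2) continuous_map_orb[OF r]] .
    show "orbit_proj ((orb r \<circ> h) w) = orbit_proj ((orb r \<circ> h') w)" if "w \<in> topspace W" for w
      using lift[OF that] into[OF that] by (simp add: orbit_proj)
    show "v \<in> topspace W" "(orb r \<circ> h) v = (orb r \<circ> h') v" "w \<in> topspace W" using v w by auto
  qed
  then show "orb r (h w) = orb r (h' w)" by simp
qed

end

section \<open>Lifting to the universal cover\<close>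

locale lifting_problem =
  pointed_covers X x0 I C K p c + isometric_prodiscrete_cover M d X G f
  for X :: "'a topology" and x0 :: 'a
    and I :: "'i set" and C :: "'i \<Rightarrow> 'b topology" and K :: "'i \<Rightarrow> ('b \<Rightarrow> 'b) set"
    and p :: "'i \<Rightarrow> 'b \<Rightarrow> 'a" and c :: "'i \<Rightarrow> 'b"
    and M :: "'c set" and d :: "'c \<Rightarrow> 'c \<Rightarrow> real" and G :: "('c \<Rightarrow> 'c) set" and f :: "'c \<Rightarrow> 'a"
begin

text \<open>
  Each orbit space, pointed by the orbit of one fixed point \<open>y0\<close> over \<open>x0\<close>, occurs in the family of
  covers.
\<close>

lemma orbit_space_models:
  obtains y0 i e where "y0 \<in> M"
    "\<And>r. r > 0 \<Longrightarrow> i r \<in> I"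
    "\<And>r. r > 0 \<Longrightarrow> homeomorphic_map (C (i r)) (orbit_space r) (e r)"
    "\<And>r y. r > 0 \<Longrightarrow> y \<in> topspace (C (i r)) \<Longrightarrow> orbit_proj (e r y) = p (i r) y"
    "\<And>r. r > 0 \<Longrightarrow> e r (c (i r)) = orb r y0"
proof -
  have "x0 \<in> f ` M" using orb_f x0 by (simp add: orbit_map_def)
  then obtain y0 where y0: "y0 \<in> M" "f y0 = x0" by blast
  have "\<exists>i e. i \<in> I \<and> homeomorphic_map (C i) (orbit_space r) e \<and>
      (\<forall>y\<in>topspace (C i). orbit_proj (e y) = p i y) \<and> e (c i) = orb r y0" if r: "r > 0" for r
  proof -
    have "orb r y0 \<in> topspace (orbit_space r)" using y0(1) by (simp add: topspace_orbit_space[OF r] orbits_def)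
    moreover have "orbit_proj (orb r y0) = x0" using orbit_proj[OF y0(1)] y0(2) by simp
    ultimately show ?thesis using cover_exists[OF galois_covering_orbit_space[OF r]] by blast
  qed
  then have "\<forall>r. \<exists>i e. r > 0 \<longrightarrow> i \<in> I \<and> homeomorphic_map (C i) (orbit_space r) e \<and>
      (\<forall>y\<in>topspace (C i). orbit_proj (e y) = p i y) \<and> e (c i) = orb r y0" by blast
  then obtain i e where "\<forall>r. r > 0 \<longrightarrow> i r \<in> I \<and> homeomorphic_map (C (i r)) (orbit_space r) (e r) \<and>
      (\<forall>y\<in>topspace (C (i r)). orbit_proj (e r y) = p (i r) y) \<and> e r (c (i r)) = orb r y0"
    unfolding choice_iff by blast
  then show ?thesis by (intro that[OF y0(1), of i e]) simp_all
qed

lemma continuous_refinement: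
  assumes s: "0 < s" "s \<le> r"
  obtains k where "continuous_map (orbit_space s) (orbit_space r) k" "\<And>u. u \<in> M \<Longrightarrow> k (orb s u) = orb r u"
proof -
  have r: "0 < r" using s by simp
  define k where "k A = orb r (SOME a. a \<in> A)" for A
  have k: "k (orb s u) = orb r u" if u: "u \<in> M" for u
  proof -
    have "(SOME a. a \<in> orb s u) \<in> orb s u" using orb_self[OF u] by (rule someI)
    then obtain n where n: "n \<in> N s" "(SOME a. a \<in> orb s u) = n u" unfolding orb_def by blast
    have "n \<in> N r" using n(1) N_mono[OF s(2)] by blast
    then show ?thesis unfolding k_def n(2) by (rule orb_eq[OF u])
  qed
  have "continuous_map mtopology (orbit_space r) (k \<circ> orb s)"
    by (rule continuous_map_eq[OF continuous_map_orb[OF r]]) (simp add: k)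
  then have "continuous_map (orbit_space s) (orbit_space r) k"
    by (rule continuous_compose_quotient_map[OF quotient_map_orb[OF s(1)]])
  then show ?thesis using k by (rule that)
qed

text \<open>
  The refinement map from the orbit space of \<open>N s\<close> to that of \<open>N r\<close> preserves the basepoints, so under the
  identifications \<open>e s\<close> and \<open>e r\<close> it is a bonding map, with which the coordinates of \<open>x\<close> are compatible.
\<close>

lemma orbit_models_compatible:
  assumes y0: "y0 \<in> M" and i: "\<And>r. r > 0 \<Longrightarrow> i r \<in> I"
    and e: "\<And>r. r > 0 \<Longrightarrow> homeomorphic_map (C (i r)) (orbit_space r) (e r)"
      "\<And>r y. r > 0 \<Longrightarrow> y \<in> topspace (C (i r)) \<Longrightarrow> orbit_proj (e r y) = p (i r) y"
      "\<And>r. r > 0 \<Longrightarrow> e r (c (i r)) = orb r y0"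
    and s: "0 < s" "s \<le> r" and x: "x \<in> topspace Xhat" and u: "u \<in> M" "orb s u = e s (x (i s))"
  shows "orb r u = e r (x (i r))"
proof -
  have r: "0 < r" using s by simp
  let ?i = "i r" and ?j = "i s"
  obtain k where k: "continuous_map (orbit_space s) (orbit_space r) k" "\<And>u. u \<in> M \<Longrightarrow> k (orb s u) = orb r u"
    using continuous_refinement[OF s] by blast
  obtain e' where e': "homeomorphic_maps (C ?i) (orbit_space r) (e r) e'"
    using e(1)[OF r] unfolding homeomorphic_map_maps by blast
  have e'c: "continuous_map (orbit_space r) (C ?i) e'"
    and e'e: "\<And>z. z \<in> topspace (C ?i) \<Longrightarrow> e' (e r z) = z" "\<And>A. A \<in> orbits r \<Longrightarrow> e r (e' A) = A"
    using e' by (auto simp: homeomorphic_maps_def topspace_orbit_space[OF r])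
  \<comment> \<open>The refinement map seen as a map between members of the family.\<close>
  define h where "h = e' \<circ> (k \<circ> e s)"
  have h: "continuous_map (C ?j) (C ?i) h"
    unfolding h_def
    by (intro continuous_map_compose[OF continuous_map_compose[OF homeomorphic_imp_continuous_map[OF e(1)[OF s(1)]] k(1)] e'c])
  have lift: "e r (h y) = orb r v" "p ?i (h y) = p ?j y" if y: "y \<in> topspace (C ?j)" and v: "v \<in> M" "e s y = orb s v" for y v
  proof -
    have hy: "h y = e' (orb r v)" using k(2)[OF v(1)] v(2) by (simp add: h_def)
    have ov: "orb r v \<in> orbits r" using v(1) by (simp add: orbits_def)
    then show eh: "e r (h y) = orb r v" using hy e'e(2) by simp
    have "h y \<in> topspace (C ?i)" using h y by (auto simp: continuous_map_def)
    then have "p ?i (h y) = orbit_proj (orb r v)" using e(2)[OF r] eh by metis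
    also have "\<dots> = orbit_proj (orb s v)" using orbit_proj[OF v(1)] by simp
    also have "\<dots> = p ?j y" using e(2)[OF s(1) y] v(2) by simp
    finally show "p ?i (h y) = p ?j y" .
  qed
  have ex: "\<exists>v\<in>M. e s y = orb s v" if "y \<in> topspace (C ?j)" for y
    using homeomorphic_map_into[OF e(1)[OF s(1)] that] by (auto simp: topspace_orbit_space[OF s(1)] orbits_def)
  have 1: "p ?i (h y) = p ?j y" if "y \<in> topspace (C ?j)" for y
    using ex[OF that] lift(2)[OF that] by blast
  have "h (c ?j) = e' (e r (c ?i))" using k(2)[OF y0] e(3) r s(1) by (simp add: h_def)
  then have 2: "h (c ?j) = c ?i" using e'e(1) base(1)[OF i[OF r]] by simp
  have xj: "x ?j \<in> topspace (C ?j)" using Xhat_coordinate[OF x i[OF s(1)]] .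
  have "cover_le C p ?i ?j" using bond_exists(1)[OF i[OF r] i[OF s(1)] h 1 2] .
  then have "x ?i = bond ?i ?j (x ?j)" using x i[OF r] i[OF s(1)] unfolding in_Xhat by simp
  also have "\<dots> = h (x ?j)" using bond_exists(2)[OF i[OF r] i[OF s(1)] h 1 2 xj] .
  finally show ?thesis using lift(1)[OF xj u(1)] u(2) by simp
qed

text \<open>
  The coordinates \<open>i r\<close> of \<open>x\<close> are orbits \<open>e r (x (i r))\<close> that decrease as \<open>r\<close> decreases; they have a
  common point by compactness and only one because small orbits have small diameter.
\<close>

lemma lift_exists:
  obtains h where "continuous_map Xhat mtopology h" "h ` topspace Xhat = M"
    "\<And>x. x \<in> topspace Xhat \<Longrightarrow> f (h x) = phi x"
proof -
  obtain y0 i e where y0: "y0 \<in> M" and i: "\<And>r. r > 0 \<Longrightarrow> i r \<in> I"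
    and e: "\<And>r. r > 0 \<Longrightarrow> homeomorphic_map (C (i r)) (orbit_space r) (e r)"
      "\<And>r y. r > 0 \<Longrightarrow> y \<in> topspace (C (i r)) \<Longrightarrow> orbit_proj (e r y) = p (i r) y"
      "\<And>r. r > 0 \<Longrightarrow> e r (c (i r)) = orb r y0"
    using orbit_space_models by metis
  have compatible: "orb r u = e r (x (i r))"
    if "0 < s" "s \<le> r" "x \<in> topspace Xhat" "u \<in> M" "orb s u = e s (x (i s))" for r s x u
    by (rule orbit_models_compatible[where i = i and e = e and s = s, OF y0 _ _ _ _ that]) (simp_all add: i e)
  let ?R = "{r::real. r > 0}"
  have R: "?R \<noteq> {}" using zero_less_one by blast
  have Hausdorff: "Hausdorff_space (orbit_space r)" if "r > 0" for r
    using galois_coveringD(5)[OF galois_covering_orbit_space[OF that]] .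
  have ex: "e r (x (i r)) \<in> topspace (orbit_space r)" if "r > 0" "x \<in> topspace Xhat" for r x
    using homeomorphic_map_into[OF e(1)[OF that(1)] Xhat_coordinate[OF that(2) i[OF that(1)]]] .
  have "\<exists>u. u \<in> M \<and> (\<forall>r>0. orb r u = e r (x (i r)))" if x: "x \<in> topspace Xhat" for x
  proof -
    let ?T = "\<lambda>r. {u \<in> topspace mtopology. orb r u \<in> {e r (x (i r))}}"
    have "(\<Inter>r\<in>?R. ?T r) \<noteq> {}"
    proof (rule directed_closed_Inter_nonempty[OF compact R])
      fix r assume "r \<in> ?R"
      then have r: "r > 0" by simp
      show "closedin mtopology (?T r)"
        by (rule closedin_continuous_map_preimage[OF continuous_map_orb[OF r]
              closedin_Hausdorff_singleton[OF Hausdorff[OF r] ex[OF r x]]])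
      show "?T r \<noteq> {}" using ex[OF r x] by (auto simp: topspace_orbit_space[OF r] orbits_def)
    next
      fix r s assume "r \<in> ?R" "s \<in> ?R"
      then have m: "0 < min r s" "min r s \<le> r" "min r s \<le> s" by auto
      have "?T (min r s) \<subseteq> ?T r" "?T (min r s) \<subseteq> ?T s"
        using compatible[OF m(1,2) x] compatible[OF m(1,3) x] by auto
      then show "\<exists>k\<in>?R. ?T k \<subseteq> ?T r \<and> ?T k \<subseteq> ?T s" using m(1) by (intro bexI[of _ "min r s"] conjI) simp_all
    qed
    then obtain u where u: "\<And>r. r > 0 \<Longrightarrow> u \<in> ?T r" by blast
    show ?thesis using u[OF zero_less_one] u by (intro exI[of _ u]) auto
  qed
  then obtain h where hM: "\<And>x. x \<in> topspace Xhat \<Longrightarrow> h x \<in> M"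
    and h: "\<And>x r. x \<in> topspace Xhat \<Longrightarrow> r > 0 \<Longrightarrow> orb r (h x) = e r (x (i r))"
    by metis
  have lift: "f (h x) = phi x" if x: "x \<in> topspace Xhat" for x
  proof -
    have r: "(0::real) < 1" by simp
    have "f (h x) = orbit_proj (e 1 (x (i 1)))" using orbit_proj[OF hM[OF x]] h[OF x r] by metis
    also have "\<dots> = p (i 1) (x (i 1))" using e(2)[OF r Xhat_coordinate[OF x i[OF r]]] .
    finally show ?thesis using phi_eq[OF x i[OF r]] by simp
  qed
  have cont_e: "continuous_map Xhat (orbit_space r) (e r \<circ> (\<lambda>x. x (i r)))" if r: "r > 0" for r
    by (rule continuous_map_compose[OF continuous_coordinate[OF i[OF r]] homeomorphic_imp_continuous_map[OF e(1)[OF r]]])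
  have "continuous_map Xhat mtopology h"
    unfolding continuous_map_to_metric
  proof (intro ballI allI impI)
    fix x and a :: real assume x: "x \<in> topspace Xhat" and a: "a > 0"
    obtain r where r: "r > 0" "\<forall>n\<in>N r. \<forall>y\<in>M. d y (n y) < a/2" using N_small[of "a/2"] a by auto
    interpret O: Metric_space "orbits r" "orbit_dist r" by (rule orbit_metric[OF r(1)])
    let ?V = "O.mball (orb r (h x)) (a/2)"
    \<comment> \<open>Half of \<open>a\<close> is spent on the distance of orbits, the other half on the size of orbits.\<close>
    let ?U = "{y \<in> topspace Xhat. (e r \<circ> (\<lambda>x. x (i r))) y \<in> ?V}"
    have "openin (orbit_space r) ?V" unfolding orbit_space_def by (rule O.openin_mball)
    then have "openin Xhat ?U" by (rule openin_continuous_map_preimage[OF cont_e[OF r(1)]])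
    moreover have "x \<in> ?U"
    proof -
      have "orb r (h x) \<in> orbits r" using hM[OF x] by (simp add: orbits_def)
      then have "orb r (h x) \<in> ?V" using a by simp
      then show ?thesis using x a h[OF x r(1)] by simp
    qed
    moreover have "\<forall>y\<in>?U. h y \<in> mball (h x) a"
    proof
      fix y assume y: "y \<in> ?U"
      then have yX: "y \<in> topspace Xhat" by simp
      have "orb r (h y) \<in> ?V" using y h[OF yX r(1)] by simp
      then have "orbit_dist r (orb r (h x)) (orb r (h y)) < a/2" by simp
      then obtain n where n: "n \<in> N r" "d (h x) (n (h y)) < a/2"
        unfolding orbit_dist_less[OF hM[OF x] hM[OF yX]] by blast
      have "d (h y) (n (h y)) < a/2" using r(2) n(1) hM[OF yX] by blast
      then have "d (h x) (h y) < a"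
        using triangle'[OF hM[OF x] N_sub(2)[OF n(1) hM[OF yX]] hM[OF yX]] n(2) by linarith
      then show "h y \<in> mball (h x) a" using hM[OF x] hM[OF yX] by simp
    qed
    ultimately show "\<exists>U. openin Xhat U \<and> x \<in> U \<and> (\<forall>y\<in>U. h y \<in> mball (h x) a)"
      by (intro exI[of _ ?U] conjI)
  qed
  moreover have "h ` topspace Xhat = M"
  proof
    show "h ` topspace Xhat \<subseteq> M" using hM by (rule image_subsetI)
    show "M \<subseteq> h ` topspace Xhat"
    proof
      fix y assume y: "y \<in> M"
      let ?T = "\<lambda>r. {x \<in> topspace Xhat. (e r \<circ> (\<lambda>x. x (i r))) x \<in> {orb r y}}"
      have oy: "orb r y \<in> topspace (orbit_space r)" if "r > 0" for r
        using y by (simp add: topspace_orbit_space[OF that] orbits_def)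
      have "(\<Inter>r\<in>?R. ?T r) \<noteq> {}"
      proof (rule directed_closed_Inter_nonempty[OF Xhat_space(1) R])
        fix r assume "r \<in> ?R"
        then have r: "r > 0" by simp
        show "closedin Xhat (?T r)"
          by (rule closedin_continuous_map_preimage[OF cont_e[OF r]
                closedin_Hausdorff_singleton[OF Hausdorff[OF r] oy[OF r]]])
        have "orb r y \<in> e r ` topspace (C (i r))"
          unfolding homeomorphic_imp_surjective_map[OF e(1)[OF r]] by (rule oy[OF r])
        then obtain z where z: "z \<in> topspace (C (i r))" "e r z = orb r y" by blast
        obtain x where "x \<in> topspace Xhat" "x (i r) = z" using coordinate_surjective[OF i[OF r] z(1)] .
        then have "x \<in> ?T r" using z(2) by simp
        then show "?T r \<noteq> {}" by blast
      next
        fix r s assume "r \<in> ?R" "s \<in> ?R"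
        then have m: "0 < min r s" "min r s \<le> r" "min r s \<le> s" by auto
        have "?T (min r s) \<subseteq> ?T r" "?T (min r s) \<subseteq> ?T s"
          using compatible[OF m(1,2) _ y] compatible[OF m(1,3) _ y] by auto
        then show "\<exists>k\<in>?R. ?T k \<subseteq> ?T r \<and> ?T k \<subseteq> ?T s" using m(1) by (intro bexI[of _ "min r s"] conjI) simp_all
      qed
      then obtain x where xT: "\<And>r. r > 0 \<Longrightarrow> x \<in> ?T r" by blast
      have x: "x \<in> topspace Xhat" using xT[OF zero_less_one] by simp
      have "h x = y"
      proof (rule orb_separates[OF hM[OF x] y])
        show "orb r (h x) = orb r y" if "r > 0" for r using h[OF x that] xT[OF that] by simp
      qed
      then show "y \<in> h ` topspace Xhat" using x by (intro image_eqI) simp_all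
    qed
  qed
  ultimately show ?thesis using lift by (rule that)
qed

text \<open>
  The deck group of \<open>h\<close> is a subgroup of that of the projection of the limit. It is transitive on
  the fibres of \<open>h\<close>: if \<open>h x = h y\<close>, then some deck transformation \<open>g\<close> of the limit moves \<open>x\<close> to \<open>y\<close>, and
  \<open>h \<circ> g\<close> and \<open>h\<close> are lifts that agree at \<open>x\<close>.
\<close>

lemma lift_is_generalized_regular_covering:
  assumes h: "continuous_map Xhat mtopology h" "h ` topspace Xhat = M"
    and lift: "\<And>x. x \<in> topspace Xhat \<Longrightarrow> f (h x) = phi x"
  shows "compact_generalized_regular_covering Xhat mtopology (deck_group Xhat h) h"
proof -
  have sub: "deck_group Xhat h \<subseteq> deck_group Xhat phi"
  proof
    fix g assume g: "g \<in> deck_group Xhat h"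
    have "phi (g x) = phi x" if x: "x \<in> topspace Xhat" for x
      using lift[OF x] lift[OF deck_groupD(3)[OF g x]] deck_groupD(2)[OF g x] by simp
    then show "g \<in> deck_group Xhat phi" using g by (simp add: deck_group_def)
  qed
  have "orbit_map (topspace Xhat) (topspace mtopology) (deck_group Xhat h) h"
    unfolding orbit_map_def
  proof (intro conjI ballI iffI)
    show "h ` topspace Xhat = topspace mtopology" using h(2) by simp
    fix x y assume x: "x \<in> topspace Xhat" and y: "y \<in> topspace Xhat"
    show "h x = h y" if "\<exists>g\<in>deck_group Xhat h. g x = y" using that deck_groupD(2)[OF _ x, of _ h] by auto
    assume eq: "h x = h y"
    then have "phi x = phi y" using lift[OF x] lift[OF y] by simp
    then obtain g where g: "g \<in> deck_group Xhat phi" "g x = y" using deck_transitive[OF x y] by blast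
    have "(h \<circ> g) z = h z" if z: "z \<in> topspace Xhat" for z
    proof (rule lift_unique_prodiscrete[OF Xhat_space(3), where v = x])
      show "continuous_map Xhat mtopology (h \<circ> g)"
        using continuous_map_compose[OF homeomorphic_imp_continuous_map[OF deck_groupD(1)[OF g(1)]] h(1)] .
      show "f ((h \<circ> g) w) = f (h w)" if w: "w \<in> topspace Xhat" for w
        using lift[OF w] lift[OF deck_groupD(3)[OF g(1) w]] deck_groupD(2)[OF g(1) w] by simp
      show "(h \<circ> g) x = h x" using eq g(2) by simp
    qed (fact h(1) x z)+
    then have "g \<in> deck_group Xhat h" using g(1) by (simp add: deck_group_def)
    then show "\<exists>g\<in>deck_group Xhat h. g x = y" using g(2) by blast
  qed
  then show ?thesis
    using h(1) sub subgroup_deck_group[of Xhat h]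
    by (intro compact_generalized_regular_coveringI Xhat_space(1,2) compact Hausdorff_space_mtopology
        deck_subgroup_acts_isomorphically deck_subgroup_acts_prodiscretely)
qed

text \<open>
  For another lift \<open>k\<close>, transitivity of \<open>G\<close> on fibres gives \<open>g\<close> with \<open>k = g \<circ> h\<close> at the basepoint, hence
  everywhere.
\<close>

lemma unique_lift_mod_deck_group:
  "\<exists>f_L. f_L \<in> gen_covering_lifts Xhat mtopology phi f \<and>
     gen_covering_lifts Xhat mtopology phi f = {compose (topspace Xhat) g f_L |g. g \<in> G}"
proof -
  let ?S = "topspace Xhat" and ?L = "gen_covering_lifts Xhat mtopology phi f"
  obtain h0 where h0: "continuous_map Xhat mtopology h0" "h0 ` ?S = M" "\<And>x. x \<in> ?S \<Longrightarrow> f (h0 x) = phi x"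
    using lift_exists by metis
  define h where "h = restrict h0 ?S"
  have h: "continuous_map Xhat mtopology h" "h ` ?S = M" "\<And>x. x \<in> ?S \<Longrightarrow> f (h x) = phi x"
    using h0 by (simp_all add: h_def)
  have hM: "x \<in> ?S \<Longrightarrow> h x \<in> M" for x using h(2) by blast
  have liftI: "k \<in> ?L" if "k \<in> extensional ?S" "continuous_map Xhat mtopology k" "k ` ?S = M"
      "\<And>x. x \<in> ?S \<Longrightarrow> f (k x) = phi x" for k
    unfolding gen_covering_lifts_def
    using that lift_is_generalized_regular_covering[OF that(2-4)] by (auto simp: PiE_iff)
  have hL: "h \<in> ?L" using h by (intro liftI) (auto simp: h_def)
  have "?L = {compose ?S g h |g. g \<in> G}"
  proof
    show "{compose ?S g h |g. g \<in> G} \<subseteq> ?L"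
    proof clarify
      fix g assume g: "g \<in> G"
      note gh = G_homeomorphic[OF g]
      show "compose ?S g h \<in> ?L"
      proof (rule liftI)
        show "compose ?S g h \<in> extensional ?S" by (simp add: compose_def)
        show "continuous_map Xhat mtopology (compose ?S g h)"
          by (rule continuous_map_eq[OF continuous_map_compose[OF h(1) homeomorphic_imp_continuous_map[OF gh]]])
            (simp add: compose_eq)
        have "compose ?S g h ` ?S = g ` h ` ?S" by (auto simp: compose_def image_image)
        then show "compose ?S g h ` ?S = M"
          using h(2) homeomorphic_imp_surjective_map[OF gh] by simp
        show "f (compose ?S g h x) = phi x" if "x \<in> ?S" for x
          using that f_invariant[OF g hM] h(3) by (simp add: compose_eq)
      qed
    qed
    show "?L \<subseteq> {compose ?S g h |g. g \<in> G}"
    proof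
      fix k assume k: "k \<in> ?L"
      then obtain H where H: "compact_generalized_regular_covering Xhat mtopology H k"
        and kE: "k \<in> ?S \<rightarrow>\<^sub>E M" and kl: "\<And>x. x \<in> ?S \<Longrightarrow> f (k x) = phi x"
        unfolding gen_covering_lifts_def by auto
      have kc: "continuous_map Xhat mtopology k"
        using compact_generalized_regular_coveringD(6)[OF Xhat_space(1,2) compact Hausdorff_space_mtopology H] .
      let ?v = "restrict c I"
      note v = base_in_Xhat
      have "k ?v \<in> M" using kE v by (auto simp: PiE_iff)
      then obtain g where g: "g \<in> G" "g (h ?v) = k ?v"
        using f_fibre[OF hM[OF v], of "k ?v"] h(3)[OF v] kl[OF v] by auto
      have "k w = (g \<circ> h) w" if w: "w \<in> ?S" for w
      proof (rule lift_unique_prodiscrete[OF Xhat_space(3) kc _ _ v _ w])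
        show "continuous_map Xhat mtopology (g \<circ> h)"
          using continuous_map_compose[OF h(1) homeomorphic_imp_continuous_map[OF G_homeomorphic[OF g(1)]]] .
        show "f (k z) = f ((g \<circ> h) z)" if "z \<in> ?S" for z
          using that kl h(3) f_invariant[OF g(1) hM] by simp
        show "k ?v = (g \<circ> h) ?v" using g(2) by simp
      qed
      then have "k = compose ?S g h"
        using kE by (intro extensionalityI[of _ ?S]) (auto simp: compose_def PiE_iff)
      then show "k \<in> {compose ?S g h |g. g \<in> G}" using g(1) by blast
    qed
  qed
  then show ?thesis using hL by blast
qed

end

theorem theorem4:
  fixes X :: "'a topology" and x0 :: 'a
    and I :: "'i set" and C :: "'i \<Rightarrow> 'b topology" and K :: "'i \<Rightarrow> ('b \<Rightarrow> 'b) set"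
    and p :: "'i \<Rightarrow> 'b \<Rightarrow> 'a" and c :: "'i \<Rightarrow> 'b"
    and Y :: "'c topology" and G :: "('c \<Rightarrow> 'c) set" and f :: "'c \<Rightarrow> 'a"
  defines "Xhat \<equiv> universal_cover I C p c"
    and "phihat \<equiv> universal_proj I p"
  assumes "continuum X"
    and "all_pointed_covers X x0 I C K p c"
    and "continuum Y"
    and "compact_generalized_regular_covering Y X G f"
  shows "\<exists>f_L. f_L \<in> gen_covering_lifts Xhat Y phihat f \<and>
           gen_covering_lifts Xhat Y phihat f = {compose (topspace Xhat) g f_L |g. g \<in> G}"
proof -
  have X: "compact_space X" "Hausdorff_space X"
    using assms(3) continuum_Hausdorff by (auto simp: continuum_def)
  have Y: "compact_space Y" "Hausdorff_space Y" "connected_space Y" "metrizable_space Y"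
    using assms(5) continuum_Hausdorff by (auto simp: continuum_def)
  note cov = compact_generalized_regular_coveringD[OF Y(1,2) X assms(6)]
  obtain d where "Metric_space (topspace Y) d" and Yd: "Metric_space.mtopology (topspace Y) d = Y"
    and d: "\<And>g x y. g \<in> G \<Longrightarrow> x \<in> topspace Y \<Longrightarrow> y \<in> topspace Y \<Longrightarrow> d (g x) (g y) = d x y"
    using invariant_metric[OF Y(1,4) cov(1,2)] by blast
  interpret Y: Metric_space "topspace Y" d by fact
  have uY: "compact_uniformity Y = {E. E \<subseteq> topspace Y \<times> topspace Y \<and> sym E \<and>
      (\<exists>e>0. \<forall>x\<in>topspace Y. \<forall>y\<in>topspace Y. d x y < e \<longrightarrow> (x, y) \<in> E)}"
    using compact_uniformity_metric[OF Y.Metric_space_axioms] Y(1) Yd by simp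
  have prodiscrete: "\<exists>r>0. \<forall>n\<in>N_set (topspace Y) {(x, y). x \<in> topspace Y \<and> y \<in> topspace Y \<and> d x y < r} G.
      \<forall>y\<in>topspace Y. d y (n y) < e" if e: "e > 0" for e
  proof -
    let ?E = "{(x, y). x \<in> topspace Y \<and> y \<in> topspace Y \<and> d x y < e}"
    have "?E \<in> compact_uniformity Y"
      unfolding uY using e by (auto simp: sym_def Y.commute intro!: exI[of _ e])
    then obtain F where F: "F \<in> compact_uniformity Y" "N_set (topspace Y) F G \<subseteq> U_set (topspace Y) ?E G"
      using cov(3) unfolding acts_prodiscretely_def by blast
    obtain r where r: "r > 0" "\<forall>x\<in>topspace Y. \<forall>y\<in>topspace Y. d x y < r \<longrightarrow> (x, y) \<in> F"
      using F(1) unfolding uY by blast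
    let ?D = "{(x, y). x \<in> topspace Y \<and> y \<in> topspace Y \<and> d x y < r}"
    have "N_set (topspace Y) ?D G \<subseteq> N_set (topspace Y) F G"
      unfolding N_set_def
      by (rule group.mono_generate[OF group_BijGroup]) (use r(2) in \<open>auto simp: S_set_def\<close>)
    then have "\<forall>n\<in>N_set (topspace Y) ?D G. \<forall>y\<in>topspace Y. d y (n y) < e"
      using F(2) by (auto simp: U_set_def)
    then show ?thesis using r(1) by blast
  qed
  interpret lifting_problem X x0 I C K p c "topspace Y" d G f
  proof (intro lifting_problem.intro pointed_covers.intro isometric_prodiscrete_cover.intro
      isometric_prodiscrete_cover_axioms.intro)
    show "continuum X" "all_pointed_covers X x0 I C K p c" by fact+
    show "compact_space Y.mtopology" "connected_space Y.mtopology" using Y Yd by simp_all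
    show "continuous_map Y.mtopology X f" using cov(6) Yd by simp
  qed (fact Y.Metric_space_axioms X(2) cov(1) cov(4) d prodiscrete)+
  show ?thesis
    using unique_lift_mod_deck_group unfolding Xhat_def phihat_def Yd .
qed

end
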